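(* Assume that $\sigma(\Gamma) < \infty$ and that $$H^1_0(\Omega) = \{u \in H^1(\Omega) : 0 \text{ is a trace of } u\}.$$ Let $\varphi \in C(\Gamma)$. (a) Suppose in addition that $\varphi \in \mathrm{Tr}(\Omega)$ and let $u \in H^1(\Omega)$ be the variational solution of the Dirichlet problem $(D_\varphi)$. Then $T\varphi = u$. (b) If $T\varphi \in H^1(\Omega)$, then $\varphi$ is a trace of $T\varphi$. Consequently, $T\varphi$ is the variational solution of the Dirichlet problem $(D_\varphi)$ and $\varphi \in \mathrm{Tr}(\Omega)$.
   Context: Setting: $d \ge 2$, $\Omega \subset \mathbb R^d$ is open and bounded with boundary $\Gamma = \partial\Omega$; functions are complex-valued unless said otherwise. For $k,l \in \{1,\ldots,d\}$, $a_{kl} \colon \Omega \to \mathbb R$ is bounded and measurable, and there is $\mu \in (0,1]$ with $\mathrm{Re} \sum_{k,l=1}^d a_{kl}(x)\,\xi_k\,\overline{\xi_l} \ge \mu|\xi|^2$ for all $x \in \Omega$, $\xi \in \mathbb C^d$. Further $b_k, c_0 \colon \Omega \to \mathbb C$ and $c_k \colon \Omega \to \mathbb R$ ($k=1,\ldots,d$) are bounded and measurable. $\mathcal D'(\Omega)$ is the antidual of $\mathcal D(\Omega) = C_c^\infty(\Omega)$. Define $\mathcal A \colon H^1_{\mathrm{loc}}(\Omega) \to \mathcal D'(\Omega)$ by $$\langle \mathcal A u, v\rangle = \sum_{k,l=1}^d \int_\Omega a_{kl}(\partial_l u)\overline{\partial_k v} + \sum_{k=1}^d \int_\Omega b_k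 u\,\overline{\partial_k v} + \sum_{k=1}^d \int_\Omega c_k(\partial_k u)\overline v + \int_\Omega c_0 u \overline v$$ for $v \in C_c^\infty(\Omega)$. A function $u$ is called $\mathcal A$-harmonic if $u \in H^1_{\mathrm{loc}}(\Omega)$ and $\mathcal A u = 0$. Standing assumption: $0$ is not a Dirichlet eigenvalue, i.e. if $u \in H^1_0(\Omega)$ and $\mathcal A u = 0$, then $u = 0$. Perron solution operator: $T \colon C(\Gamma) \to C_b(\Omega)$ is the unique bounded linear map (supremum norms; $C_b(\Omega)$ is the space of bounded continuous functions) such that $T\varphi$ is $\mathcal A$-harmonic for all $\varphi \in C(\Gamma)$ and $\Phi|_\Omega - T(\Phi|_\Gamma) \in H^1_0(\Omega)$ for all $\Phi \in C(\overline\Omega)\cap H^1(\Omega)$. Such a map exists and is unique. Traces: $\sigma$ is the $(d-1)$-dimensional Hausdorff measure on $\Gamma$, and $L_2(\Gamma) = L_2(\Gamma,\sigma)$. For $u \in H^1(\Omega)$ and $\varphi \in L_2(\Gamma)$, $\varphi$ is called a (approximative) trace of $u$ if there are $u_1, u_2, \ldots \in H^1(\Omega) \cap C(\overline\Omega)$ with $u_n \to u$ in $H^1(\Omega)$ and $u_n|_\Gamma \to \varphi$ in $L_2(\Gamma)$. $\mathrm{Tr}(\Omega)$ is the set of $\varphi \in L_2(\Gamma)$ that are a trace of some $u \in H^1(\Omega)$. For $\varphi \in \mathrm{Tr}(\Omega)$, a variational solution of the Dirichlet problem $(D_\varphi)$ is an $\mathcal A$-harmonic $u \in H^1(\Omega)$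 having $\varphi$ as a trace; under the displayed assumption in the claim it exists and is unique for each $\varphi \in \mathrm{Tr}(\Omega)$. *)

theory Defs
  imports "HOL-Analysis.Analysis"
begin

text \<open>
  Elements of \<open>L\<^sub>2\<close> and of Sobolev spaces on \<open>\<Omega>\<close> are represented by total functions on \<open>real ^ 'n\<close>;
  their values off \<open>\<Omega>\<close> are irrelevant, and two of them are the same element iff they agree
  almost everywhere with respect to \<open>lebesgue_on \<Omega>\<close>. Likewise elements of \<open>L\<^sub>2(\<Gamma>)\<close> and of \<open>C(\<Gamma>)\<close> are
  represented by total functions of which only the values on \<open>\<Gamma> = frontier \<Omega>\<close> matter.
\<close>

section \<open>Test functions\<close>

definition partial_deriv :: "'n::finite \<Rightarrow> (real ^ 'n \<Rightarrow> complex) \<Rightarrow> real ^ 'n \<Rightarrow> complex" where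
  "partial_deriv k f x = frechet_derivative f (at x) (axis k 1)"

fun C_k :: "nat \<Rightarrow> (real ^ 'n::finite \<Rightarrow> complex) \<Rightarrow> bool" where
  "C_k 0 f \<longleftrightarrow> continuous_on UNIV f"
| "C_k (Suc m) f \<longleftrightarrow> (\<forall>x. f differentiable (at x)) \<and> (\<forall>k. C_k m (partial_deriv k f))"

text \<open>\<open>C\<^sub>c\<^sup>\<infinity>(\<Omega>)\<close>, every function being extended by zero to the whole space.\<close>

definition test_functions :: "(real ^ 'n::finite) set \<Rightarrow> (real ^ 'n \<Rightarrow> complex) set" where
  "test_functions \<Omega> = {v. (\<forall>m. C_k m v) \<and>
     compact (closure {x. v x \<noteq> 0}) \<and> closure {x. v x \<noteq> 0} \<subseteq> \<Omega>}"

section \<open>Sobolev spaces\<close>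

definition L2 :: "'a measure \<Rightarrow> ('a \<Rightarrow> complex) set" where
  "L2 M = {f. f \<in> borel_measurable M \<and> integrable M (\<lambda>x. (norm (f x))\<^sup>2)}"

definition L2_norm :: "'a measure \<Rightarrow> ('a \<Rightarrow> complex) \<Rightarrow> real" where
  "L2_norm M f = sqrt (\<integral>x. (norm (f x))\<^sup>2 \<partial>M)"

definition L1_loc :: "(real ^ 'n::finite) set \<Rightarrow> (real ^ 'n \<Rightarrow> complex) set" where
  "L1_loc \<Omega> = {f. f \<in> borel_measurable (lebesgue_on \<Omega>) \<and>
     (\<forall>K. compact K \<and> K \<subseteq> \<Omega> \<longrightarrow> integrable (lebesgue_on K) f)}"

definition L2_loc :: "(real ^ 'n::finite) set \<Rightarrow> (real ^ 'n \<Rightarrow> complex) set" where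
  "L2_loc \<Omega> = {f. f \<in> borel_measurable (lebesgue_on \<Omega>) \<and>
     (\<forall>K. compact K \<and> K \<subseteq> \<Omega> \<longrightarrow> f \<in> L2 (lebesgue_on K))}"

definition is_weak_deriv ::
    "(real ^ 'n::finite) set \<Rightarrow> 'n \<Rightarrow> (real ^ 'n \<Rightarrow> complex) \<Rightarrow> (real ^ 'n \<Rightarrow> complex) \<Rightarrow> bool" where
  "is_weak_deriv \<Omega> k u g \<longleftrightarrow> u \<in> L1_loc \<Omega> \<and> g \<in> L1_loc \<Omega> \<and>
     (\<forall>v \<in> test_functions \<Omega>.
        (\<integral>x. u x * partial_deriv k v x \<partial>lebesgue_on \<Omega>) = - (\<integral>x. g x * v x \<partial>lebesgue_on \<Omega>))"

text \<open>The weak derivative is unique only up to null sets; this is some representative of it.\<close>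

definition weak_deriv ::
    "(real ^ 'n::finite) set \<Rightarrow> 'n \<Rightarrow> (real ^ 'n \<Rightarrow> complex) \<Rightarrow> real ^ 'n \<Rightarrow> complex" where
  "weak_deriv \<Omega> k u = (SOME g. is_weak_deriv \<Omega> k u g)"

definition H1 :: "(real ^ 'n::finite) set \<Rightarrow> (real ^ 'n \<Rightarrow> complex) set" where
  "H1 \<Omega> = {u \<in> L2 (lebesgue_on \<Omega>). \<forall>k. \<exists>g \<in> L2 (lebesgue_on \<Omega>). is_weak_deriv \<Omega> k u g}"

definition H1_loc :: "(real ^ 'n::finite) set \<Rightarrow> (real ^ 'n \<Rightarrow> complex) set" where
  "H1_loc \<Omega> = {u \<in> L2_loc \<Omega>. \<forall>k. \<exists>g \<in> L2_loc \<Omega>. is_weak_deriv \<Omega> k u g}"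

definition H1_norm :: "(real ^ 'n::finite) set \<Rightarrow> (real ^ 'n \<Rightarrow> complex) \<Rightarrow> real" where
  "H1_norm \<Omega> u = sqrt ((L2_norm (lebesgue_on \<Omega>) u)\<^sup>2 +
     (\<Sum>k\<in>UNIV. (L2_norm (lebesgue_on \<Omega>) (weak_deriv \<Omega> k u))\<^sup>2))"

definition H1_0 :: "(real ^ 'n::finite) set \<Rightarrow> (real ^ 'n \<Rightarrow> complex) set" where
  "H1_0 \<Omega> = {u \<in> H1 \<Omega>. \<exists>v :: nat \<Rightarrow> real ^ 'n \<Rightarrow> complex.
     (\<forall>n. v n \<in> test_functions \<Omega>) \<and> (\<lambda>n. H1_norm \<Omega> (\<lambda>x. v n x - u x)) \<longlonglongrightarrow> 0}"

section \<open>The elliptic operator\<close>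

text \<open>
  The pairing of \<open>\<A>u\<close> with a test function \<open>v\<close>. As \<open>\<A>u\<close> is an antidistribution, \<open>\<A>u = 0\<close> means
  that all these pairings vanish.
\<close>

definition A_pairing ::
    "(real ^ 'n::finite) set \<Rightarrow> ('n \<Rightarrow> 'n \<Rightarrow> real ^ 'n \<Rightarrow> real) \<Rightarrow> ('n \<Rightarrow> real ^ 'n \<Rightarrow> complex) \<Rightarrow>
     ('n \<Rightarrow> real ^ 'n \<Rightarrow> real) \<Rightarrow> (real ^ 'n \<Rightarrow> complex) \<Rightarrow>
     (real ^ 'n \<Rightarrow> complex) \<Rightarrow> (real ^ 'n \<Rightarrow> complex) \<Rightarrow> complex" where
  "A_pairing \<Omega> a b c c0 u v =
     (\<Sum>k\<in>UNIV. \<Sum>l\<in>UNIV. \<integral>x. complex_of_real (a k l x) * weak_deriv \<Omega> l u x *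
        cnj (partial_deriv k v x) \<partial>lebesgue_on \<Omega>) +
     (\<Sum>k\<in>UNIV. \<integral>x. b k x * u x * cnj (partial_deriv k v x) \<partial>lebesgue_on \<Omega>) +
     (\<Sum>k\<in>UNIV. \<integral>x. complex_of_real (c k x) * weak_deriv \<Omega> k u x * cnj (v x) \<partial>lebesgue_on \<Omega>) +
     (\<integral>x. c0 x * u x * cnj (v x) \<partial>lebesgue_on \<Omega>)"

definition A_vanishes ::
    "(real ^ 'n::finite) set \<Rightarrow> ('n \<Rightarrow> 'n \<Rightarrow> real ^ 'n \<Rightarrow> real) \<Rightarrow> ('n \<Rightarrow> real ^ 'n \<Rightarrow> complex) \<Rightarrow>
     ('n \<Rightarrow> real ^ 'n \<Rightarrow> real) \<Rightarrow> (real ^ 'n \<Rightarrow> complex) \<Rightarrow> (real ^ 'n \<Rightarrow> complex) \<Rightarrow> bool" where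
  "A_vanishes \<Omega> a b c c0 u \<longleftrightarrow> (\<forall>v \<in> test_functions \<Omega>. A_pairing \<Omega> a b c c0 u v = 0)"

definition A_harmonic ::
    "(real ^ 'n::finite) set \<Rightarrow> ('n \<Rightarrow> 'n \<Rightarrow> real ^ 'n \<Rightarrow> real) \<Rightarrow> ('n \<Rightarrow> real ^ 'n \<Rightarrow> complex) \<Rightarrow>
     ('n \<Rightarrow> real ^ 'n \<Rightarrow> real) \<Rightarrow> (real ^ 'n \<Rightarrow> complex) \<Rightarrow> (real ^ 'n \<Rightarrow> complex) \<Rightarrow> bool" where
  "A_harmonic \<Omega> a b c c0 u \<longleftrightarrow> u \<in> H1_loc \<Omega> \<and> A_vanishes \<Omega> a b c c0 u"

section \<open>The Perron solution operator\<close>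

text \<open>
  The defining properties of the bounded linear map \<open>T : C(\<Gamma>) \<rightarrow> C\<^sub>b(\<Omega>)\<close>. That the values of \<open>T \<phi>\<close> on
  \<open>\<Omega>\<close> depend only on the restriction of \<open>\<phi>\<close> to \<open>\<Gamma>\<close> follows from linearity and the norm bound, so
  \<open>T \<Phi>\<close> below is \<open>T\<close> applied to the restriction of \<open>\<Phi>\<close>.
\<close>

definition perron_operator ::
    "(real ^ 'n::finite) set \<Rightarrow> ('n \<Rightarrow> 'n \<Rightarrow> real ^ 'n \<Rightarrow> real) \<Rightarrow> ('n \<Rightarrow> real ^ 'n \<Rightarrow> complex) \<Rightarrow>
     ('n \<Rightarrow> real ^ 'n \<Rightarrow> real) \<Rightarrow> (real ^ 'n \<Rightarrow> complex) \<Rightarrow>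
     ((real ^ 'n \<Rightarrow> complex) \<Rightarrow> (real ^ 'n \<Rightarrow> complex)) \<Rightarrow> bool" where
  "perron_operator \<Omega> a b c c0 T \<longleftrightarrow>
     (\<forall>\<phi>. continuous_on (frontier \<Omega>) \<phi> \<longrightarrow> continuous_on \<Omega> (T \<phi>) \<and> bounded (T \<phi> ` \<Omega>)) \<and>
     (\<forall>\<phi> \<psi>. continuous_on (frontier \<Omega>) \<phi> \<and> continuous_on (frontier \<Omega>) \<psi> \<longrightarrow>
        (\<forall>x\<in>\<Omega>. T (\<lambda>y. \<phi> y + \<psi> y) x = T \<phi> x + T \<psi> x)) \<and>
     (\<forall>\<phi> \<alpha>. continuous_on (frontier \<Omega>) \<phi> \<longrightarrow> (\<forall>x\<in>\<Omega>. T (\<lambda>y. \<alpha> * \<phi> y) x = \<alpha> * T \<phi> x)) \<and>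
     (\<exists>C. \<forall>\<phi>. continuous_on (frontier \<Omega>) \<phi> \<longrightarrow>
        (\<forall>x\<in>\<Omega>. norm (T \<phi> x) \<le> C * (SUP y\<in>frontier \<Omega>. norm (\<phi> y)))) \<and>
     (\<forall>\<phi>. continuous_on (frontier \<Omega>) \<phi> \<longrightarrow> A_harmonic \<Omega> a b c c0 (T \<phi>)) \<and>
     (\<forall>\<Phi> \<in> H1 \<Omega>. continuous_on (closure \<Omega>) \<Phi> \<longrightarrow> (\<lambda>x. \<Phi> x - T \<Phi> x) \<in> H1_0 \<Omega>)"

section \<open>Hausdorff measure on the boundary\<close>

text \<open>
  Boundedness of the covering sets is required explicitly because \<open>diameter\<close> is meaningless for
  unbounded sets. The factor is the usual normalisation under which the \<open>d\<close>-dimensional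
  Hausdorff measure on \<open>d\<close>-dimensional space is Lebesgue measure.
\<close>

definition hausdorff_premeasure :: "nat \<Rightarrow> real \<Rightarrow> 'a::metric_space set \<Rightarrow> ennreal" where
  "hausdorff_premeasure s \<delta> A =
     (INF C \<in> {C :: nat \<Rightarrow> 'a set. A \<subseteq> (\<Union>i. C i) \<and> (\<forall>i. bounded (C i) \<and> diameter (C i) \<le> \<delta>)}.
        \<Sum>i. if C i = {} then 0 else ennreal (unit_ball_vol (real s) * (diameter (C i) / 2) ^ s))"

definition hausdorff_outer :: "nat \<Rightarrow> 'a::metric_space set \<Rightarrow> ennreal" where
  "hausdorff_outer s A = (SUP \<delta> \<in> {0<..}. hausdorff_premeasure s \<delta> A)"

text \<open>
  \<open>hausdorff_outer s\<close> is a metric outer measure and hence countably additive on the Borel sets, so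
  the measure below takes the value \<open>hausdorff_outer s A\<close> at every Borel set \<open>A\<close>.
\<close>

definition hausdorff_measure :: "nat \<Rightarrow> 'a::metric_space measure" where
  "hausdorff_measure s = measure_of UNIV (sets borel) (hausdorff_outer s)"

definition boundary_measure :: "(real ^ 'n::finite) set \<Rightarrow> (real ^ 'n) measure" where
  "boundary_measure \<Omega> = restrict_space (hausdorff_measure (CARD('n) - 1)) (frontier \<Omega>)"

section \<open>Traces and variational solutions\<close>

definition is_trace ::
    "(real ^ 'n::finite) set \<Rightarrow> (real ^ 'n \<Rightarrow> complex) \<Rightarrow> (real ^ 'n \<Rightarrow> complex) \<Rightarrow> bool" where
  "is_trace \<Omega> u \<phi> \<longleftrightarrow> u \<in> H1 \<Omega> \<and> \<phi> \<in> L2 (boundary_measure \<Omega>) \<and>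
     (\<exists>w :: nat \<Rightarrow> real ^ 'n \<Rightarrow> complex.
        (\<forall>n. w n \<in> H1 \<Omega> \<and> continuous_on (closure \<Omega>) (w n) \<and> w n \<in> L2 (boundary_measure \<Omega>)) \<and>
        (\<lambda>n. H1_norm \<Omega> (\<lambda>x. w n x - u x)) \<longlonglongrightarrow> 0 \<and>
        (\<lambda>n. L2_norm (boundary_measure \<Omega>) (\<lambda>z. w n z - \<phi> z)) \<longlonglongrightarrow> 0)"

definition Tr :: "(real ^ 'n::finite) set \<Rightarrow> (real ^ 'n \<Rightarrow> complex) set" where
  "Tr \<Omega> = {\<phi> \<in> L2 (boundary_measure \<Omega>). \<exists>u \<in> H1 \<Omega>. is_trace \<Omega> u \<phi>}"

definition variational_solution ::
    "(real ^ 'n::finite) set \<Rightarrow> ('n \<Rightarrow> 'n \<Rightarrow> real ^ 'n \<Rightarrow> real) \<Rightarrow> ('n \<Rightarrow> real ^ 'n \<Rightarrow> complex) \<Rightarrow>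
     ('n \<Rightarrow> real ^ 'n \<Rightarrow> real) \<Rightarrow> (real ^ 'n \<Rightarrow> complex) \<Rightarrow> (real ^ 'n \<Rightarrow> complex) \<Rightarrow>
     (real ^ 'n \<Rightarrow> complex) \<Rightarrow> bool" where
  "variational_solution \<Omega> a b c c0 \<phi> u \<longleftrightarrow>
     u \<in> H1 \<Omega> \<and> A_harmonic \<Omega> a b c c0 u \<and> is_trace \<Omega> u \<phi>"

end

theory Submission
  imports Defs
begin

text \<open>
  Truncating the approximants of a variational solution radially at the size of their boundary
  values, subtracting their images under \<open>T\<close> and applying Garding's inequality gives sequences
  bounded in \<open>H1\<close>. Near-minimisers of the norm over their convex tails converge strongly, and this
  yields a maximum estimate for variational solutions with small continuous trace; density of smooth
  boundary values then gives (a).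

  For (b) let \<open>\<Phi>\<^sub>k\<close> be smooth with \<open>\<bar>\<Phi>\<^sub>k - \<phi>\<bar> \<le> 2\<^sup>-\<^sup>k\<close> on the boundary. Up to an error of order
  \<open>2\<^sup>-\<^sup>k\<close> in the supremum norm, \<open>T \<phi> - \<Phi>\<^sub>k\<close> lies in \<open>H10\<close>, hence it is small in \<open>H1\<close> after
  subtraction of a test function. A telescoping sum of truncations glues these small corrections to
  one function \<open>E\<close>, as small as desired in \<open>H1\<close>, such that \<open>T \<phi> - E\<close> extends continuously by \<open>\<phi>\<close>.
\<close>

section \<open>Square-integrable functions\<close>

text \<open>The lower-order terms carry no sign condition, so there is no maximum principle to start
  from: the only supremum estimate is the boundedness of \<open>T\<close>, with a constant
  \<open>C\<close> that may exceed 1. A trace, however, is controlled only in \<open>L2\<close> of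
  the boundary. Truncation links the two: \<open>trunc e\<close> fixes values of size at most
  \<open>e\<close> and is 1-Lipschitz, so it alters the approximants on the boundary by an amount
  tending to 0 in \<open>L2\<close>, while their images under \<open>T\<close> become bounded by
  \<open>C * e\<close>. This pointwise bound also supplies the \<open>L2\<close> control that
  Garding's inequality asks for. The identity for \<open>H1_0\<close> absorbs the truncation error,
  and uniqueness identifies the limit. In (b), closeness in \<open>H1\<close> says nothing about
  continuity up to the boundary. Test functions vanish near the boundary, so subtracting one makes a
  correction small in \<open>H1\<close> without altering it there; the levels in the telescoping sum
  are summable and yet large enough to be inactive near the boundary. Chain rules are avoided:
  Lipschitz maps act on \<open>H1\<close> through difference quotients, which yields norm bounds
  only, and these suffice.\<close>

lemma L2_I:
  assumes "f \<in> borel_measurable M" "integrable M (\<lambda>x. (norm (f x))\<^sup>2)"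
  shows "f \<in> L2 M"
  using assms by (simp add: L2_def)

lemma L2_measurable: "f \<in> L2 M \<Longrightarrow> f \<in> borel_measurable M"
  and L2_integrable: "f \<in> L2 M \<Longrightarrow> integrable M (\<lambda>x. (norm (f x))\<^sup>2)"
  by (simp_all add: L2_def)

lemma L2_dominated:
  assumes "g \<in> L2 M" "f \<in> borel_measurable M" "AE x in M. norm (f x) \<le> norm (g x)"
  shows "f \<in> L2 M"
proof (rule L2_I)
  show "integrable M (\<lambda>x. (norm (f x))\<^sup>2)"
    by (rule Bochner_Integration.integrable_bound[OF L2_integrable[OF assms(1)]])
       (use assms in \<open>auto elim!: eventually_mono intro!: power_mono\<close>)
qed fact

lemma L2_zero [simp]: "(\<lambda>x. 0) \<in> L2 M"
  by (simp add: L2_def)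

lemma L2_cmult: "f \<in> L2 M \<Longrightarrow> (\<lambda>x. c * f x) \<in> L2 M"
  by (auto simp: L2_def norm_mult power_mult_distrib)

lemma norm_add_squared_le:
  fixes a b :: "'a::real_normed_vector"
  shows "(norm (a + b))\<^sup>2 \<le> 2 * (norm a)\<^sup>2 + 2 * (norm b)\<^sup>2"
proof -
  have "(norm (a + b))\<^sup>2 \<le> (norm a + norm b)\<^sup>2"
    by (intro power_mono norm_triangle_ineq) auto
  also have "\<dots> \<le> 2 * (norm a)\<^sup>2 + 2 * (norm b)\<^sup>2"
    using sum_squares_bound[of "norm a" "norm b"] by (simp add: power2_sum)
  finally show ?thesis .
qed

lemma L2_add: assumes "f \<in> L2 M" "g \<in> L2 M" shows "(\<lambda>x. f x + g x) \<in> L2 M"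
proof (rule L2_I)
  note [measurable] = L2_measurable[OF assms(1)] L2_measurable[OF assms(2)]
  show "(\<lambda>x. f x + g x) \<in> borel_measurable M" by measurable
  show "integrable M (\<lambda>x. (norm (f x + g x))\<^sup>2)"
    by (rule Bochner_Integration.integrable_bound
          [of _ "\<lambda>x. 2 * (norm (f x))\<^sup>2 + 2 * (norm (g x))\<^sup>2"])
       (use assms in \<open>auto simp: L2_integrable norm_add_squared_le\<close>)
qed

lemma L2_uminus: "f \<in> L2 M \<Longrightarrow> (\<lambda>x. - f x) \<in> L2 M"
  using L2_cmult[of f M "-1"] by simp

lemma L2_diff: "f \<in> L2 M \<Longrightarrow> g \<in> L2 M \<Longrightarrow> (\<lambda>x. f x - g x) \<in> L2 M"
  using L2_add[of f M "\<lambda>x. - g x"] L2_uminus[of g M] by simp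

lemma L2_cnj: "f \<in> L2 M \<Longrightarrow> (\<lambda>x. cnj (f x)) \<in> L2 M"
  using borel_measurable_continuous_on[OF continuous_on_cnj[OF continuous_on_id], of f M]
  by (auto simp: L2_def)

lemma L2_cong_AE:
  assumes "f \<in> L2 M" "g \<in> borel_measurable M" "AE x in M. g x = f x"
  shows "g \<in> L2 M"
  by (rule L2_dominated[OF assms(1,2)]) (use assms(3) in auto)

lemma L2_mult_integrable:
  assumes "f \<in> L2 M" "g \<in> L2 M"
  shows "integrable M (\<lambda>x. f x * g x)"
proof -
  note [measurable] = L2_measurable[OF assms(1)] L2_measurable[OF assms(2)]
  have "norm (f x * g x) \<le> (norm (f x))\<^sup>2 + (norm (g x))\<^sup>2" for x
    using sum_squares_bound[of "norm (f x)" "norm (g x)"]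
      mult_nonneg_nonneg[OF norm_ge_zero[of "f x"] norm_ge_zero[of "g x"]]
    unfolding norm_mult by linarith
  then show ?thesis
    by (intro Bochner_Integration.integrable_bound
          [of M "\<lambda>x. (norm (f x))\<^sup>2 + (norm (g x))\<^sup>2" "\<lambda>x. f x * g x"]
          Bochner_Integration.integrable_add L2_integrable assms) auto
qed

lemma L2_norm_nonneg [simp]: "0 \<le> L2_norm M f"
  by (simp add: L2_norm_def)

lemma L2_norm_squared: "(L2_norm M f)\<^sup>2 = (\<integral>x. (norm (f x))\<^sup>2 \<partial>M)"
  by (simp add: L2_norm_def)

lemma L2_norm_zero [simp]: "L2_norm M (\<lambda>x. 0) = 0"
  by (simp add: L2_norm_def)

lemma L2_norm_cmult: "L2_norm M (\<lambda>x. c * f x) = norm c * L2_norm M f"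
  by (simp add: L2_norm_def norm_mult power_mult_distrib real_sqrt_mult)

lemma L2_norm_uminus [simp]: "L2_norm M (\<lambda>x. - f x) = L2_norm M f"
  by (simp add: L2_norm_def)

lemma L2_norm_commute: "L2_norm M (\<lambda>x. f x - g x) = L2_norm M (\<lambda>x. g x - f x)"
  by (simp add: L2_norm_def norm_minus_commute)

lemma L2_norm_cong_AE:
  assumes "AE x in M. f x = g x" "f \<in> borel_measurable M" "g \<in> borel_measurable M"
  shows "L2_norm M f = L2_norm M g"
  unfolding L2_norm_def
  by (intro arg_cong[of _ _ sqrt] integral_cong_AE) (use assms in auto)

lemma L2_norm_mono:
  assumes "g \<in> L2 M" "f \<in> borel_measurable M" "AE x in M. norm (f x) \<le> norm (g x)"
  shows "L2_norm M f \<le> L2_norm M g"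
  unfolding L2_norm_def
proof (intro real_sqrt_le_mono integral_mono_AE)
  show "AE x in M. (norm (f x))\<^sup>2 \<le> (norm (g x))\<^sup>2"
    using assms(3) by eventually_elim (auto intro: power_mono)
qed (use assms L2_dominated[OF assms] in \<open>auto simp: L2_integrable\<close>)

lemma L2_norm_eq_0_AE:
  assumes "f \<in> L2 M" "L2_norm M f = 0"
  shows "AE x in M. f x = 0"
proof -
  have "(\<integral>x. (norm (f x))\<^sup>2 \<partial>M) = 0"
    using assms(2) L2_norm_squared[of M f] by simp
  then have "AE x in M. (norm (f x))\<^sup>2 = 0"
    using assms(1) by (subst (asm) integral_nonneg_eq_0_iff_AE) (auto simp: L2_integrable)
  then show ?thesis by simp
qed

lemma L2_Cauchy_Schwarz_abs:
  assumes "f \<in> L2 M" "g \<in> L2 M"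
  shows "(\<integral>x. norm (f x * g x) \<partial>M) \<le> L2_norm M f * L2_norm M g"
proof -
  let ?I = "\<integral>x. norm (f x * g x) \<partial>M" and ?a = "L2_norm M f" and ?b = "L2_norm M g"
  have I: "integrable M (\<lambda>x. norm (f x * g x))"
    using L2_mult_integrable[OF assms] by simp
  \<comment> \<open>Young's inequality with a free weight \<open>t\<close>; the choice
    \<open>t = ?b / ?a\<close> below makes the right-hand side \<open>2 * ?a * ?b\<close>. Vanishing
    norms are split off because this quotient has to be positive.\<close>
  have key: "2 * ?I \<le> t * ?a\<^sup>2 + ?b\<^sup>2 / t" if "t > 0" for t
  proof -
    have "2 * norm (f x * g x) \<le> t * (norm (f x))\<^sup>2 + (norm (g x))\<^sup>2 / t" for x
    proof -
      have "0 \<le> (t * norm (f x) - norm (g x))\<^sup>2 / t" using that by simp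
      also have "\<dots> = t * (norm (f x))\<^sup>2 + (norm (g x))\<^sup>2 / t - 2 * norm (f x * g x)"
        using that by (simp add: field_simps power2_eq_square norm_mult)
      finally show ?thesis by simp
    qed
    then have "(\<integral>x. 2 * norm (f x * g x) \<partial>M)
        \<le> (\<integral>x. t * (norm (f x))\<^sup>2 + (norm (g x))\<^sup>2 / t \<partial>M)"
      by (intro integral_mono) (use assms I in \<open>auto simp: L2_integrable\<close>)
    also have "\<dots> = t * ?a\<^sup>2 + ?b\<^sup>2 / t"
      using assms by (simp add: L2_norm_squared L2_integrable)
    finally show ?thesis by simp
  qed
  show ?thesis
  proof (cases "?a = 0 \<or> ?b = 0")
    case True
    then have "AE x in M. f x = 0 \<or> g x = 0"
    proof
      assume "?a = 0" from L2_norm_eq_0_AE[OF assms(1) this] show ?thesis by auto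
    next
      assume "?b = 0" from L2_norm_eq_0_AE[OF assms(2) this] show ?thesis by auto
    qed
    then have "?I = 0" by (intro integral_eq_zero_AE) auto
    then show ?thesis by simp
  next
    case False
    then have "?a > 0" "?b > 0" by (simp_all add: order_less_le)
    then show ?thesis using key[of "?b / ?a"] by (simp add: power2_eq_square)
  qed
qed

lemma L2_Cauchy_Schwarz:
  assumes "f \<in> L2 M" "g \<in> L2 M"
  shows "norm (\<integral>x. f x * g x \<partial>M) \<le> L2_norm M f * L2_norm M g"
  using order_trans[OF integral_norm_bound L2_Cauchy_Schwarz_abs[OF assms]] .

lemma L2_norm_triangle:
  assumes "f \<in> L2 M" "g \<in> L2 M"
  shows "L2_norm M (\<lambda>x. f x + g x) \<le> L2_norm M f + L2_norm M g"
proof (rule power2_le_imp_le)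
  have I: "integrable M (\<lambda>x. norm (f x * g x))"
    using L2_mult_integrable[OF assms] by simp
  have "(L2_norm M (\<lambda>x. f x + g x))\<^sup>2
      \<le> (\<integral>x. (norm (f x))\<^sup>2 + 2 * norm (f x * g x) + (norm (g x))\<^sup>2 \<partial>M)"
    unfolding L2_norm_squared
  proof (rule integral_mono)
    fix x
    have "(norm (f x + g x))\<^sup>2 \<le> (norm (f x) + norm (g x))\<^sup>2"
      by (intro power_mono norm_triangle_ineq) auto
    then show "(norm (f x + g x))\<^sup>2 \<le> (norm (f x))\<^sup>2 + 2 * norm (f x * g x) + (norm (g x))\<^sup>2"
      by (simp add: power2_sum norm_mult algebra_simps)
  qed (use assms I L2_add[OF assms] in \<open>auto simp: L2_integrable\<close>)
  also have "\<dots> = (L2_norm M f)\<^sup>2 + 2 * (\<integral>x. norm (f x * g x) \<partial>M) + (L2_norm M g)\<^sup>2"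
    using assms I by (simp add: L2_norm_squared L2_integrable)
  also have "\<dots> \<le> (L2_norm M f + L2_norm M g)\<^sup>2"
    using L2_Cauchy_Schwarz_abs[OF assms] by (simp add: power2_sum)
  finally show "(L2_norm M (\<lambda>x. f x + g x))\<^sup>2 \<le> (L2_norm M f + L2_norm M g)\<^sup>2" .
qed simp

lemma L2_norm_triangle_sub:
  assumes "f \<in> L2 M" "g \<in> L2 M" "h \<in> L2 M"
  shows "L2_norm M (\<lambda>x. f x - h x) \<le> L2_norm M (\<lambda>x. f x - g x) + L2_norm M (\<lambda>x. g x - h x)"
  using L2_norm_triangle[OF L2_diff[OF assms(1,2)] L2_diff[OF assms(2,3)]] by simp

text \<open>Written with the midpoint so that it has the shape of \<open>par\<close> in
  \<open>near_minimisers_Cauchy\<close>: it forces near-minimisers of a norm over a convex set to be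
  close to each other.\<close>

lemma L2_norm_parallelogram:
  assumes "f \<in> L2 M" "g \<in> L2 M"
  shows "(L2_norm M (\<lambda>x. f x - g x))\<^sup>2 =
    2 * (L2_norm M f)\<^sup>2 + 2 * (L2_norm M g)\<^sup>2 - 4 * (L2_norm M (\<lambda>x. (f x + g x) / 2))\<^sup>2"
proof -
  have *: "(norm (a - b))\<^sup>2 = 2 * (norm a)\<^sup>2 + 2 * (norm b)\<^sup>2 - 4 * (norm ((a + b) / 2))\<^sup>2"
    for a b :: complex
    unfolding cmod_power2 by (simp add: power2_eq_square) (simp add: field_simps)
  have m: "(\<lambda>x. (f x + g x) / 2) \<in> L2 M"
    using L2_cmult[OF L2_add[OF assms], of "1/2"] by simp
  show ?thesis
    unfolding L2_norm_squared * using assms L2_integrable[OF m] by (simp add: L2_integrable)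
qed

lemma L2_limit_unique:
  assumes "\<And>n. f n \<in> L2 M" "g \<in> L2 M" "h \<in> L2 M"
    "(\<lambda>n. L2_norm M (\<lambda>x. f n x - g x)) \<longlonglongrightarrow> 0" "(\<lambda>n. L2_norm M (\<lambda>x. f n x - h x)) \<longlonglongrightarrow> 0"
  shows "AE x in M. g x = h x"
proof -
  have "L2_norm M (\<lambda>x. g x - h x) \<le> 0"
  proof (rule LIMSEQ_le_const)
    show "(\<lambda>n. L2_norm M (\<lambda>x. f n x - g x) + L2_norm M (\<lambda>x. f n x - h x)) \<longlonglongrightarrow> 0"
      using tendsto_add[OF assms(4,5)] by simp
    show "\<exists>N. \<forall>n\<ge>N. L2_norm M (\<lambda>x. g x - h x)
        \<le> L2_norm M (\<lambda>x. f n x - g x) + L2_norm M (\<lambda>x. f n x - h x)"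
      using L2_norm_triangle_sub[OF assms(2) assms(1) assms(3)] L2_norm_commute[of M g]
      by auto
  qed
  then have "L2_norm M (\<lambda>x. g x - h x) = 0" using L2_norm_nonneg by (metis order_antisym)
  then show ?thesis using L2_norm_eq_0_AE[OF L2_diff[OF assms(2,3)]] by auto
qed

lemma L2_norm_tendsto:
  assumes "\<And>n. f n \<in> L2 M" "g \<in> L2 M" "(\<lambda>n. L2_norm M (\<lambda>x. f n x - g x)) \<longlonglongrightarrow> 0"
  shows "(\<lambda>n. L2_norm M (f n)) \<longlonglongrightarrow> L2_norm M g"
proof -
  have "\<bar>L2_norm M (f n) - L2_norm M g\<bar> \<le> L2_norm M (\<lambda>x. f n x - g x)" for n
    using L2_norm_triangle_sub[OF assms(1)[of n] assms(2) L2_zero]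
      L2_norm_triangle_sub[OF assms(2) assms(1)[of n] L2_zero] L2_norm_commute[of M g "f n"]
    by simp
  then have "(\<lambda>n. L2_norm M (f n) - L2_norm M g) \<longlonglongrightarrow> 0"
    by (intro Lim_null_comparison[OF _ assms(3)]) auto
  then show ?thesis by (simp add: LIM_zero_iff)
qed

lemma L2_integral_tendsto:
  assumes "\<And>n. f n \<in> L2 M" "g \<in> L2 M" "(\<lambda>n. L2_norm M (\<lambda>x. f n x - g x)) \<longlonglongrightarrow> 0" "h \<in> L2 M"
  shows "(\<lambda>n. \<integral>x. f n x * h x \<partial>M) \<longlonglongrightarrow> (\<integral>x. g x * h x \<partial>M)"
proof -
  have le: "norm ((\<integral>x. f n x * h x \<partial>M) - (\<integral>x. g x * h x \<partial>M))
      \<le> L2_norm M (\<lambda>x. f n x - g x) * L2_norm M h" for n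
  proof -
    have "(\<integral>x. f n x * h x \<partial>M) - (\<integral>x. g x * h x \<partial>M) = (\<integral>x. (f n x - g x) * h x \<partial>M)"
      using L2_mult_integrable[OF assms(1,4)] L2_mult_integrable[OF assms(2,4)]
      by (simp add: left_diff_distrib)
    then show ?thesis using L2_Cauchy_Schwarz[OF L2_diff[OF assms(1,2)] assms(4)] by simp
  qed
  have lim: "(\<lambda>n. L2_norm M (\<lambda>x. f n x - g x) * L2_norm M h) \<longlonglongrightarrow> 0"
    using tendsto_mult_right[OF assms(3), of "L2_norm M h"] by simp
  have "(\<lambda>n. (\<integral>x. f n x * h x \<partial>M) - (\<integral>x. g x * h x \<partial>M)) \<longlonglongrightarrow> 0"
    by (rule Lim_null_comparison[OF always_eventually[OF allI[OF le]] lim])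
  then show ?thesis by (simp add: LIM_zero_iff)
qed


section \<open>Completeness of \<open>L2\<close> over an arbitrary measure\<close>

lemma exists_fast_subsequence:
  fixes D :: "nat \<Rightarrow> nat \<Rightarrow> real" and \<epsilon> :: "nat \<Rightarrow> real"
  assumes Cauchy: "\<And>e. e > 0 \<Longrightarrow> \<exists>N. \<forall>m\<ge>N. \<forall>n\<ge>N. D m n < e"
    and pos: "\<And>k. \<epsilon> k > 0"
  obtains r where "strict_mono r" "\<And>k m n. m \<ge> r k \<Longrightarrow> n \<ge> r k \<Longrightarrow> D m n < \<epsilon> k"
proof -
  have "\<exists>r. \<forall>k. (\<forall>m\<ge>r k. \<forall>n\<ge>r k. D m n < \<epsilon> k) \<and> r k < r (Suc k)"
  proof (rule dependent_nat_choice)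
    show "\<exists>N. \<forall>m\<ge>N. \<forall>n\<ge>N. D m n < \<epsilon> 0" using Cauchy[OF pos] .
    fix N k
    obtain N' where "\<forall>m\<ge>N'. \<forall>n\<ge>N'. D m n < \<epsilon> (Suc k)" using Cauchy[OF pos] by blast
    then show "\<exists>y. (\<forall>m\<ge>y. \<forall>n\<ge>y. D m n < \<epsilon> (Suc k)) \<and> N < y"
      by (intro exI[of _ "max N' (Suc N)"]) auto
  qed
  then obtain r where "\<forall>k. (\<forall>m\<ge>r k. \<forall>n\<ge>r k. D m n < \<epsilon> k) \<and> r k < r (Suc k)" by blast
  then show thesis by (intro that[of r]) (auto simp: strict_mono_Suc_iff)
qed

lemma nn_integral_norm_squared:
  assumes "f \<in> L2 M"
  shows "(\<integral>\<^sup>+x. ennreal ((norm (f x))\<^sup>2) \<partial>M) = ennreal ((L2_norm M f)\<^sup>2)"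
  unfolding L2_norm_squared using assms
  by (intro nn_integral_eq_integral) (auto simp: L2_integrable)

text \<open>The weight \<open>4 ^ k\<close> turns summability of squares into the geometric bound
  \<open>sqrt S * (1/2) ^ k\<close> on the increments. Squares are used because their integrals are
  \<open>L2\<close> norms, so the series can be integrated term by term without a triangle
  inequality for infinite sums.\<close>

lemma convergent_if_weighted_square_summable:
  fixes y :: "nat \<Rightarrow> complex"
  assumes "summable (\<lambda>k. 4 ^ k * (norm (y (Suc k) - y k))\<^sup>2)"
  shows "convergent y"
proof -
  let ?a = "\<lambda>k. 4 ^ k * (norm (y (Suc k) - y k))\<^sup>2"
  define S where "S = suminf ?a"
  have le: "?a k \<le> S" for k
    unfolding S_def using sum_le_suminf[OF assms, of "{k}"] by simp
  have "norm (y (Suc k) - y k) \<le> sqrt S * (1/2) ^ k" for k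
  proof (rule power2_le_imp_le)
    have "0 \<le> S" using order_trans[OF _ le[of 0]] by simp
    have "((1/2::real) ^ k)\<^sup>2 = (1/4) ^ k" by (simp add: power2_eq_square flip: power_mult_distrib)
    then have eq: "(sqrt S * (1/2) ^ k)\<^sup>2 = S / 4 ^ k"
      using \<open>0 \<le> S\<close> by (simp add: power_mult_distrib power_divide real_sqrt_pow2)
    show "(norm (y (Suc k) - y k))\<^sup>2 \<le> (sqrt S * (1/2) ^ k)\<^sup>2"
      unfolding eq using le[of k] by (simp add: field_simps)
    show "0 \<le> sqrt S * (1/2) ^ k" using order_trans[OF _ le[of 0]] by simp
  qed
  note le' = this
  have sm: "summable (\<lambda>k. sqrt S * (1/2::real) ^ k)"
    by (intro summable_mult summable_geometric) simp
  have "summable (\<lambda>k. y (Suc k) - y k)"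
    by (rule summable_comparison_test'[OF sm, of 0]) (rule le')
  then have "convergent (\<lambda>n. \<Sum>k<n. y (Suc k) - y k)" by (simp add: summable_iff_convergent)
  then have "convergent (\<lambda>n. y n - y 0)" by (simp add: sum_lessThan_telescope)
  then show ?thesis using convergent_add[OF _ convergent_const[of "y 0"]] by force
qed

text \<open>Riesz-Fischer: a rapidly Cauchy subsequence converges almost everywhere, and Fatou's
  lemma carries the Cauchy estimate over to the pointwise limit.\<close>

lemma L2_complete:
  assumes f: "\<And>n. f n \<in> L2 M"
    and Cauchy: "\<And>e. e > 0 \<Longrightarrow> \<exists>N. \<forall>m\<ge>N. \<forall>n\<ge>N. L2_norm M (\<lambda>x. f m x - f n x) < e"
  obtains g where "g \<in> L2 M" "(\<lambda>n. L2_norm M (\<lambda>x. f n x - g x)) \<longlonglongrightarrow> 0"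
proof -
  note [measurable] = L2_measurable[OF f]
  \<comment> \<open>The rate \<open>(1/4) ^ k\<close> enters the integrals squared, so it beats the
    weight \<open>4 ^ k\<close> and leaves the summable bound \<open>(1/4) ^ k\<close>.\<close>
  obtain r where r: "strict_mono r"
    and D: "\<And>k m n. m \<ge> r k \<Longrightarrow> n \<ge> r k \<Longrightarrow> L2_norm M (\<lambda>x. f m x - f n x) < (1/4) ^ k"
    using exists_fast_subsequence[of "\<lambda>m n. L2_norm M (\<lambda>x. f m x - f n x)" "\<lambda>k. (1/4) ^ k"] Cauchy
    by (auto simp: L2_norm_commute)
  define a where "a k x = 4 ^ k * (norm (f (r (Suc k)) x - f (r k) x))\<^sup>2" for k x
  have [measurable]: "a k \<in> borel_measurable M" for k unfolding a_def by measurable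
  have "(\<integral>\<^sup>+x. ennreal (a k x) \<partial>M) \<le> ennreal ((1/4) ^ k)" for k
  proof -
    have "(\<integral>\<^sup>+x. ennreal (a k x) \<partial>M) =
        ennreal (4 ^ k) * ennreal ((L2_norm M (\<lambda>x. f (r (Suc k)) x - f (r k) x))\<^sup>2)"
      unfolding a_def nn_integral_norm_squared[OF L2_diff[OF f f], symmetric]
      by (subst nn_integral_cmult[symmetric]) (auto simp: ennreal_mult)
    also have "\<dots> = ennreal (4 ^ k * (L2_norm M (\<lambda>x. f (r (Suc k)) x - f (r k) x))\<^sup>2)"
      by (simp add: ennreal_mult)
    also have "\<dots> \<le> ennreal (4 ^ k * ((1/4) ^ k)\<^sup>2)"
      using D[of k "r (Suc k)" "r k"] strict_monoD[OF r, of k "Suc k"]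
      by (intro ennreal_leI mult_left_mono power_mono) auto
    also have "4 ^ k * ((1/4) ^ k)\<^sup>2 = (1/4::real) ^ k"
      by (simp add: power2_eq_square flip: power_mult_distrib)
    finally show ?thesis .
  qed
  then have "(\<integral>\<^sup>+x. (\<Sum>k. ennreal (a k x)) \<partial>M) \<le> (\<Sum>k. ennreal ((1/4) ^ k))"
    by (subst nn_integral_suminf) (auto intro!: suminf_le)
  also have "\<dots> < \<infinity>"
    by (subst suminf_ennreal2) (auto intro!: summable_geometric)
  finally have "AE x in M. (\<Sum>k. ennreal (a k x)) \<noteq> \<infinity>"
    by (intro nn_integral_noteq_infinite) auto
  then have "AE x in M. summable (\<lambda>k. a k x)"
    by eventually_elim (auto intro!: summable_suminf_not_top simp: a_def)
  then have conv: "AE x in M. convergent (\<lambda>k. f (r k) x)"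
    by eventually_elim (auto intro!: convergent_if_weighted_square_summable simp: a_def)
  define g where "g x = lim (\<lambda>k. f (r k) x)" for x
  have [measurable]: "g \<in> borel_measurable M" unfolding g_def by measurable
  have g: "AE x in M. (\<lambda>k. f (r k) x) \<longlonglongrightarrow> g x"
    using conv by eventually_elim (simp add: g_def convergent_LIMSEQ_iff)
  have bound: "(\<integral>\<^sup>+x. ennreal ((norm (f n x - g x))\<^sup>2) \<partial>M) \<le> ennreal (((1/4) ^ j)\<^sup>2)"
    if "n \<ge> r j" for n j
  proof -
    have "AE x in M. ennreal ((norm (f n x - g x))\<^sup>2)
        = liminf (\<lambda>k. ennreal ((norm (f n x - f (r k) x))\<^sup>2))"
      using g
    proof eventually_elim
      fix x assume "(\<lambda>k. f (r k) x) \<longlonglongrightarrow> g x"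
      then have "(\<lambda>k. ennreal ((norm (f n x - f (r k) x))\<^sup>2)) \<longlonglongrightarrow> ennreal ((norm (f n x - g x))\<^sup>2)"
        by (intro tendsto_intros tendsto_ennrealI)
      from lim_imp_Liminf[OF _ this] show "ennreal ((norm (f n x - g x))\<^sup>2)
        = liminf (\<lambda>k. ennreal ((norm (f n x - f (r k) x))\<^sup>2))" by simp
    qed
    then have "(\<integral>\<^sup>+x. ennreal ((norm (f n x - g x))\<^sup>2) \<partial>M)
        = (\<integral>\<^sup>+x. liminf (\<lambda>k. ennreal ((norm (f n x - f (r k) x))\<^sup>2)) \<partial>M)"
      by (rule nn_integral_cong_AE)
    also have "\<dots> \<le> liminf (\<lambda>k. \<integral>\<^sup>+x. ennreal ((norm (f n x - f (r k) x))\<^sup>2) \<partial>M)"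
      by (rule nn_integral_liminf) measurable
    also have "\<dots> \<le> ennreal (((1/4) ^ j)\<^sup>2)"
    proof (rule Liminf_le)
      show "\<forall>\<^sub>F k in sequentially. (\<integral>\<^sup>+x. ennreal ((norm (f n x - f (r k) x))\<^sup>2) \<partial>M) \<le> ennreal (((1/4) ^ j)\<^sup>2)"
        using eventually_ge_at_top[of j]
      proof eventually_elim
        case (elim k)
        then have "r j \<le> r k" using r by (simp add: strict_mono_less_eq)
        from D[OF that this] show ?case
          unfolding nn_integral_norm_squared[OF L2_diff[OF f f]]
          by (intro ennreal_leI power_mono) auto
      qed
    qed simp
    finally show ?thesis .
  qed
  have diff: "(\<lambda>x. f n x - g x) \<in> L2 M" if "n \<ge> r j" for n j
    using bound[OF that] by (intro L2_I integrableI_bounded) (auto intro: le_less_trans)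
  \<comment> \<open>So far only differences \<open>f n - g\<close> are known to be square
    integrable; the index \<open>r 0\<close> qualifies with \<open>j = 0\<close>, and subtracting
    recovers \<open>g\<close> itself.\<close>
  have "(\<lambda>x. f (r 0) x - (f (r 0) x - g x)) \<in> L2 M" by (rule L2_diff[OF f diff[of 0]]) simp
  then have gL2: "g \<in> L2 M" by simp
  have "(\<lambda>n. L2_norm M (\<lambda>x. f n x - g x)) \<longlonglongrightarrow> 0"
  proof (rule LIMSEQ_I)
    fix e :: real assume "e > 0"
    then obtain j where j: "(1/4) ^ j < e" using real_arch_pow_inv[of e "1/4"] by auto
    have "norm (L2_norm M (\<lambda>x. f n x - g x) - 0) < e" if "n \<ge> r j" for n
    proof -
      have "(L2_norm M (\<lambda>x. f n x - g x))\<^sup>2 \<le> ((1/4) ^ j)\<^sup>2"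
        using bound[OF that] nn_integral_norm_squared[OF diff[OF that]] by simp
      then have "L2_norm M (\<lambda>x. f n x - g x) \<le> (1/4) ^ j"
        by (rule power2_le_imp_le) simp
      with j show ?thesis by simp
    qed
    then show "\<exists>N. \<forall>n\<ge>N. norm (L2_norm M (\<lambda>x. f n x - g x) - 0) < e" by blast
  qed
  with gL2 show thesis by (rule that)
qed

text \<open>The excess of \<open>norm (g x)\<close> over \<open>c\<close> is at most
  \<open>norm (f n x - g x)\<close>, since \<open>f n\<close> stays below \<open>c\<close>; hence
  the norm of the excess is 0. This avoids extracting an almost everywhere convergent
  subsequence.\<close>

lemma L2_limit_norm_le:
  assumes f: "\<And>n. f n \<in> L2 M" "\<And>n. AE x in M. norm (f n x) \<le> c"
    and g: "g \<in> L2 M" "(\<lambda>n. L2_norm M (\<lambda>x. f n x - g x)) \<longlonglongrightarrow> 0" and "c \<ge> 0"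
  shows "AE x in M. norm (g x) \<le> c"
proof -
  note [measurable] = L2_measurable[OF f(1)] L2_measurable[OF g(1)]
  define h where "h x = complex_of_real (max 0 (norm (g x) - c))" for x
  have [measurable]: "h \<in> borel_measurable M" unfolding h_def by measurable
  have le: "L2_norm M h \<le> L2_norm M (\<lambda>x. f n x - g x)" for n
  proof (rule L2_norm_mono[OF L2_diff[OF f(1) g(1)]])
    show "AE x in M. norm (h x) \<le> norm (f n x - g x)"
      using f(2)[of n]
    proof eventually_elim
      case (elim x)
      have "norm (g x) - norm (f n x) \<le> norm (f n x - g x)"
        using norm_triangle_ineq2[of "g x" "f n x"] by (simp add: norm_minus_commute)
      with elim show ?case by (simp add: h_def)
    qed
  qed simp
  have "L2_norm M h \<le> 0"
    by (rule LIMSEQ_le_const[OF g(2)]) (use le in auto)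
  then have "L2_norm M h = 0" using L2_norm_nonneg by (metis order_antisym)
  moreover have "h \<in> L2 M"
    by (rule L2_dominated[OF g(1)]) (use \<open>c \<ge> 0\<close> in \<open>auto simp: h_def\<close>)
  ultimately have "AE x in M. h x = 0" by (intro L2_norm_eq_0_AE)
  then show ?thesis by eventually_elim (auto simp: h_def)
qed

section \<open>Near-minimisers of a quadratic functional\<close>

text \<open>
  This replaces weak compactness and Mazur's lemma: a bounded sequence satisfying countably many
  convex constraints asymptotically can be exchanged for a strongly convergent one.
\<close>

lemma near_minimisers_Cauchy:
  fixes q :: "'v \<Rightarrow> real" and D :: "'v \<Rightarrow> 'v \<Rightarrow> real"
  assumes decr: "\<And>n. K (Suc n) \<subseteq> K n"
    and mid: "\<And>n x y. x \<in> K n \<Longrightarrow> y \<in> K n \<Longrightarrow> mid x y \<in> K n"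
    and par: "\<And>x y. x \<in> K 0 \<Longrightarrow> y \<in> K 0 \<Longrightarrow> D x y \<le> 2 * q x + 2 * q y - 4 * q (mid x y)"
    and nonneg: "\<And>x. x \<in> K 0 \<Longrightarrow> 0 \<le> q x"
    and bd: "\<And>n. \<exists>x\<in>K n. q x \<le> B"
  obtains x where "\<And>n. x n \<in> K n" "\<And>n y. y \<in> K n \<Longrightarrow> q (x n) \<le> q y + 1 / (real n + 1)"
    "\<And>e. e > 0 \<Longrightarrow> \<exists>N. \<forall>m\<ge>N. \<forall>n\<ge>N. D (x m) (x n) < e"
proof -
  have sub: "K n \<subseteq> K m" if "m \<le> n" for m n
    using that by (rule lift_Suc_antimono_le[of K, OF decr])
  define I where "I n = Inf (q ` K n)" for n
  have ne: "q ` K n \<noteq> {}" and bb: "bdd_below (q ` K n)" for n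
    using bd[of n] nonneg sub[of 0 n] by (auto intro!: bdd_belowI2[of _ 0])
  have I_le: "I n \<le> q x" if "x \<in> K n" for n x
    unfolding I_def using that bb by (intro cInf_lower) auto
  have I_mono: "I m \<le> I n" if "m \<le> n" for m n
    unfolding I_def using sub[OF that] ne bb by (intro cInf_superset_mono) auto
  have I_bd: "I n \<le> B" for n using bd[of n] I_le by force
  have "\<exists>x\<in>K n. q x < I n + 1 / (real n + 1)" for n
  proof -
    have "Inf (q ` K n) < I n + 1 / (real n + 1)" by (simp add: I_def)
    then obtain y where "y \<in> q ` K n" "y < I n + 1 / (real n + 1)"
      using cInf_lessD[OF ne] by blast
    then show ?thesis by auto
  qed
  then obtain x where x: "\<And>n. x n \<in> K n" "\<And>n. q (x n) < I n + 1 / (real n + 1)" by metis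
  have "\<exists>N. \<forall>m\<ge>N. \<forall>n\<ge>N. D (x m) (x n) < e" if "e > 0" for e
  proof -
    \<comment> \<open>The infima increase as the sets shrink and are bounded by \<open>B\<close>.
      Midpoints of late terms stay in \<open>K N\<close> and cannot undercut \<open>I N\<close>, so
      \<open>D\<close> stays below
      \<open>2 * (L + e/8) + 2 * (L + e/8) - 4 * (L - e/8) = e\<close>.\<close>
    have "incseq I" using I_mono by (simp add: incseq_def)
    then obtain L where L: "I \<longlonglongrightarrow> L" "\<And>n. I n \<le> L"
      using incseq_convergent[of I B] I_bd by auto
    have "\<forall>\<^sub>F n in sequentially. L - e/8 < I n"
      by (rule order_tendstoD(1)[OF L(1)]) (use that in simp)
    moreover have "\<forall>\<^sub>F n in sequentially. 1 / (real n + 1) < e / 8"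
      using order_tendstoD(2)[OF LIMSEQ_inverse_real_of_nat, of "e/8"] that
      by (simp add: inverse_eq_divide add.commute)
    ultimately have "\<forall>\<^sub>F n in sequentially. L - e/8 < I n \<and> 1 / (real n + 1) < e / 8"
      by (rule eventually_conj)
    then obtain N where N: "\<And>n. n \<ge> N \<Longrightarrow> L - e/8 < I n \<and> 1 / (real n + 1) < e / 8"
      by (auto simp: eventually_sequentially)
    have "D (x m) (x n) < e" if "m \<ge> N" "n \<ge> N" for m n
    proof -
      have "x m \<in> K N" "x n \<in> K N" using x(1) sub that by blast+
      then have "I N \<le> q (mid (x m) (x n))" "x m \<in> K 0" "x n \<in> K 0"
        using mid I_le sub[of 0 N] by blast+
      with par[of "x m" "x n"] x(2)[of m] x(2)[of n] N[of N] N[OF that(1)] N[OF that(2)]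
        L(2)[of m] L(2)[of n]
      show ?thesis by linarith
    qed
    then show ?thesis by blast
  qed
  moreover have "q (x n) \<le> q y + 1 / (real n + 1)" if "y \<in> K n" for n y
    using x(2)[of n] I_le[OF that] by linarith
  ultimately show thesis using x(1) that by blast
qed

section \<open>Test functions\<close>

lemma partial_deriv_eqI:
  "(f has_derivative D) (at x) \<Longrightarrow> partial_deriv k f x = D (axis k 1)"
  unfolding partial_deriv_def by (metis frechet_derivative_at)

lemma partial_deriv_add:
  assumes "f differentiable (at x)" "g differentiable (at x)"
  shows "partial_deriv k (\<lambda>x. f x + g x) x = partial_deriv k f x + partial_deriv k g x"
  using has_derivative_add[OF assms[unfolded frechet_derivative_works]]
  by (subst partial_deriv_eqI) (auto simp: partial_deriv_def)

lemma partial_deriv_mult: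
  assumes "f differentiable (at x)" "g differentiable (at x)"
  shows "partial_deriv k (\<lambda>x. f x * g x) x = f x * partial_deriv k g x + partial_deriv k f x * g x"
  using has_derivative_mult[OF assms[unfolded frechet_derivative_works]]
  by (subst partial_deriv_eqI) (auto simp: partial_deriv_def)

lemma partial_deriv_linear:
  assumes "f differentiable (at x)" "bounded_linear L"
  shows "partial_deriv k (\<lambda>x. L (f x)) x = L (partial_deriv k f x)"
  using bounded_linear.has_derivative[OF assms(2) assms(1)[unfolded frechet_derivative_works]]
  by (subst partial_deriv_eqI) (auto simp: partial_deriv_def)

lemma partial_deriv_translate:
  assumes "f differentiable (at (x + a))"
  shows "partial_deriv k (\<lambda>x. f (x + a)) x = partial_deriv k f (x + a)"
proof -
  have *: "((\<lambda>x. x + a) has_derivative (\<lambda>h. h)) (at x)"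
    by (auto intro!: derivative_eq_intros)
  from has_derivative_compose[OF this assms[unfolded frechet_derivative_works]]
  show ?thesis by (subst partial_deriv_eqI) (auto simp: partial_deriv_def)
qed

lemma C_k_Suc_imp_continuous: "C_k (Suc m) f \<Longrightarrow> continuous_on UNIV f"
  by (auto simp: continuous_on_eq_continuous_within intro: differentiable_imp_continuous_within)

lemma C_k_SucD: "C_k (Suc m) f \<Longrightarrow> C_k m f"
proof (induction m arbitrary: f)
  case 0
  then show ?case using C_k_Suc_imp_continuous[of 0 f] by simp
qed auto

lemma C_k_imp_continuous: "C_k m f \<Longrightarrow> continuous_on UNIV f"
  by (cases m) (use C_k_Suc_imp_continuous in auto)

lemma C_k_const: "C_k m (\<lambda>x::real^'n::finite. c)"
proof (induction m arbitrary: c)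
  case (Suc m)
  have "partial_deriv k (\<lambda>x::real^'n. c) = (\<lambda>x. 0)" for k
    by (rule ext, subst partial_deriv_eqI[OF has_derivative_const]) simp
  with Suc show ?case by simp
qed simp

lemma C_k_add: "C_k m f \<Longrightarrow> C_k m g \<Longrightarrow> C_k m (\<lambda>x. f x + g x)"
proof (induction m arbitrary: f g)
  case (Suc m)
  then have "partial_deriv k (\<lambda>x. f x + g x) = (\<lambda>x. partial_deriv k f x + partial_deriv k g x)" for k
    by (intro ext partial_deriv_add) auto
  with Suc show ?case by auto
qed (auto intro: continuous_intros)

lemma C_k_mult: "C_k m f \<Longrightarrow> C_k m g \<Longrightarrow> C_k m (\<lambda>x. f x * g x)"
proof (induction m arbitrary: f g)
  case (Suc m)
  then have "partial_deriv k (\<lambda>x. f x * g x) =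
      (\<lambda>x. f x * partial_deriv k g x + partial_deriv k f x * g x)" for k
    by (intro ext partial_deriv_mult) auto
  moreover have "C_k m f" "C_k m g" using Suc.prems C_k_SucD by blast+
  ultimately show ?case using Suc by (auto intro!: C_k_add)
qed (auto intro: continuous_intros)

lemma C_k_linear: "C_k m f \<Longrightarrow> bounded_linear L \<Longrightarrow> C_k m (\<lambda>x. L (f x))"
proof (induction m arbitrary: f)
  case (Suc m)
  then have "partial_deriv k (\<lambda>x. L (f x)) = (\<lambda>x. L (partial_deriv k f x))" for k
    by (intro ext partial_deriv_linear) auto
  with Suc show ?case
    by (auto intro: differentiable_compose[of L] bounded_linear_imp_differentiable)
qed (auto intro: bounded_linear.continuous_on)

lemma C_k_translate: "C_k m f \<Longrightarrow> C_k m (\<lambda>x. f (x + a))"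
proof (induction m arbitrary: f)
  case 0
  then show ?case by (auto intro!: continuous_on_compose2[of UNIV f] continuous_intros)
next
  case (Suc m)
  then have "partial_deriv k (\<lambda>x. f (x + a)) = (\<lambda>x. partial_deriv k f (x + a))" for k
    by (intro ext partial_deriv_translate) auto
  moreover have "(\<lambda>x. f (x + a)) differentiable (at x)" for x
    using Suc.prems by (intro differentiable_compose[of f "\<lambda>x. x + a"]) (auto intro!: derivative_intros)
  ultimately show ?case using Suc by auto
qed

lemma C_k_prod:
  "finite I \<Longrightarrow> (\<And>i. i \<in> I \<Longrightarrow> C_k m (f i)) \<Longrightarrow> C_k m (\<lambda>x. \<Prod>i\<in>I. f i x)"
  by (induction I rule: finite_induct) (auto intro: C_k_const C_k_mult)

text \<open>The whole family of derivatives is given because a partial derivative replaces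
  \<open>D j\<close> by \<open>D (Suc j)\<close> times a constant; the induction on \<open>m\<close>
  therefore runs with \<open>j\<close> free.\<close>

lemma C_k_of_coordinate:
  fixes D :: "nat \<Rightarrow> real \<Rightarrow> real"
  assumes D: "\<And>j t. (D j has_real_derivative D (Suc j) t) (at t)"
  shows "C_k m (\<lambda>x::real^'n::finite. complex_of_real (D j (x $ i)))"
proof (induction m arbitrary: j)
  case 0
  have "continuous_on UNIV (D j)"
    using D by (intro DERIV_continuous_on) (auto intro: DERIV_subset)
  then show ?case
    by (auto intro!: continuous_intros continuous_on_compose2[of UNIV "D j"])
next
  case (Suc m)
  have der: "((\<lambda>x::real^'n. complex_of_real (D j (x $ i))) has_derivative
      (\<lambda>h. complex_of_real (D (Suc j) (x $ i) * h $ i))) (at x)" for x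
  proof -
    have "((\<lambda>x::real^'n. x $ i) has_derivative (\<lambda>h. h $ i)) (at x)"
      by (intro bounded_linear_imp_has_derivative bounded_linear_vec_nth)
    from has_derivative_compose[OF this D[of j, unfolded has_field_derivative_def]]
    have "((\<lambda>x::real^'n. D j (x $ i)) has_derivative (\<lambda>h. D (Suc j) (x $ i) * h $ i)) (at x)" .
    from bounded_linear.has_derivative[OF bounded_linear_of_real this] show ?thesis by simp
  qed
  have "partial_deriv k (\<lambda>x::real^'n. complex_of_real (D j (x $ i))) =
      (\<lambda>x. complex_of_real (axis k 1 $ i) * complex_of_real (D (Suc j) (x $ i)))" for k
    by (rule ext, subst partial_deriv_eqI[OF der]) simp
  then show ?case
    using Suc[of "Suc j"] der by (auto simp: differentiable_def intro!: C_k_mult C_k_const)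
qed

lemma C_k_real_polynomial_function:
  fixes p :: "real ^ 'n::finite \<Rightarrow> real"
  assumes "real_polynomial_function p"
  shows "C_k m (\<lambda>x. complex_of_real (p x))"
  using assms
proof (induction arbitrary: m)
  case (linear f)
  then have bl: "bounded_linear (\<lambda>x. complex_of_real (f x))"
    by (intro bounded_linear_compose[OF bounded_linear_of_real])
  show ?case
  proof (cases m)
    case 0
    then show ?thesis using linear by (simp add: linear_continuous_on)
  next
    case (Suc m')
    have "partial_deriv k (\<lambda>x. complex_of_real (f x)) = (\<lambda>x. complex_of_real (f (axis k 1)))" for k
      by (rule ext, subst partial_deriv_eqI[OF bounded_linear_imp_has_derivative[OF bl]]) simp
    then show ?thesis
      using Suc bl by (auto intro: C_k_const bounded_linear_imp_differentiable)
  qed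
qed (auto intro: C_k_const C_k_add C_k_mult)

lemma test_functionsI:
  assumes "\<And>m. C_k m v" "compact K" "K \<subseteq> \<Omega>" "\<And>x. x \<notin> K \<Longrightarrow> v x = 0"
  shows "v \<in> test_functions \<Omega>"
proof -
  have sub: "{x. v x \<noteq> 0} \<subseteq> K" using assms(4) by auto
  have "closure {x. v x \<noteq> 0} \<subseteq> K"
    using sub assms(2) by (intro closure_minimal) (auto simp: compact_imp_closed)
  moreover have "compact (closure {x. v x \<noteq> 0})"
    unfolding compact_closure by (rule bounded_subset[OF compact_imp_bounded[OF assms(2)] sub])
  ultimately show ?thesis
    using assms(1,3) by (auto simp: test_functions_def)
qed

lemma test_functionsE:
  assumes "v \<in> test_functions \<Omega>"
  obtains K where "compact K" "K \<subseteq> \<Omega>" "\<And>x. x \<notin> K \<Longrightarrow> v x = 0"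
  using assms closure_subset[of "{x. v x \<noteq> 0}"]
  by (intro that[of "closure {x. v x \<noteq> 0}"]) (auto simp: test_functions_def)

lemma test_functions_C_k: "v \<in> test_functions \<Omega> \<Longrightarrow> C_k m v"
  by (simp add: test_functions_def)

lemma test_functions_differentiable: "v \<in> test_functions \<Omega> \<Longrightarrow> v differentiable (at x)"
  using test_functions_C_k[of v \<Omega> "Suc 0"] by simp

lemma test_functions_continuous: "v \<in> test_functions \<Omega> \<Longrightarrow> continuous_on S v"
  using test_functions_C_k[of v \<Omega> 0] continuous_on_subset by auto

lemma test_functions_mono: "\<Omega> \<subseteq> \<Omega>' \<Longrightarrow> v \<in> test_functions \<Omega> \<Longrightarrow> v \<in> test_functions \<Omega>'"
  by (auto simp: test_functions_def)

lemma test_functions_zero [simp]: "(\<lambda>x. 0) \<in> test_functions \<Omega>"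
  by (rule test_functionsI[of _ "{}"]) (auto intro: C_k_const)

lemma test_functions_add:
  assumes "u \<in> test_functions \<Omega>" "v \<in> test_functions \<Omega>"
  shows "(\<lambda>x. u x + v x) \<in> test_functions \<Omega>"
proof -
  obtain K L where "compact K" "K \<subseteq> \<Omega>" "\<And>x. x \<notin> K \<Longrightarrow> u x = 0"
    "compact L" "L \<subseteq> \<Omega>" "\<And>x. x \<notin> L \<Longrightarrow> v x = 0"
    using assms by (auto elim!: test_functionsE)
  then show ?thesis
    using assms by (intro test_functionsI[of _ "K \<union> L"]) (auto intro: C_k_add test_functions_C_k)
qed

lemma test_functions_linear:
  assumes "v \<in> test_functions \<Omega>" "bounded_linear L"
  shows "(\<lambda>x. L (v x)) \<in> test_functions \<Omega>"
proof -
  obtain K where "compact K" "K \<subseteq> \<Omega>" "\<And>x. x \<notin> K \<Longrightarrow> v x = 0"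
    using assms by (auto elim!: test_functionsE)
  then show ?thesis
    using assms bounded_linear.linear[THEN linear_0]
    by (intro test_functionsI[of _ K]) (auto intro: C_k_linear test_functions_C_k)
qed

lemma test_functions_cmult: "v \<in> test_functions \<Omega> \<Longrightarrow> (\<lambda>x. c * v x) \<in> test_functions \<Omega>"
  by (rule test_functions_linear[OF _ bounded_linear_mult_right])

lemma test_functions_cnj: "v \<in> test_functions \<Omega> \<Longrightarrow> (\<lambda>x. cnj (v x)) \<in> test_functions \<Omega>"
  by (rule test_functions_linear[OF _ bounded_linear_cnj])

lemma test_functions_partial_deriv:
  assumes "v \<in> test_functions \<Omega>"
  shows "partial_deriv k v \<in> test_functions \<Omega>"
proof -
  obtain K where K: "compact K" "K \<subseteq> \<Omega>" "\<And>x. x \<notin> K \<Longrightarrow> v x = 0"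
    using assms by (auto elim!: test_functionsE)
  have "partial_deriv k v x = 0" if "x \<notin> K" for x
  proof -
    have "(v has_derivative (\<lambda>h. 0)) (at x)"
    proof (rule has_derivative_transform_within_open[OF has_derivative_const])
      show "open (- K)" using K by (simp add: compact_imp_closed open_Compl)
    qed (use that K in auto)
    then show ?thesis by (simp add: partial_deriv_eqI)
  qed
  then show ?thesis
    using K test_functions_C_k[OF assms, of "Suc _"] by (intro test_functionsI[of _ K]) auto
qed

lemma test_functions_translate:
  assumes v: "v \<in> test_functions U" and sub: "\<And>x. x \<in> U \<Longrightarrow> x - a \<in> \<Omega>"
  shows "(\<lambda>x. v (x + a)) \<in> test_functions \<Omega>"
proof -
  obtain K where K: "compact K" "K \<subseteq> U" "\<And>x. x \<notin> K \<Longrightarrow> v x = 0"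
    using v by (auto elim!: test_functionsE)
  show ?thesis
  proof (rule test_functionsI[of _ "(\<lambda>x. x - a) ` K"])
    show "compact ((\<lambda>x. x - a) ` K)"
      using K by (intro compact_continuous_image continuous_intros)
    show "v (x + a) = 0" if "x \<notin> (\<lambda>x. x - a) ` K" for x
      using that K(3)[of "x + a"] by (metis add_diff_cancel image_eqI)
  qed (use K sub v in \<open>auto intro: C_k_translate test_functions_C_k\<close>)
qed

lemma test_functions_bounded:
  assumes "v \<in> test_functions \<Omega>"
  obtains B where "B > 0" "\<And>x. norm (v x) \<le> B"
proof -
  obtain K where K: "compact K" "K \<subseteq> \<Omega>" "\<And>x. x \<notin> K \<Longrightarrow> v x = 0"
    using assms by (auto elim!: test_functionsE)
  have "bounded (v ` K)"
    using K test_functions_continuous[OF assms]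
    by (intro compact_imp_bounded compact_continuous_image)
  then obtain B where "B > 0" "\<And>x. x \<in> K \<Longrightarrow> norm (v x) \<le> B"
    by (auto simp: bounded_pos)
  then show thesis using K(3) by (intro that[of B]) (metis norm_zero less_imp_le)+
qed

lemma test_functions_measurable: "v \<in> test_functions \<Omega> \<Longrightarrow> v \<in> borel_measurable (lebesgue_on S)"
  using borel_measurable_continuous_onI[OF test_functions_continuous[of v \<Omega> UNIV]]
  by (intro measurable_restrict_space1) (auto intro: measurable_completion)

subsection \<open>Bump functions of boxes\<close>

text \<open>The polynomials \<open>p\<close> for which the derivatives of
  \<open>exp (- (1 / s))\<close> are \<open>p (1 / s) * exp (- (1 / s))\<close>. Differentiating
  such a product in \<open>s\<close> produces the square of \<open>1 / s\<close> times
  \<open>p - p'\<close> at \<open>1 / s\<close>, which is the recursion.\<close>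

fun flat_poly :: "nat \<Rightarrow> real poly" where
  "flat_poly 0 = 1"
| "flat_poly (Suc j) = [:0, 0, 1:] * (flat_poly j - pderiv (flat_poly j))"

definition flat_exp :: "nat \<Rightarrow> real \<Rightarrow> real" where
  "flat_exp j s = (if s > 0 then poly (flat_poly j) (1 / s) * exp (- (1 / s)) else 0)"

lemma poly_times_exp_minus_tendsto_0:
  fixes p :: "real poly"
  shows "((\<lambda>y. poly p y * exp (- y)) \<longlongrightarrow> 0) at_top"
proof -
  have "((\<lambda>y. \<Sum>i\<le>degree p. coeff p i * (y ^ i / exp y)) \<longlongrightarrow> (\<Sum>i\<le>degree p. coeff p i * 0)) at_top"
    by (intro tendsto_intros tendsto_power_div_exp_0)
  then show ?thesis
    by (simp add: poly_altdef sum_distrib_right exp_minus divide_inverse mult.assoc)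
qed

lemma flat_exp_has_derivative: "(flat_exp j has_real_derivative flat_exp (Suc j) t) (at t)"
proof (cases t "0::real" rule: linorder_cases)
  case less
  have "((\<lambda>s. 0) has_real_derivative flat_exp (Suc j) t) (at t)"
    using less by (simp add: flat_exp_def)
  then show ?thesis
    by (rule has_field_derivative_transform_within[where d = "- t"])
       (use less in \<open>auto simp: flat_exp_def dist_real_def\<close>)
next
  case greater
  have "((\<lambda>s. poly (flat_poly j) (1 / s) * exp (- (1 / s))) has_real_derivative flat_exp (Suc j) t) (at t)"
    by (rule derivative_eq_intros refl poly_DERIV[THEN DERIV_chain2] | use greater in \<open>simp; fail\<close>)+
       (use greater in \<open>simp add: flat_exp_def field_simps power2_eq_square\<close>)
  then show ?thesis
    by (rule has_field_derivative_transform_within[where d = t])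
       (use greater in \<open>auto simp: flat_exp_def dist_real_def\<close>)
next
  case equal
  \<comment> \<open>Flatness at 0 comes from exponential decay: with \<open>y = inverse h\<close>
    the quotient is a polynomial in \<open>y\<close> times \<open>exp (- y)\<close>, and
    \<open>y\<close> tends to infinity.\<close>
  have "((\<lambda>h. flat_exp j h / h) \<longlongrightarrow> 0) (at_right 0)"
  proof -
    have "((\<lambda>h. poly ([:0, 1:] * flat_poly j) (inverse h) * exp (- inverse h)) \<longlongrightarrow> 0) (at_right 0)"
      by (rule filterlim_compose[OF poly_times_exp_minus_tendsto_0 filterlim_inverse_at_top_right])
    then show ?thesis
      by (rule Lim_transform_eventually)
         (auto simp: eventually_at_filter flat_exp_def field_simps)
  qed
  moreover have "((\<lambda>h. flat_exp j h / h) \<longlongrightarrow> 0) (at_left 0)"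
    by (rule Lim_transform_eventually[OF tendsto_const])
       (auto simp: eventually_at_filter flat_exp_def)
  ultimately have "((\<lambda>h. flat_exp j h / h) \<longlongrightarrow> 0) (at 0)"
    by (simp add: filterlim_split_at)
  then show ?thesis
    using equal by (simp add: DERIV_def flat_exp_def)
qed

text \<open>The factor \<open>r\<close> steepens the flanks without moving the support, so the bumps
  converge pointwise to the indicator of the open box as \<open>r\<close> grows. The arguments are
  kept in the form \<open>c * x + d\<close> to match \<open>C_k_flat_exp_affine\<close>.\<close>

definition box_bump :: "real ^ 'n::finite \<Rightarrow> real ^ 'n \<Rightarrow> real \<Rightarrow> real ^ 'n \<Rightarrow> complex" where
  "box_bump a b r x = (\<Prod>i\<in>UNIV. complex_of_real (flat_exp 0 (r * (x $ i) + r * - (a $ i))) *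
     complex_of_real (flat_exp 0 (- r * (x $ i) + r * (b $ i))))"

lemma C_k_flat_exp_affine:
  "C_k m (\<lambda>x::real^'n::finite. complex_of_real (flat_exp 0 (c * (x $ i) + d)))"
proof -
  have "((\<lambda>t. c ^ j * flat_exp j (c * t + d)) has_real_derivative
      c ^ Suc j * flat_exp (Suc j) (c * t + d)) (at t)" for j t
    by (rule derivative_eq_intros refl flat_exp_has_derivative[THEN DERIV_chain2] | simp)+
  from C_k_of_coordinate[of "\<lambda>j t. c ^ j * flat_exp j (c * t + d)", OF this, of m 0 i]
  show ?thesis by simp
qed

lemma flat_exp_0_bounds: "0 \<le> flat_exp 0 s" "flat_exp 0 s \<le> 1"
  by (auto simp: flat_exp_def)

lemma box_bump_eq_0:
  assumes "r > 0" "x \<notin> box a b"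
  shows "box_bump a b r x = 0"
proof -
  from assms(2) obtain i where "x $ i \<le> a $ i \<or> b $ i \<le> x $ i"
    by (auto simp: mem_box_cart not_less)
  then have "r * (x $ i) + r * - (a $ i) \<le> 0 \<or> - r * (x $ i) + r * (b $ i) \<le> 0"
    using assms(1) by auto
  then have "flat_exp 0 (r * (x $ i) + r * - (a $ i)) = 0 \<or> flat_exp 0 (- r * (x $ i) + r * (b $ i)) = 0"
    unfolding flat_exp_def by auto
  then have "complex_of_real (flat_exp 0 (r * (x $ i) + r * - (a $ i))) *
     complex_of_real (flat_exp 0 (- r * (x $ i) + r * (b $ i))) = 0" by auto
  then show ?thesis
    unfolding box_bump_def by (intro prod_zero) auto
qed

lemma norm_box_bump_le_1: "norm (box_bump a b r x) \<le> 1"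
  unfolding box_bump_def prod_norm[symmetric]
  by (intro prod_le_1) (auto simp: norm_mult flat_exp_0_bounds intro!: mult_le_one)

lemma box_bump_test_function:
  assumes "r > 0" "cbox a b \<subseteq> \<Omega>"
  shows "box_bump a b r \<in> test_functions \<Omega>"
proof (rule test_functionsI[of _ "cbox a b"])
  show "C_k m (box_bump a b r)" for m
    unfolding box_bump_def by (intro C_k_prod C_k_mult C_k_flat_exp_affine) auto
  show "box_bump a b r x = 0" if "x \<notin> cbox a b" for x
    using that box_subset_cbox by (intro box_bump_eq_0 assms) blast
qed (use assms in auto)

lemma cnj_box_bump: "cnj (box_bump a b r x) = box_bump a b r x"
  by (simp add: box_bump_def)

lemma box_bump_tendsto_indicator:
  fixes x :: "real ^ 'n::finite"
  shows "(\<lambda>n. box_bump a b (real (Suc n)) x) \<longlonglongrightarrow> indicator (box a b) x"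
proof (cases "x \<in> box a b")
  case True
  have flat: "(\<lambda>n. flat_exp 0 (real (Suc n) * s)) \<longlonglongrightarrow> 1" if "s > 0" for s
  proof -
    have "(\<lambda>n. exp (- ((1 / s) * inverse (real (Suc n))))) \<longlonglongrightarrow> exp (- ((1 / s) * 0))"
      by (intro tendsto_intros LIMSEQ_inverse_real_of_nat)
    moreover have "flat_exp 0 (real (Suc n) * s) = exp (- ((1 / s) * inverse (real (Suc n))))" for n
      using that by (simp add: flat_exp_def divide_inverse mult.commute del: of_nat_Suc)
    ultimately show ?thesis by simp
  qed
  have "(\<lambda>n. \<Prod>i\<in>UNIV. complex_of_real (flat_exp 0 (real (Suc n) * (x $ i - a $ i))) *
      complex_of_real (flat_exp 0 (real (Suc n) * (b $ i - x $ i))))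
    \<longlonglongrightarrow> (\<Prod>i\<in>(UNIV::'n set). complex_of_real 1 * complex_of_real 1)"
    using True by (intro tendsto_prod tendsto_mult tendsto_of_real flat) (auto simp: mem_box_cart)
  moreover have "(\<Prod>i\<in>UNIV. complex_of_real (flat_exp 0 (real (Suc n) * (x $ i - a $ i))) *
      complex_of_real (flat_exp 0 (real (Suc n) * (b $ i - x $ i)))) = box_bump a b (real (Suc n)) x" for n
    unfolding box_bump_def by (simp only: right_diff_distrib) (simp add: algebra_simps)
  ultimately show ?thesis using True by simp
next
  case False
  then show ?thesis by (simp add: box_bump_eq_0)
qed


subsection \<open>The fundamental lemma of the calculus of variations\<close>

text \<open>Dynkin's argument: open boxes are stable under intersection and generate the Borel sets.
  The integral over the whole space is assumed separately for the step to complements.\<close>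

lemma AE_eq_0_if_box_integrals_0:
  fixes F :: "'a::euclidean_space \<Rightarrow> real"
  assumes F: "integrable lebesgue F" "(\<integral>x. F x \<partial>lebesgue) = 0"
    and box: "\<And>a b. (\<integral>x. indicator (box a b) x * F x \<partial>lebesgue) = 0"
  shows "AE x in lebesgue. F x = 0"
proof -
  have int: "integrable lebesgue (\<lambda>x. indicator A x * F x)" if "A \<in> sets lebesgue" for A
    using integrable_mult_indicator[OF that F(1)] by simp
  have borel: "(\<integral>x. indicator A x * F x \<partial>lebesgue) = 0" if "A \<in> sets borel" for A
  proof -
    let ?G = "range (\<lambda>(a, b). box a b :: 'a set)"
    have "Int_stable ?G"
      by (auto simp: Int_stable_def box_Int_box)
    moreover have "?G \<subseteq> Pow UNIV" by simp
    moreover have "A \<in> sigma_sets UNIV ?G" using that by (simp add: borel_eq_box)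
    ultimately show ?thesis
    proof (induction rule: sigma_sets_induct_disjoint)
      case (basic A)
      then show ?case using box by auto
    next
      case (compl A)
      then have A: "A \<in> sets lebesgue" by (simp add: borel_eq_box)
      have "(\<integral>x. indicator (UNIV - A) x * F x \<partial>lebesgue) = (\<integral>x. F x - indicator A x * F x \<partial>lebesgue)"
        by (intro Bochner_Integration.integral_cong) (auto simp: indicator_def)
      then show ?case using compl F int[OF A] by simp
    next
      case (union A)
      have "A i \<in> sigma_sets UNIV ?G" for i using union by blast
      then have A: "A i \<in> sets lebesgue" for i by (simp add: borel_eq_box)
      have "set_integrable lebesgue (\<Union>i. A i) F"
        using int[of "\<Union>i. A i"] A by (auto simp: set_integrable_def)
      from lebesgue_integral_countable_add[OF _ _ this] A union
      show ?case by (auto simp: set_lebesgue_integral_def disjoint_family_on_def)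
    qed auto
  qed
  \<comment> \<open>A Lebesgue set differs from a Borel set by a null set, so all set integrals of
    \<open>F\<close> agree with those of 0 and uniqueness of densities applies.\<close>
  have "(\<integral>x\<in>A. F x \<partial>lebesgue) = (\<integral>x\<in>A. 0 \<partial>lebesgue)" if A: "A \<in> sets lebesgue" for A
  proof -
    obtain S N N' where SN: "A = S \<union> N" "N \<subseteq> N'" "N' \<in> null_sets lborel" "S \<in> sets lborel"
      using A by (rule sets_completionE)
    then have "N' \<in> null_sets lebesgue" by (intro null_sets_completionI)
    then have "AE x in lebesgue. x \<notin> N'" by (rule AE_not_in)
    then have "AE x in lebesgue. indicator A x * F x = indicator S x * F x"
      by eventually_elim (use SN in \<open>auto simp: indicator_def\<close>)
    then have "(\<integral>x. indicator A x * F x \<partial>lebesgue) = (\<integral>x. indicator S x * F x \<partial>lebesgue)"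
      using int[OF A] int[of S] SN by (intro integral_cong_AE) auto
    then show ?thesis using borel[of S] SN by (simp add: set_lebesgue_integral_def)
  qed
  from density_unique_real[OF F(1) _ this] show ?thesis by simp
qed

lemma L1_locD:
  assumes "f \<in> L1_loc \<Omega>"
  shows "f \<in> borel_measurable (lebesgue_on \<Omega>)"
    "\<And>K. compact K \<Longrightarrow> K \<subseteq> \<Omega> \<Longrightarrow> integrable (lebesgue_on K) f"
  using assms by (auto simp: L1_loc_def)

text \<open>Box bumps converge boundedly to the indicator of a box, so the integrals of
  \<open>f\<close> over boxes vanish. Only self-conjugate test functions are demanded, which the
  proof that test functions are dense in \<open>L2\<close> exploits.\<close>

lemma fundamental_lemma_calculus_of_variations:
  assumes U: "open U" and f: "f \<in> L1_loc U"
    and zero: "\<And>v. v \<in> test_functions U \<Longrightarrow> (\<And>x. cnj (v x) = v x) \<Longrightarrow>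
      (\<integral>x. f x * v x \<partial>lebesgue_on U) = 0"
  shows "AE x in lebesgue_on U. f x = 0"
proof -
  have Us: "U \<in> sets lebesgue" using U by simp
  have int_cbox: "integrable lebesgue (\<lambda>x. indicator (cbox a b) x *\<^sub>R f x)" if "cbox a b \<subseteq> U" for a b
    using L1_locD(2)[OF f _ that] by (simp add: integrable_restrict_space)
  have f0: "(\<lambda>x. indicator U x *\<^sub>R f x) \<in> borel_measurable lebesgue"
    using L1_locD(1)[OF f] Us by (simp add: borel_measurable_restrict_space_iff)
  have box0: "(\<integral>x. indicator (box a b) x *\<^sub>R f x \<partial>lebesgue) = 0" if sub: "cbox a b \<subseteq> U" for a b
  proof -
    let ?s = "\<lambda>n x. (indicator U x *\<^sub>R f x) * box_bump a b (real (Suc n)) x"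
    have test: "box_bump a b (real (Suc n)) \<in> test_functions U" for n
      using sub by (intro box_bump_test_function) auto
    have "(\<lambda>n. \<integral>x. ?s n x \<partial>lebesgue) \<longlonglongrightarrow> (\<integral>x. indicator (box a b) x *\<^sub>R f x \<partial>lebesgue)"
    proof (rule integral_dominated_convergence[where w = "\<lambda>x. norm (indicator (cbox a b) x *\<^sub>R f x)"])
      show "?s n \<in> borel_measurable lebesgue" for n
        using test_functions_measurable[OF test[of n], of UNIV]
        by (intro borel_measurable_times f0) (simp add: lebesgue_on_UNIV_eq)
      show "(\<lambda>x. indicator (box a b) x *\<^sub>R f x) \<in> borel_measurable lebesgue"
      proof -
        have eq: "(\<lambda>x. indicator (box a b) x *\<^sub>R f x) = (\<lambda>x. indicator (box a b) x *\<^sub>R (indicator U x *\<^sub>R f x))"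
          using sub box_subset_cbox[of a b] by (auto simp: indicator_def fun_eq_iff)
        show ?thesis unfolding eq by (intro borel_measurable_scaleR[OF borel_measurable_indicator f0]) simp
      qed
      show "integrable lebesgue (\<lambda>x. norm (indicator (cbox a b) x *\<^sub>R f x))"
        using int_cbox[OF sub] by (rule integrable_norm)
      show "AE x in lebesgue. (\<lambda>n. ?s n x) \<longlonglongrightarrow> indicator (box a b) x *\<^sub>R f x"
      proof (rule AE_I2)
        fix x
        have "(\<lambda>n. ?s n x) \<longlonglongrightarrow> (indicator U x *\<^sub>R f x) * indicator (box a b) x"
          by (intro tendsto_mult tendsto_const box_bump_tendsto_indicator)
        moreover have "(indicator U x *\<^sub>R f x) * indicator (box a b) x = indicator (box a b) x *\<^sub>R f x"
          using sub box_subset_cbox[of a b] by (auto simp: indicator_def)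
        ultimately show "(\<lambda>n. ?s n x) \<longlonglongrightarrow> indicator (box a b) x *\<^sub>R f x" by simp
      qed
      show "AE x in lebesgue. norm (?s n x) \<le> norm (indicator (cbox a b) x *\<^sub>R f x)" for n
      proof (rule AE_I2)
        fix x
        show "norm (?s n x) \<le> norm (indicator (cbox a b) x *\<^sub>R f x)"
        proof (cases "x \<in> cbox a b")
          case True
          then show ?thesis
            using sub mult_left_mono[OF norm_box_bump_le_1[of a b "real (Suc n)" x], of "norm (f x)"]
            by (auto simp: norm_mult)
        next
          case False
          then have "x \<notin> box a b" using box_subset_cbox by blast
          then show ?thesis by (simp add: box_bump_eq_0)
        qed
      qed
    qed
    moreover have "(\<integral>x. ?s n x \<partial>lebesgue) = 0" for n
    proof -
      have "(\<integral>x. ?s n x \<partial>lebesgue) = (\<integral>x. f x * box_bump a b (real (Suc n)) x \<partial>lebesgue_on U)"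
        using Us by (subst integral_restrict_space) auto
      then show ?thesis using zero[OF test cnj_box_bump] by simp
    qed
    ultimately show ?thesis by (simp add: LIMSEQ_const_iff)
  qed
  \<comment> \<open>As \<open>f\<close> is only locally integrable, the criterion for boxes is
    applied to \<open>f\<close> cut off to one box whose closed version lies in \<open>U\<close>;
    countably many closed boxes cover \<open>U\<close>.\<close>
  have cbox: "AE x in lebesgue. x \<in> cbox A C \<longrightarrow> f x = 0" if sub: "cbox A C \<subseteq> U" for A C
  proof -
    let ?F = "\<lambda>x. indicator (box A C) x *\<^sub>R f x"
    have int: "integrable lebesgue ?F"
    proof -
      have "integrable lebesgue (\<lambda>x. indicator (box A C) x *\<^sub>R (indicator (cbox A C) x *\<^sub>R f x))"
        by (intro integrable_mult_indicator int_cbox[OF sub]) simp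
      also have "(\<lambda>x. indicator (box A C) x *\<^sub>R (indicator (cbox A C) x *\<^sub>R f x)) = ?F"
        using box_subset_cbox[of A C] by (auto simp: indicator_def fun_eq_iff)
      finally show ?thesis .
    qed
    have box_int: "(\<integral>x. indicator (box a b) x *\<^sub>R ?F x \<partial>lebesgue) = 0" for a b
    proof -
      \<comment> \<open>An arbitrary box meets \<open>box A C\<close> in the open box with these
        corners, and the closed box with the same corners is still contained in
        \<open>cbox A C\<close>.\<close>
      let ?a = "\<Sum>i\<in>Basis. max (a \<bullet> i) (A \<bullet> i) *\<^sub>R i" and ?b = "\<Sum>i\<in>Basis. min (b \<bullet> i) (C \<bullet> i) *\<^sub>R i"
      have "cbox ?a ?b \<subseteq> cbox A C" by (auto simp: mem_box)
      then have zero: "(\<integral>x. indicator (box ?a ?b) x *\<^sub>R f x \<partial>lebesgue) = 0"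
        using sub by (intro box0) auto
      have eq: "indicator (box a b) x *\<^sub>R ?F x = indicator (box ?a ?b) x *\<^sub>R f x" for x
        unfolding box_Int_box[symmetric] by (auto simp: indicator_def)
      show ?thesis unfolding eq by (rule zero)
    qed
    have "AE x in lebesgue. Re (?F x) = 0"
    proof (rule AE_eq_0_if_box_integrals_0)
      show "(\<integral>x. Re (?F x) \<partial>lebesgue) = 0"
        using box0[OF sub] int by (simp only: integral_Re) simp
      have I: "integrable lebesgue (\<lambda>x. indicator (box a b) x *\<^sub>R ?F x)" for a b
        by (intro integrable_mult_indicator int) simp
      show "(\<integral>x. indicator (box a b) x * Re (?F x) \<partial>lebesgue) = 0" for a b
        using integral_Re[OF I[of a b]] unfolding box_int scaleR_complex.sel by simp
    qed (use int in \<open>intro integrable_Re\<close>)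
    moreover have "AE x in lebesgue. Im (?F x) = 0"
    proof (rule AE_eq_0_if_box_integrals_0)
      show "(\<integral>x. Im (?F x) \<partial>lebesgue) = 0"
        using box0[OF sub] int by (simp only: integral_Im) simp
      have I: "integrable lebesgue (\<lambda>x. indicator (box a b) x *\<^sub>R ?F x)" for a b
        by (intro integrable_mult_indicator int) simp
      show "(\<integral>x. indicator (box a b) x * Im (?F x) \<partial>lebesgue) = 0" for a b
        using integral_Im[OF I[of a b]] unfolding box_int scaleR_complex.sel by simp
    qed (use int in \<open>intro integrable_Im\<close>)
    moreover have "AE x in lebesgue. x \<notin> cbox A C - box A C"
      using negligible_frontier_interval[of A C] by (intro AE_not_in) (simp add: negligible_iff_null_sets)
    ultimately show ?thesis
      by eventually_elim (auto simp: complex_eq_iff)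
  qed
  obtain \<D> where D: "countable \<D>" "\<D> \<subseteq> Pow U" "\<And>X. X \<in> \<D> \<Longrightarrow> \<exists>a b. X = cbox a b" "\<Union>\<D> = U"
    by (rule open_countable_Union_open_cbox[OF U]) blast
  have "AE x in lebesgue. \<forall>X\<in>\<D>. x \<in> X \<longrightarrow> f x = 0"
  proof (subst AE_ball_countable[OF D(1)], rule ballI)
    fix X assume X: "X \<in> \<D>"
    then obtain a b where "X = cbox a b" using D(3) by blast
    then show "AE x in lebesgue. x \<in> X \<longrightarrow> f x = 0" using D(2) X cbox[of a b] by blast
  qed
  then have "AE x in lebesgue. x \<in> U \<longrightarrow> f x = 0"
    by eventually_elim (use D(4) in auto)
  then show ?thesis using Us by (simp add: AE_restrict_space_iff)
qed

section \<open>Weak derivatives on bounded open sets\<close>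

text \<open>Serves as weak sequential compactness: the functional \<open>c\<close> is already known
  as a limit along \<open>F\<close>, and a representing \<open>G\<close> with the same norm bound
  arises as the strong limit of near-minimisers of the norm.\<close>

lemma L2_weak_limit:
  assumes F: "\<And>n. F n \<in> L2 M" "\<And>n. L2_norm M (F n) \<le> B" and V: "V \<subseteq> L2 M"
    and lim: "\<And>v. v \<in> V \<Longrightarrow> (\<lambda>n. \<integral>x. F n x * v x \<partial>M) \<longlonglongrightarrow> c v"
  obtains G where "G \<in> L2 M" "L2_norm M G \<le> B" "\<And>v. v \<in> V \<Longrightarrow> (\<integral>x. G x * v x \<partial>M) = c v"
proof -
  \<comment> \<open>\<open>K n\<close> collects the functions of norm at most \<open>B\<close> that
    obey every error bound for \<open>c v\<close> obeyed by the whole tail of \<open>F\<close> from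
    \<open>n\<close> on. Quantifying over the error \<open>e\<close> keeps the condition stable
    under midpoints and makes \<open>F n\<close> a member.\<close>
  define K where "K n = {G \<in> L2 M. L2_norm M G \<le> B \<and> (\<forall>v\<in>V. \<forall>e.
    (\<forall>m\<ge>n. norm ((\<integral>x. F m x * v x \<partial>M) - c v) \<le> e) \<longrightarrow> norm ((\<integral>x. G x * v x \<partial>M) - c v) \<le> e)}" for n
  have mid: "(\<lambda>x. (G x + H x) / 2) \<in> K n" if G: "G \<in> K n" and H: "H \<in> K n" for n G H
  proof -
    have L: "G \<in> L2 M" "H \<in> L2 M" using G H by (auto simp: K_def)
    have half: "norm ((a + b) / 2) \<le> e" if "norm a \<le> e" "norm b \<le> e" for a b :: complex and e
      using norm_triangle_ineq[of a b] that by (simp add: norm_divide)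
    have "L2_norm M (\<lambda>x. (1/2) * (G x + H x)) \<le> B"
      unfolding L2_norm_cmult using L2_norm_triangle[OF L] G H by (auto simp: K_def)
    moreover have "norm ((\<integral>x. (G x + H x) / 2 * v x \<partial>M) - c v) \<le> e"
      if "v \<in> V" "\<forall>m\<ge>n. norm ((\<integral>x. F m x * v x \<partial>M) - c v) \<le> e" for v e
    proof -
      have v: "v \<in> L2 M" using that V by auto
      have eq: "(\<lambda>x. (G x + H x) / 2 * v x) = (\<lambda>x. (1/2) * (G x * v x) + (1/2) * (H x * v x))"
        by (auto simp: field_simps)
      have eq': "(\<integral>x. (G x + H x) / 2 * v x \<partial>M) - c v
          = (((\<integral>x. G x * v x \<partial>M) - c v) + ((\<integral>x. H x * v x \<partial>M) - c v)) / 2"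
        unfolding eq using L2_mult_integrable[OF L(1) v] L2_mult_integrable[OF L(2) v]
        by (simp add: field_simps)
      have "norm ((\<integral>x. G x * v x \<partial>M) - c v) \<le> e" "norm ((\<integral>x. H x * v x \<partial>M) - c v) \<le> e"
        using G H that by (auto simp: K_def)
      then show ?thesis unfolding eq' by (rule half)
    qed
    ultimately show ?thesis
      using L2_cmult[OF L2_add[OF L], of "1/2"] by (auto simp: K_def)
  qed
  have FK: "F n \<in> K n" for n using F by (auto simp: K_def)
  have bd: "\<exists>G\<in>K n. (L2_norm M G)\<^sup>2 \<le> B\<^sup>2" for n
    using FK[of n] F(2)[of n] by (intro bexI[of _ "F n"]) (auto intro: power_mono)
  obtain G where G: "\<And>n. G n \<in> K n"
    and C: "\<And>e. e > 0 \<Longrightarrow> \<exists>N. \<forall>m\<ge>N. \<forall>n\<ge>N. (L2_norm M (\<lambda>x. G m x - G n x))\<^sup>2 < e"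
  proof (rule near_minimisers_Cauchy[of K "\<lambda>G H x. (G x + H x) / 2"
        "\<lambda>G H. (L2_norm M (\<lambda>x. G x - H x))\<^sup>2" "\<lambda>G. (L2_norm M G)\<^sup>2" "B\<^sup>2"])
    show "K (Suc n) \<subseteq> K n" for n unfolding K_def using Suc_leD by blast
    show "(L2_norm M (\<lambda>x. G x - H x))\<^sup>2 \<le> 2 * (L2_norm M G)\<^sup>2 + 2 * (L2_norm M H)\<^sup>2 -
        4 * (L2_norm M (\<lambda>x. (G x + H x) / 2))\<^sup>2" if "G \<in> K 0" "H \<in> K 0" for G H
      using that L2_norm_parallelogram[of G M H] by (simp add: K_def)
  qed (use mid bd in auto)
  have GL: "G n \<in> L2 M" "L2_norm M (G n) \<le> B" for n using G[of n] by (auto simp: K_def)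
  have "\<exists>N. \<forall>m\<ge>N. \<forall>n\<ge>N. L2_norm M (\<lambda>x. G m x - G n x) < e" if "e > 0" for e
    using C[of "e\<^sup>2"] that power_less_imp_less_base[of _ 2 e] by (simp add: less_imp_le) blast
  then obtain g where g: "g \<in> L2 M" "(\<lambda>n. L2_norm M (\<lambda>x. G n x - g x)) \<longlonglongrightarrow> 0"
    using L2_complete[of G M, OF GL(1)] by blast
  have "L2_norm M g \<le> B"
    by (rule LIMSEQ_le_const2[OF L2_norm_tendsto[OF GL(1) g]]) (use GL in auto)
  moreover have "(\<integral>x. g x * v x \<partial>M) = c v" if "v \<in> V" for v
  proof (rule LIMSEQ_unique)
    show "(\<lambda>n. \<integral>x. G n x * v x \<partial>M) \<longlonglongrightarrow> (\<integral>x. g x * v x \<partial>M)"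
      using that V by (intro L2_integral_tendsto GL g) auto
    show "(\<lambda>n. \<integral>x. G n x * v x \<partial>M) \<longlonglongrightarrow> c v"
    proof (rule LIMSEQ_I)
      fix e :: real assume "e > 0"
      then obtain N where N: "\<And>n. n \<ge> N \<Longrightarrow> norm ((\<integral>x. F n x * v x \<partial>M) - c v) < e / 2"
        using LIMSEQ_D[OF lim[OF \<open>v \<in> V\<close>], of "e/2"] by auto
      have "norm ((\<integral>x. G n x * v x \<partial>M) - c v) < e" if "n \<ge> N" for n
      proof -
        have "\<forall>m\<ge>n. norm ((\<integral>x. F m x * v x \<partial>M) - c v) \<le> e / 2"
          using N that less_imp_le order_trans by blast
        then have "norm ((\<integral>x. G n x * v x \<partial>M) - c v) \<le> e / 2"
          using G[of n] \<open>v \<in> V\<close> unfolding K_def by blast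
        then show ?thesis using \<open>e > 0\<close> by simp
      qed
      then show "\<exists>N. \<forall>n\<ge>N. norm ((\<integral>x. G n x * v x \<partial>M) - c v) < e" by blast
    qed
  qed
  ultimately show thesis using g(1) that by blast
qed

lemma L1_loc_mult_test_integrable:
  assumes g: "g \<in> L1_loc \<Omega>" and v: "v \<in> test_functions \<Omega>" and \<Omega>: "\<Omega> \<in> sets lebesgue"
  shows "integrable (lebesgue_on \<Omega>) (\<lambda>x. g x * v x)"
proof -
  obtain K where K: "compact K" "K \<subseteq> \<Omega>" "\<And>x. x \<notin> K \<Longrightarrow> v x = 0"
    using v by (auto elim: test_functionsE)
  obtain B where B: "\<And>x. norm (v x) \<le> B" using test_functions_bounded[OF v] by blast
  have Ks: "K \<in> sets lebesgue" using K(1) by (simp add: compact_imp_closed)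
  have "integrable (lebesgue_on K) (\<lambda>x. g x * v x)"
  proof (rule Bochner_Integration.integrable_bound[of _ "\<lambda>x. complex_of_real B * g x"])
    show "integrable (lebesgue_on K) (\<lambda>x. complex_of_real B * g x)"
      using L1_locD(2)[OF g K(1,2)] by simp
    show "(\<lambda>x. g x * v x) \<in> borel_measurable (lebesgue_on K)"
      using L1_locD(2)[OF g K(1,2)] test_functions_measurable[OF v] by auto
    show "AE x in lebesgue_on K. norm (g x * v x) \<le> norm (complex_of_real B * g x)"
    proof (rule AE_I2)
      fix x
      have "norm (g x) * norm (v x) \<le> norm (g x) * \<bar>B\<bar>"
        using B[of x] by (intro mult_left_mono) auto
      then show "norm (g x * v x) \<le> norm (complex_of_real B * g x)"
        by (simp add: norm_mult mult.commute)
    qed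
  qed
  moreover have "(\<lambda>x. indicator \<Omega> x *\<^sub>R (g x * v x)) = (\<lambda>x. indicator K x *\<^sub>R (g x * v x))"
    using K by (auto simp: indicator_def fun_eq_iff)
  ultimately show ?thesis using Ks \<Omega> by (simp add: integrable_restrict_space)
qed

lemma L1_loc_diff:
  assumes "f \<in> L1_loc \<Omega>" "g \<in> L1_loc \<Omega>"
  shows "(\<lambda>x. f x - g x) \<in> L1_loc \<Omega>"
  using assms by (auto simp: L1_loc_def)

lemma is_weak_derivD:
  "is_weak_deriv \<Omega> k u g \<Longrightarrow> v \<in> test_functions \<Omega> \<Longrightarrow>
    (\<integral>x. u x * partial_deriv k v x \<partial>lebesgue_on \<Omega>) = - (\<integral>x. g x * v x \<partial>lebesgue_on \<Omega>)"
  by (auto simp: is_weak_deriv_def)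

text \<open>Since \<open>weak_deriv\<close> is an arbitrary choice among representatives, every
  later fact about it is an almost-everywhere statement derived from this uniqueness.\<close>

lemma weak_deriv_unique:
  assumes \<Omega>: "open \<Omega>" and g: "is_weak_deriv \<Omega> k u g" and g': "is_weak_deriv \<Omega> k u g'"
  shows "AE x in lebesgue_on \<Omega>. g x = g' x"
proof -
  have L: "g \<in> L1_loc \<Omega>" "g' \<in> L1_loc \<Omega>" using g g' by (auto simp: is_weak_deriv_def)
  have "AE x in lebesgue_on \<Omega>. g x - g' x = 0"
  proof (rule fundamental_lemma_calculus_of_variations[OF \<Omega> L1_loc_diff[OF L]])
    fix v assume v: "v \<in> test_functions \<Omega>"
    have "(\<integral>x. (g x - g' x) * v x \<partial>lebesgue_on \<Omega>)
        = (\<integral>x. g x * v x \<partial>lebesgue_on \<Omega>) - (\<integral>x. g' x * v x \<partial>lebesgue_on \<Omega>)"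
      using L1_loc_mult_test_integrable[OF L(1) v] L1_loc_mult_test_integrable[OF L(2) v] \<Omega>
      by (simp add: left_diff_distrib)
    moreover have "(\<integral>x. g x * v x \<partial>lebesgue_on \<Omega>) = (\<integral>x. g' x * v x \<partial>lebesgue_on \<Omega>)"
      using is_weak_derivD[OF g v] is_weak_derivD[OF g' v] by simp
    ultimately show "(\<integral>x. (g x - g' x) * v x \<partial>lebesgue_on \<Omega>) = 0" by simp
  qed
  then show ?thesis by simp
qed

lemma is_weak_deriv_weak_deriv:
  "is_weak_deriv \<Omega> k u g \<Longrightarrow> is_weak_deriv \<Omega> k u (weak_deriv \<Omega> k u)"
  unfolding weak_deriv_def by (rule someI[of "is_weak_deriv \<Omega> k u"])

lemma weak_deriv_AE_eq:
  "open \<Omega> \<Longrightarrow> is_weak_deriv \<Omega> k u g \<Longrightarrow> AE x in lebesgue_on \<Omega>. weak_deriv \<Omega> k u x = g x"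
  by (rule weak_deriv_unique[OF _ is_weak_deriv_weak_deriv])

section \<open>Function spaces over a bounded open set\<close>

locale bounded_open =
  fixes \<Omega> :: "(real ^ 'n::finite) set"
  assumes open_Omega: "open \<Omega>" and bounded_Omega: "bounded \<Omega>"
begin

abbreviation M where "M \<equiv> lebesgue_on \<Omega>"

abbreviation wd where "wd k u \<equiv> weak_deriv \<Omega> k u"

lemma Omega_sets [simp, measurable]: "\<Omega> \<in> sets lebesgue"
  using open_Omega by simp

sublocale finite_measure M
  by (intro finite_measure_lebesgue_on lmeasurable_open open_Omega bounded_Omega)

lemma L2_bounded:
  assumes "f \<in> borel_measurable M" "AE x in M. norm (f x) \<le> B"
  shows "f \<in> L2 M"
proof (rule L2_dominated[OF _ assms(1)])
  show "(\<lambda>x. complex_of_real B) \<in> L2 M" by (rule L2_I) auto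
  show "AE x in M. norm (f x) \<le> norm (complex_of_real B)"
    using assms(2) by eventually_elim auto
qed

lemma L2_const: "(\<lambda>x. c) \<in> L2 M"
  by (rule L2_bounded[of _ "norm c"]) auto

lemma L2_norm_bounded_le:
  assumes "f \<in> borel_measurable M" "AE x in M. norm (f x) \<le> B" "B \<ge> 0"
  shows "L2_norm M f \<le> B * L2_norm M (\<lambda>x. 1)"
proof -
  have "L2_norm M f \<le> L2_norm M (\<lambda>x. complex_of_real B * 1)"
    by (intro L2_norm_mono assms L2_cmult L2_const) (use assms in auto)
  also have "\<dots> = B * L2_norm M (\<lambda>x. 1)" unfolding L2_norm_cmult using assms(3) by simp
  finally show ?thesis .
qed

lemma L2_integrable_self: "f \<in> L2 M \<Longrightarrow> integrable M f"
  using L2_mult_integrable[OF _ L2_const, of f 1] by simp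

lemma L2_imp_L1_loc:
  assumes "f \<in> L2 M"
  shows "f \<in> L1_loc \<Omega>"
proof -
  have "integrable (lebesgue_on K) f" if "compact K" "K \<subseteq> \<Omega>" for K
  proof -
    have Ks: "K \<in> sets lebesgue" using that by (simp add: compact_imp_closed)
    have "integrable lebesgue (\<lambda>x. indicator \<Omega> x *\<^sub>R f x)"
      using L2_integrable_self[OF assms] by (simp add: integrable_restrict_space)
    then have "integrable lebesgue (\<lambda>x. indicator K x *\<^sub>R (indicator \<Omega> x *\<^sub>R f x))"
      by (rule integrable_mult_indicator[OF Ks])
    also have "(\<lambda>x. indicator K x *\<^sub>R (indicator \<Omega> x *\<^sub>R f x)) = (\<lambda>x. indicator K x *\<^sub>R f x)"
      using that by (auto simp: indicator_def fun_eq_iff)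
    finally show ?thesis using Ks by (simp add: integrable_restrict_space)
  qed
  then show ?thesis using L2_measurable[OF assms] by (auto simp: L1_loc_def)
qed

lemma test_functions_L2:
  assumes "v \<in> test_functions S"
  shows "v \<in> L2 M"
proof -
  obtain B where "\<And>x. norm (v x) \<le> B" using test_functions_bounded[OF assms] by blast
  then show ?thesis by (intro L2_bounded[of v B] test_functions_measurable[OF assms]) auto
qed

subsection \<open>The space H1\<close>

lemma is_weak_derivI:
  assumes "u \<in> L2 M" "g \<in> L2 M"
    "\<And>v. v \<in> test_functions \<Omega> \<Longrightarrow>
      (\<integral>x. u x * partial_deriv k v x \<partial>M) = - (\<integral>x. g x * v x \<partial>M)"
  shows "is_weak_deriv \<Omega> k u g"
  using assms by (auto simp: is_weak_deriv_def L2_imp_L1_loc)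

lemma H1_I:
  assumes "u \<in> L2 M" "\<And>k. g k \<in> L2 M" "\<And>k. is_weak_deriv \<Omega> k u (g k)"
  shows "u \<in> H1 \<Omega>"
  using assms by (auto simp: H1_def)

lemma H1_L2: "u \<in> H1 \<Omega> \<Longrightarrow> u \<in> L2 M"
  by (simp add: H1_def)

lemma H1_weak_deriv: "u \<in> H1 \<Omega> \<Longrightarrow> is_weak_deriv \<Omega> k u (wd k u)"
  by (auto simp: H1_def intro: is_weak_deriv_weak_deriv)

lemma H1_wd_L2:
  assumes "u \<in> H1 \<Omega>"
  shows "wd k u \<in> L2 M"
proof -
  obtain g where g: "g \<in> L2 M" "is_weak_deriv \<Omega> k u g" using assms by (auto simp: H1_def)
  have "wd k u \<in> borel_measurable M"
    using H1_weak_deriv[OF assms] by (auto simp: is_weak_deriv_def L1_loc_def)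
  then show ?thesis by (rule L2_cong_AE[OF g(1) _ weak_deriv_AE_eq[OF open_Omega g(2)]])
qed

lemma wd_eq_AE:
  "is_weak_deriv \<Omega> k u g \<Longrightarrow> AE x in M. wd k u x = g x"
  by (rule weak_deriv_AE_eq[OF open_Omega])

lemma is_weak_deriv_linear:
  assumes u: "u \<in> H1 \<Omega>" and v: "v \<in> H1 \<Omega>"
  shows "is_weak_deriv \<Omega> k (\<lambda>x. a * u x + b * v x) (\<lambda>x. a * wd k u x + b * wd k v x)"
proof (rule is_weak_derivI)
  note L = H1_L2[OF u] H1_L2[OF v] H1_wd_L2[OF u] H1_wd_L2[OF v]
  show "(\<lambda>x. a * u x + b * v x) \<in> L2 M" "(\<lambda>x. a * wd k u x + b * wd k v x) \<in> L2 M"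
    using L by (auto intro!: L2_add L2_cmult)
  fix w assume w: "w \<in> test_functions \<Omega>"
  note wL = test_functions_L2[OF w] test_functions_L2[OF test_functions_partial_deriv[OF w]]
  have lin: "(\<integral>x. (a * f x + b * g x) * h x \<partial>M) = a * (\<integral>x. f x * h x \<partial>M) + b * (\<integral>x. g x * h x \<partial>M)"
    if "f \<in> L2 M" "g \<in> L2 M" "h \<in> L2 M" for f g h
    using L2_mult_integrable[OF that(1,3)] L2_mult_integrable[OF that(2,3)]
    by (simp add: distrib_right mult.assoc)
  show "(\<integral>x. (a * u x + b * v x) * partial_deriv k w x \<partial>M) =
      - (\<integral>x. (a * wd k u x + b * wd k v x) * w x \<partial>M)"
    using is_weak_derivD[OF H1_weak_deriv[OF u] w] is_weak_derivD[OF H1_weak_deriv[OF v] w]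
    by (simp add: lin[OF L(1,2) wL(2)] lin[OF L(3,4) wL(1)])
qed

lemma H1_linear:
  assumes "u \<in> H1 \<Omega>" "v \<in> H1 \<Omega>"
  shows "(\<lambda>x. a * u x + b * v x) \<in> H1 \<Omega>"
proof (rule H1_I)
  show "(\<lambda>x. a * u x + b * v x) \<in> L2 M"
    by (rule L2_add[OF L2_cmult[OF H1_L2[OF assms(1)]] L2_cmult[OF H1_L2[OF assms(2)]]])
  show "(\<lambda>x. a * wd k u x + b * wd k v x) \<in> L2 M" for k
    by (rule L2_add[OF L2_cmult[OF H1_wd_L2[OF assms(1)]] L2_cmult[OF H1_wd_L2[OF assms(2)]]])
  show "is_weak_deriv \<Omega> k (\<lambda>x. a * u x + b * v x) (\<lambda>x. a * wd k u x + b * wd k v x)" for k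
    by (rule is_weak_deriv_linear[OF assms])
qed

lemma wd_linear:
  assumes "u \<in> H1 \<Omega>" "v \<in> H1 \<Omega>"
  shows "AE x in M. wd k (\<lambda>x. a * u x + b * v x) x = a * wd k u x + b * wd k v x"
  by (rule wd_eq_AE[OF is_weak_deriv_linear[OF assms]])

lemma H1_add: "u \<in> H1 \<Omega> \<Longrightarrow> v \<in> H1 \<Omega> \<Longrightarrow> (\<lambda>x. u x + v x) \<in> H1 \<Omega>"
  and H1_diff: "u \<in> H1 \<Omega> \<Longrightarrow> v \<in> H1 \<Omega> \<Longrightarrow> (\<lambda>x. u x - v x) \<in> H1 \<Omega>"
  and H1_midpoint: "u \<in> H1 \<Omega> \<Longrightarrow> v \<in> H1 \<Omega> \<Longrightarrow> (\<lambda>x. (u x + v x) / 2) \<in> H1 \<Omega>"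
  using H1_linear[of u v 1 1] H1_linear[of u v 1 "-1"] H1_linear[of u v "1/2" "1/2"]
  by (simp_all add: add_divide_distrib)

lemma wd_add: "u \<in> H1 \<Omega> \<Longrightarrow> v \<in> H1 \<Omega> \<Longrightarrow> AE x in M. wd k (\<lambda>x. u x + v x) x = wd k u x + wd k v x"
  and wd_diff: "u \<in> H1 \<Omega> \<Longrightarrow> v \<in> H1 \<Omega> \<Longrightarrow> AE x in M. wd k (\<lambda>x. u x - v x) x = wd k u x - wd k v x"
  and wd_midpoint: "u \<in> H1 \<Omega> \<Longrightarrow> v \<in> H1 \<Omega> \<Longrightarrow>
    AE x in M. wd k (\<lambda>x. (u x + v x) / 2) x = (wd k u x + wd k v x) / 2"
  using wd_linear[of u v k 1 1] wd_linear[of u v k 1 "-1"] wd_linear[of u v k "1/2" "1/2"]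
  by (simp_all add: add_divide_distrib)

lemma L2_norm_wd_diff:
  "u \<in> H1 \<Omega> \<Longrightarrow> v \<in> H1 \<Omega> \<Longrightarrow>
    L2_norm M (wd k (\<lambda>x. u x - v x)) = L2_norm M (\<lambda>x. wd k u x - wd k v x)"
  by (intro L2_norm_cong_AE wd_diff L2_measurable H1_wd_L2 L2_diff H1_diff)

lemma L2_norm_wd_add:
  "u \<in> H1 \<Omega> \<Longrightarrow> v \<in> H1 \<Omega> \<Longrightarrow>
    L2_norm M (wd k (\<lambda>x. u x + v x)) = L2_norm M (\<lambda>x. wd k u x + wd k v x)"
  by (intro L2_norm_cong_AE wd_add L2_measurable H1_wd_L2 L2_add H1_add)

lemma L2_norm_wd_midpoint:
  assumes "u \<in> H1 \<Omega>" "v \<in> H1 \<Omega>"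
  shows "L2_norm M (wd k (\<lambda>x. (u x + v x) / 2)) = L2_norm M (\<lambda>x. (wd k u x + wd k v x) / 2)"
  using L2_cmult[OF L2_add[OF H1_wd_L2[OF assms(1)] H1_wd_L2[OF assms(2)]], of "1/2" k k]
  by (intro L2_norm_cong_AE wd_midpoint L2_measurable H1_wd_L2 H1_midpoint assms) simp

lemma is_weak_deriv_cong_AE:
  assumes u: "u \<in> H1 \<Omega>" and v: "v \<in> borel_measurable M" "AE x in M. v x = u x"
  shows "is_weak_deriv \<Omega> k v (wd k u)"
proof (rule is_weak_derivI)
  fix w assume w: "w \<in> test_functions \<Omega>"
  have "(\<integral>x. v x * partial_deriv k w x \<partial>M) = (\<integral>x. u x * partial_deriv k w x \<partial>M)"
  proof (rule integral_cong_AE)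
    show "AE x in M. v x * partial_deriv k w x = u x * partial_deriv k w x"
      using v(2) by eventually_elim simp
  qed (intro borel_measurable_times v(1) L2_measurable[OF H1_L2[OF u]]
        test_functions_measurable[OF test_functions_partial_deriv[OF w]])+
  then show "(\<integral>x. v x * partial_deriv k w x \<partial>M) = - (\<integral>x. wd k u x * w x \<partial>M)"
    using is_weak_derivD[OF H1_weak_deriv[OF u] w] by simp
qed (use L2_cong_AE[OF H1_L2[OF u] v] H1_wd_L2[OF u] in auto)

lemma H1_cong_AE:
  assumes u: "u \<in> H1 \<Omega>" and v: "v \<in> borel_measurable M" "AE x in M. v x = u x"
  shows "v \<in> H1 \<Omega>"
  by (rule H1_I[OF _ H1_wd_L2[OF u] is_weak_deriv_cong_AE[OF assms]])
     (rule L2_cong_AE[OF H1_L2[OF u] v])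

lemma wd_cong_AE:
  assumes "u \<in> H1 \<Omega>" "v \<in> borel_measurable M" "AE x in M. v x = u x"
  shows "AE x in M. wd k v x = wd k u x"
  by (rule wd_eq_AE[OF is_weak_deriv_cong_AE[OF assms]])

section \<open>The norm of \<open>H1\<close>: triangle inequality, completeness, weak
  closedness\<close>

lemma H1_norm_cong_AE:
  assumes "u \<in> H1 \<Omega>" "v \<in> borel_measurable M" "AE x in M. v x = u x"
  shows "H1_norm \<Omega> v = H1_norm \<Omega> u"
proof -
  have "L2_norm M v = L2_norm M u"
    by (rule L2_norm_cong_AE[OF assms(3,2) L2_measurable[OF H1_L2[OF assms(1)]]])
  moreover have "L2_norm M (wd k v) = L2_norm M (wd k u)" for k
    by (rule L2_norm_cong_AE[OF wd_cong_AE[OF assms] L2_measurable[OF H1_wd_L2[OF H1_cong_AE[OF assms]]]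
          L2_measurable[OF H1_wd_L2[OF assms(1)]]])
  ultimately show ?thesis by (simp add: H1_norm_def)
qed

text \<open>Reading the norm as the Euclidean norm of a vector of \<open>L2\<close> norms reduces
  the triangle inequality in \<open>H1\<close> to the one in finite dimensions.\<close>

lemma H1_norm_eq_norm: "H1_norm \<Omega> u = norm (L2_norm M u, \<chi> k. L2_norm M (wd k u))"
  by (simp add: H1_norm_def norm_Pair norm_vec_def L2_set_def sum_nonneg)

lemma H1_norm_nonneg [simp]: "0 \<le> H1_norm \<Omega> u"
  by (simp add: H1_norm_eq_norm)

lemma H1_norm_squared:
  "(H1_norm \<Omega> u)\<^sup>2 = (L2_norm M u)\<^sup>2 + (\<Sum>k\<in>UNIV. (L2_norm M (wd k u))\<^sup>2)"
  by (simp add: H1_norm_def sum_nonneg)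

lemma L2_norm_le_H1_norm: "L2_norm M u \<le> H1_norm \<Omega> u"
  using norm_fst_le[of "L2_norm M u"] by (simp add: H1_norm_eq_norm)

lemma L2_norm_wd_le_H1_norm: "L2_norm M (wd k u) \<le> H1_norm \<Omega> u"
proof -
  have "L2_norm M (wd k u) \<le> norm (\<chi> k. L2_norm M (wd k u))"
    using component_le_norm_cart[of "\<chi> k. L2_norm M (wd k u)" k] by simp
  also have "\<dots> \<le> H1_norm \<Omega> u" unfolding H1_norm_eq_norm by (rule norm_snd_le)
  finally show ?thesis .
qed

lemma H1_norm_mono:
  assumes "L2_norm M u \<le> L2_norm M v" "\<And>k. L2_norm M (wd k u) \<le> L2_norm M (wd k v)"
  shows "H1_norm \<Omega> u \<le> H1_norm \<Omega> v"
  unfolding H1_norm_def using assms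
  by (intro real_sqrt_le_mono add_mono sum_mono power_mono) auto

lemma H1_norm_triangle:
  assumes "u \<in> H1 \<Omega>" "v \<in> H1 \<Omega>"
  shows "H1_norm \<Omega> (\<lambda>x. u x + v x) \<le> H1_norm \<Omega> u + H1_norm \<Omega> v"
proof -
  have "H1_norm \<Omega> (\<lambda>x. u x + v x) \<le> sqrt ((L2_norm M u + L2_norm M v)\<^sup>2 +
      (\<Sum>k\<in>UNIV. (L2_norm M (wd k u) + L2_norm M (wd k v))\<^sup>2))"
    unfolding H1_norm_def L2_norm_wd_add[OF assms]
    by (intro real_sqrt_le_mono add_mono sum_mono power_mono L2_norm_triangle H1_L2 H1_wd_L2
        assms L2_norm_nonneg)
  also have "\<dots> = norm (L2_norm M u + L2_norm M v, \<chi> k. L2_norm M (wd k u) + L2_norm M (wd k v))"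
    by (simp add: norm_Pair norm_vec_def L2_set_def sum_nonneg)
  also have "(L2_norm M u + L2_norm M v, \<chi> k. L2_norm M (wd k u) + L2_norm M (wd k v)) =
      (L2_norm M u, \<chi> k. L2_norm M (wd k u)) + (L2_norm M v, \<chi> k. L2_norm M (wd k v))"
    by (simp add: vec_eq_iff)
  also have "norm \<dots> \<le> H1_norm \<Omega> u + H1_norm \<Omega> v"
    unfolding H1_norm_eq_norm by (rule norm_triangle_ineq)
  finally show ?thesis .
qed

lemma H1_norm_parallelogram:
  assumes "u \<in> H1 \<Omega>" "v \<in> H1 \<Omega>"
  shows "(H1_norm \<Omega> (\<lambda>x. u x - v x))\<^sup>2 =
    2 * (H1_norm \<Omega> u)\<^sup>2 + 2 * (H1_norm \<Omega> v)\<^sup>2 - 4 * (H1_norm \<Omega> (\<lambda>x. (u x + v x) / 2))\<^sup>2"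
  unfolding H1_norm_squared L2_norm_wd_diff[OF assms] L2_norm_wd_midpoint[OF assms]
    L2_norm_parallelogram[OF H1_L2[OF assms(1)] H1_L2[OF assms(2)]]
    L2_norm_parallelogram[OF H1_wd_L2[OF assms(1)] H1_wd_L2[OF assms(2)]]
  by (simp add: sum.distrib sum_subtractf sum_distrib_left algebra_simps)

lemma H1_norm_cmult:
  assumes "u \<in> H1 \<Omega>"
  shows "H1_norm \<Omega> (\<lambda>x. c * u x) = norm c * H1_norm \<Omega> u"
proof -
  have "L2_norm M (wd k (\<lambda>x. c * u x)) = norm c * L2_norm M (wd k u)" for k
  proof -
    have "AE x in M. wd k (\<lambda>x. c * u x) x = c * wd k u x"
      using wd_linear[OF assms assms, of k c 0] by simp
    moreover have "(\<lambda>x. c * u x) \<in> H1 \<Omega>" using H1_linear[OF assms assms, of c 0] by simp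
    ultimately show ?thesis
      unfolding L2_norm_cmult[symmetric]
      by (intro L2_norm_cong_AE L2_measurable H1_wd_L2 L2_cmult assms)
  qed
  then show ?thesis
    unfolding H1_norm_def L2_norm_cmult
    by (simp add: power_mult_distrib real_sqrt_mult flip: sum_distrib_left distrib_left)
qed

lemma H1_norm_commute:
  assumes "u \<in> H1 \<Omega>" "v \<in> H1 \<Omega>"
  shows "H1_norm \<Omega> (\<lambda>x. u x - v x) = H1_norm \<Omega> (\<lambda>x. v x - u x)"
  using H1_norm_cmult[OF H1_diff[OF assms], of "-1"] by simp

lemma H1_norm_triangle_sub:
  assumes "u \<in> H1 \<Omega>" "v \<in> H1 \<Omega>" "w \<in> H1 \<Omega>"
  shows "H1_norm \<Omega> (\<lambda>x. u x - w x) \<le> H1_norm \<Omega> (\<lambda>x. u x - v x) + H1_norm \<Omega> (\<lambda>x. v x - w x)"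
  using H1_norm_triangle[OF H1_diff[OF assms(1,2)] H1_diff[OF assms(2,3)]] by simp

lemma H1_norm_triangle_diff:
  assumes "u \<in> H1 \<Omega>" "v \<in> H1 \<Omega>"
  shows "H1_norm \<Omega> (\<lambda>x. u x - v x) \<le> H1_norm \<Omega> u + H1_norm \<Omega> v"
  using H1_norm_triangle[OF assms(1), of "\<lambda>x. - v x"] H1_norm_cmult[OF assms(2), of "-1"]
    H1_linear[OF assms(2,2), of "-1" 0] by simp

lemma H1_norm_tendsto_0I:
  assumes "\<And>n. u n \<in> H1 \<Omega>" "v \<in> H1 \<Omega>"
    "(\<lambda>n. L2_norm M (\<lambda>x. u n x - v x)) \<longlonglongrightarrow> 0"
    "\<And>k. (\<lambda>n. L2_norm M (\<lambda>x. wd k (u n) x - wd k v x)) \<longlonglongrightarrow> 0"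
  shows "(\<lambda>n. H1_norm \<Omega> (\<lambda>x. u n x - v x)) \<longlonglongrightarrow> 0"
proof -
  have "(\<lambda>n. sqrt ((L2_norm M (\<lambda>x. u n x - v x))\<^sup>2 +
      (\<Sum>k\<in>UNIV. (L2_norm M (\<lambda>x. wd k (u n) x - wd k v x))\<^sup>2))) \<longlonglongrightarrow>
      sqrt (0\<^sup>2 + (\<Sum>k\<in>(UNIV::'n set). 0\<^sup>2))"
    by (intro tendsto_intros assms)
  then show ?thesis by (simp add: H1_norm_def L2_norm_wd_diff[OF assms(1,2)])
qed

lemma H1_norm_tendsto_0D:
  assumes "\<And>n. u n \<in> H1 \<Omega>" "v \<in> H1 \<Omega>" "(\<lambda>n. H1_norm \<Omega> (\<lambda>x. u n x - v x)) \<longlonglongrightarrow> 0"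
  shows "(\<lambda>n. L2_norm M (\<lambda>x. u n x - v x)) \<longlonglongrightarrow> 0"
    "(\<lambda>n. L2_norm M (\<lambda>x. wd k (u n) x - wd k v x)) \<longlonglongrightarrow> 0"
proof -
  show "(\<lambda>n. L2_norm M (\<lambda>x. u n x - v x)) \<longlonglongrightarrow> 0"
    by (rule tendsto_sandwich[OF _ _ tendsto_const assms(3)]) (auto simp: L2_norm_le_H1_norm)
  show "(\<lambda>n. L2_norm M (\<lambda>x. wd k (u n) x - wd k v x)) \<longlonglongrightarrow> 0"
    by (rule tendsto_sandwich[OF _ _ tendsto_const assms(3)])
       (auto simp: L2_norm_wd_le_H1_norm simp flip: L2_norm_wd_diff[OF assms(1,2)])
qed

lemma H1_norm_tendsto:
  assumes "\<And>n. u n \<in> H1 \<Omega>" "v \<in> H1 \<Omega>" "(\<lambda>n. H1_norm \<Omega> (\<lambda>x. u n x - v x)) \<longlonglongrightarrow> 0"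
  shows "(\<lambda>n. H1_norm \<Omega> (u n)) \<longlonglongrightarrow> H1_norm \<Omega> v"
  unfolding H1_norm_def
  by (intro tendsto_intros L2_norm_tendsto[OF H1_L2[OF assms(1)] H1_L2[OF assms(2)]]
      L2_norm_tendsto[OF H1_wd_L2[OF assms(1)] H1_wd_L2[OF assms(2)]] H1_norm_tendsto_0D assms)

text \<open>The identity defining a weak derivative is continuous in both functions with respect to
  \<open>L2\<close>, so the limits of the derivatives are the derivatives of the limit.\<close>

lemma H1_complete:
  assumes u: "\<And>n. u n \<in> H1 \<Omega>"
    and Cauchy: "\<And>e. e > 0 \<Longrightarrow> \<exists>N. \<forall>m\<ge>N. \<forall>n\<ge>N. H1_norm \<Omega> (\<lambda>x. u m x - u n x) < e"
  obtains v where "v \<in> H1 \<Omega>" "(\<lambda>n. H1_norm \<Omega> (\<lambda>x. u n x - v x)) \<longlonglongrightarrow> 0"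
proof -
  have "\<exists>N. \<forall>m\<ge>N. \<forall>n\<ge>N. L2_norm M (\<lambda>x. u m x - u n x) < e" if "e > 0" for e
    using Cauchy[OF that] L2_norm_le_H1_norm le_less_trans by blast
  then obtain v where v: "v \<in> L2 M" "(\<lambda>n. L2_norm M (\<lambda>x. u n x - v x)) \<longlonglongrightarrow> 0"
    using L2_complete[of u M, OF H1_L2[OF u]] by blast
  have "\<exists>g. g \<in> L2 M \<and> (\<lambda>n. L2_norm M (\<lambda>x. wd k (u n) x - g x)) \<longlonglongrightarrow> 0" for k
  proof -
    have "\<exists>N. \<forall>m\<ge>N. \<forall>n\<ge>N. L2_norm M (\<lambda>x. wd k (u m) x - wd k (u n) x) < e" if "e > 0" for e
      using Cauchy[OF that] L2_norm_wd_le_H1_norm le_less_trans L2_norm_wd_diff[OF u u] by metis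
    then show ?thesis
      using L2_complete[of "\<lambda>n. wd k (u n)" M, OF H1_wd_L2[OF u]] by blast
  qed
  then have "\<forall>k. \<exists>g. g \<in> L2 M \<and> (\<lambda>n. L2_norm M (\<lambda>x. wd k (u n) x - g x)) \<longlonglongrightarrow> 0" by blast
  from choice[OF this] obtain g where g: "\<And>k. g k \<in> L2 M"
    "\<And>k. (\<lambda>n. L2_norm M (\<lambda>x. wd k (u n) x - g k x)) \<longlonglongrightarrow> 0" by blast
  have wdv: "is_weak_deriv \<Omega> k v (g k)" for k
  proof (rule is_weak_derivI[OF v(1) g(1)])
    fix w assume w: "w \<in> test_functions \<Omega>"
    have "(\<lambda>n. \<integral>x. u n x * partial_deriv k w x \<partial>M) \<longlonglongrightarrow> (\<integral>x. v x * partial_deriv k w x \<partial>M)"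
      by (intro L2_integral_tendsto v H1_L2 u test_functions_L2[of _ \<Omega>] test_functions_partial_deriv w)
    moreover have "(\<lambda>n. - (\<integral>x. wd k (u n) x * w x \<partial>M)) \<longlonglongrightarrow> - (\<integral>x. g k x * w x \<partial>M)"
      by (intro tendsto_minus L2_integral_tendsto g H1_wd_L2 u test_functions_L2[of _ \<Omega>] w)
    ultimately show "(\<integral>x. v x * partial_deriv k w x \<partial>M) = - (\<integral>x. g k x * w x \<partial>M)"
      unfolding is_weak_derivD[OF H1_weak_deriv[OF u] w] by (rule LIMSEQ_unique)
  qed
  have vH: "v \<in> H1 \<Omega>" by (rule H1_I[OF v(1) g(1) wdv])
  have "L2_norm M (\<lambda>x. wd k (u n) x - wd k v x) = L2_norm M (\<lambda>x. wd k (u n) x - g k x)" for k n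
    by (intro L2_norm_cong_AE L2_measurable L2_diff H1_wd_L2 u vH g)
       (use wd_eq_AE[OF wdv[of k]] in eventually_elim, simp)
  then have "(\<lambda>n. H1_norm \<Omega> (\<lambda>x. u n x - v x)) \<longlonglongrightarrow> 0"
    using g(2) by (intro H1_norm_tendsto_0I u vH v) simp
  with vH show thesis by (rule that)
qed

text \<open>Near-minimisers of the \<open>H1\<close> norm among the elements of \<open>X\<close> at
  \<open>L2\<close> distance at most \<open>inverse (real (Suc n))\<close> from \<open>v\<close>
  converge in \<open>H1\<close>, and their limit can only be \<open>v\<close>. The bound
  \<open>B\<close> survives by comparison with the members \<open>u m\<close>. Used for
  \<open>X = H1_0 \<Omega>\<close> as weak closedness and for \<open>X = H1 \<Omega>\<close> as a
  membership criterion.\<close>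

lemma H1_bounded_L2_limit:
  assumes X: "X \<subseteq> H1 \<Omega>" "\<And>u v. u \<in> X \<Longrightarrow> v \<in> X \<Longrightarrow> (\<lambda>x. (u x + v x) / 2) \<in> X"
    and u: "\<And>n. u n \<in> X" "\<And>n. H1_norm \<Omega> (u n) \<le> B"
    and v: "v \<in> L2 M" "(\<lambda>n. L2_norm M (\<lambda>x. u n x - v x)) \<longlonglongrightarrow> 0"
  obtains w where "\<And>n. w n \<in> X" "v \<in> H1 \<Omega>" "(\<lambda>n. H1_norm \<Omega> (\<lambda>x. w n x - v x)) \<longlonglongrightarrow> 0"
    "H1_norm \<Omega> v \<le> B"
proof -
  define K where "K n = {w \<in> X. L2_norm M (\<lambda>x. w x - v x) \<le> inverse (real (Suc n))}" for n
  have decr: "K (Suc n) \<subseteq> K n" for n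
  proof -
    have "inverse (real (Suc (Suc n))) \<le> inverse (real (Suc n))" by (intro le_imp_inverse_le) auto
    then show ?thesis unfolding K_def using order_trans by blast
  qed
  have mid: "(\<lambda>x. (f x + g x) / 2) \<in> K n" if f: "f \<in> K n" and g: "g \<in> K n" for n f g
  proof -
    have L: "(\<lambda>x. f x - v x) \<in> L2 M" "(\<lambda>x. g x - v x) \<in> L2 M"
      using f g X(1) by (auto simp: K_def intro!: L2_diff[OF H1_L2 v(1)])
    have "L2_norm M (\<lambda>x. (f x + g x) / 2 - v x) = L2_norm M (\<lambda>x. (1/2) * ((f x - v x) + (g x - v x)))"
      by (intro arg_cong[of _ _ "L2_norm M"]) (auto simp: field_simps)
    also have "\<dots> = (1/2) * L2_norm M (\<lambda>x. (f x - v x) + (g x - v x))"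
      unfolding L2_norm_cmult by simp
    also have "\<dots> \<le> (1/2) * (L2_norm M (\<lambda>x. f x - v x) + L2_norm M (\<lambda>x. g x - v x))"
      using L2_norm_triangle[OF L] by simp
    also have "\<dots> \<le> inverse (real (Suc n))" using f g by (auto simp: K_def)
    finally show ?thesis using f g X(2) by (auto simp: K_def)
  qed
  have ne: "\<exists>m. u m \<in> K n" for n
  proof -
    have "\<forall>\<^sub>F m in sequentially. L2_norm M (\<lambda>x. u m x - v x) < inverse (real (Suc n))"
      by (rule order_tendstoD(2)[OF v(2)]) simp
    then obtain m where "L2_norm M (\<lambda>x. u m x - v x) < inverse (real (Suc n))"
      by (auto simp: eventually_sequentially)
    then show ?thesis using u by (auto simp: K_def intro!: exI[of _ m])
  qed
  have sq: "(H1_norm \<Omega> (u n))\<^sup>2 \<le> B\<^sup>2" for n using u(2) by (intro power_mono) auto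
  have KH: "w \<in> H1 \<Omega>" if "w \<in> K n" for w n using that X by (auto simp: K_def)
  obtain w where w: "\<And>n. w n \<in> K n"
    and wle: "\<And>n y. y \<in> K n \<Longrightarrow> (H1_norm \<Omega> (w n))\<^sup>2 \<le> (H1_norm \<Omega> y)\<^sup>2 + 1 / (real n + 1)"
    and C: "\<And>e. e > 0 \<Longrightarrow> \<exists>N. \<forall>m\<ge>N. \<forall>n\<ge>N. (H1_norm \<Omega> (\<lambda>x. w m x - w n x))\<^sup>2 < e"
  proof (rule near_minimisers_Cauchy[of K "\<lambda>f g x. (f x + g x) / 2"
      "\<lambda>f g. (H1_norm \<Omega> (\<lambda>x. f x - g x))\<^sup>2" "\<lambda>f. (H1_norm \<Omega> f)\<^sup>2" "B\<^sup>2"])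
    show "\<exists>x\<in>K n. (H1_norm \<Omega> x)\<^sup>2 \<le> B\<^sup>2" for n using ne[of n] sq by blast
  qed (use decr mid H1_norm_parallelogram[OF KH KH] in auto)
  have wH: "w n \<in> H1 \<Omega>" for n using KH w by blast
  have "\<exists>N. \<forall>m\<ge>N. \<forall>n\<ge>N. H1_norm \<Omega> (\<lambda>x. w m x - w n x) < e" if "e > 0" for e
    using C[of "e\<^sup>2"] that power_less_imp_less_base[of _ 2 e] by (simp add: less_imp_le) blast
  then obtain v' where v': "v' \<in> H1 \<Omega>" "(\<lambda>n. H1_norm \<Omega> (\<lambda>x. w n x - v' x)) \<longlonglongrightarrow> 0"
    using H1_complete[of w, OF wH] by blast
  have "(\<lambda>n. L2_norm M (\<lambda>x. w n x - v x)) \<longlonglongrightarrow> 0"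
  proof (rule tendsto_sandwich[OF _ _ tendsto_const LIMSEQ_inverse_real_of_nat])
    show "\<forall>\<^sub>F n in sequentially. L2_norm M (\<lambda>x. w n x - v x) \<le> inverse (real (Suc n))"
      using w by (auto simp: K_def)
  qed auto
  then have AE: "AE x in M. v x = v' x"
    by (rule L2_limit_unique[OF H1_L2[OF wH] v(1) H1_L2[OF v'(1)] _ H1_norm_tendsto_0D(1)[OF wH v']])
  have vH: "v \<in> H1 \<Omega>" by (rule H1_cong_AE[OF v'(1) L2_measurable[OF v(1)] AE])
  have "H1_norm \<Omega> (\<lambda>x. w n x - v x) = H1_norm \<Omega> (\<lambda>x. w n x - v' x)" for n
    by (rule H1_norm_cong_AE[OF H1_diff[OF wH v'(1)] L2_measurable[OF L2_diff[OF H1_L2[OF wH] v(1)]]])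
       (use AE in eventually_elim, simp)
  then have lim: "(\<lambda>n. H1_norm \<Omega> (\<lambda>x. w n x - v x)) \<longlonglongrightarrow> 0" using v'(2) by simp
  have "(H1_norm \<Omega> v)\<^sup>2 \<le> B\<^sup>2 + 0"
  proof (rule LIMSEQ_le)
    show "(\<lambda>n. (H1_norm \<Omega> (w n))\<^sup>2) \<longlonglongrightarrow> (H1_norm \<Omega> v)\<^sup>2"
      by (intro tendsto_power H1_norm_tendsto wH vH lim)
    show "(\<lambda>n. B\<^sup>2 + inverse (real (Suc n))) \<longlonglongrightarrow> B\<^sup>2 + 0"
      by (intro tendsto_intros LIMSEQ_inverse_real_of_nat)
    have "(H1_norm \<Omega> (w n))\<^sup>2 \<le> B\<^sup>2 + inverse (real (Suc n))" for n
    proof -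
      obtain m where "u m \<in> K n" using ne by blast
      from wle[OF this] sq[of m] show ?thesis by (simp add: inverse_eq_divide add.commute)
    qed
    then show "\<exists>N. \<forall>n\<ge>N. (H1_norm \<Omega> (w n))\<^sup>2 \<le> B\<^sup>2 + inverse (real (Suc n))" by blast
  qed
  moreover have "B \<ge> 0" using u(2)[of 0] H1_norm_nonneg order_trans by blast
  ultimately have "H1_norm \<Omega> v \<le> B" using power2_le_imp_le by force
  moreover have "w n \<in> X" for n using w by (auto simp: K_def)
  ultimately show thesis using vH lim that by blast
qed

end

section \<open>Difference quotients and Lipschitz truncations\<close>

lemma
  fixes a :: "'a::euclidean_space"
  shows lebesgue_measurable_translate: "(\<lambda>x. x + a) \<in> lebesgue \<rightarrow>\<^sub>M lebesgue"
    and lebesgue_distr_translate: "distr lebesgue lebesgue (\<lambda>x. x + a) = lebesgue"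
proof -
  have T: "(\<lambda>x. a + (\<Sum>j\<in>Basis. (1 * (x \<bullet> j)) *\<^sub>R j)) = (\<lambda>x. x + a)"
    by (simp add: euclidean_representation add.commute)
  show "(\<lambda>x. x + a) \<in> lebesgue \<rightarrow>\<^sub>M lebesgue"
    using lebesgue_affine_measurable[of "\<lambda>_. 1" a] unfolding T by simp
  show "distr lebesgue lebesgue (\<lambda>x. x + a) = lebesgue"
    using lebesgue_affine_euclidean[of "\<lambda>_. 1" a] unfolding T by (simp add: density_1)
qed

lemma integral_lebesgue_translate:
  fixes f :: "'a::euclidean_space \<Rightarrow> 'b::{banach, second_countable_topology}"
  assumes "f \<in> borel_measurable lebesgue"
  shows "(\<integral>x. f (x + a) \<partial>lebesgue) = (\<integral>x. f x \<partial>lebesgue)"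
  using integral_distr[OF lebesgue_measurable_translate[of a] assms]
  by (simp add: lebesgue_distr_translate)

lemma integrable_lebesgue_translate:
  fixes f :: "'a::euclidean_space \<Rightarrow> 'b::{banach, second_countable_topology}"
  assumes "integrable lebesgue f"
  shows "integrable lebesgue (\<lambda>x. f (x + a))"
  using integrable_distr[OF lebesgue_measurable_translate[of a], of f] assms
  by (simp add: lebesgue_distr_translate)

lemma test_functions_borel: "v \<in> test_functions S \<Longrightarrow> v \<in> borel_measurable lebesgue"
  using test_functions_measurable[of v S UNIV] by (simp add: lebesgue_on_UNIV_eq)

lemma test_functions_line_derivative:
  assumes "v \<in> test_functions S"
  shows "((\<lambda>t. v (x + t *\<^sub>R axis k 1)) has_vector_derivative
    partial_deriv k v (x + t *\<^sub>R axis k 1)) (at t)"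
proof -
  let ?D = "frechet_derivative v (at (x + t *\<^sub>R axis k 1))"
  have D: "(v has_derivative ?D) (at (x + t *\<^sub>R axis k 1))"
    using test_functions_differentiable[OF assms] by (simp add: frechet_derivative_works)
  have "((\<lambda>t. x + t *\<^sub>R axis k 1) has_derivative (\<lambda>h. h *\<^sub>R axis k 1)) (at t)"
    by (auto intro!: derivative_eq_intros)
  from has_derivative_compose[OF this D]
  have "((\<lambda>t. v (x + t *\<^sub>R axis k 1)) has_derivative (\<lambda>h. ?D (h *\<^sub>R axis k 1))) (at t)" .
  moreover have "?D (h *\<^sub>R axis k 1) = h *\<^sub>R ?D (axis k 1)" for h
    by (rule linear_cmul[OF has_derivative_linear[OF D]])
  ultimately show ?thesis by (simp add: has_vector_derivative_def partial_deriv_def)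
qed

lemma norm_vector_derivative_bound:
  fixes f :: "real \<Rightarrow> 'a::real_normed_vector"
  assumes "\<And>t. t \<in> closed_segment a b \<Longrightarrow> (f has_vector_derivative f' t) (at t)"
    "\<And>t. t \<in> closed_segment a b \<Longrightarrow> norm (f' t) \<le> B"
  shows "norm (f b - f a) \<le> B * \<bar>b - a\<bar>"
proof -
  have "norm (f b - f a) \<le> B * norm (b - a)"
  proof (rule differentiable_bound[of "closed_segment a b"])
    show "(f has_derivative (\<lambda>h. h *\<^sub>R f' t)) (at t within closed_segment a b)"
      if "t \<in> closed_segment a b" for t
      using assms(1)[OF that] by (auto simp: has_vector_derivative_def intro: has_derivative_at_withinI)
    show "onorm (\<lambda>h. h *\<^sub>R f' t) \<le> B" if "t \<in> closed_segment a b" for t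
    proof (rule onorm_bound)
      show "0 \<le> B" using assms(2)[OF that] norm_ge_zero order_trans by blast
      show "norm (h *\<^sub>R f' t) \<le> B * norm h" for h :: real
        using mult_left_mono[OF assms(2)[OF that], of "\<bar>h\<bar>"] by (simp add: mult.commute)
    qed
  qed auto
  then show ?thesis by simp
qed

text \<open>Restates the vector derivative as the limit of a complex quotient, the form in which
  dominated convergence delivers derivatives of integrals.\<close>

lemma has_vector_derivative_iff_quotient:
  fixes f :: "real \<Rightarrow> complex"
  shows "(f has_vector_derivative D) (at t) \<longleftrightarrow>
    ((\<lambda>s. (f (t + s) - f t) / complex_of_real s) \<longlongrightarrow> D) (at 0)"
proof -
  have "(f has_vector_derivative D) (at t) \<longleftrightarrow>
      ((\<lambda>s. norm (f (t + s) - f t - s *\<^sub>R D) / norm s) \<longlongrightarrow> 0) (at 0)"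
    by (simp add: has_vector_derivative_def has_derivative_at bounded_linear_scaleR_left)
  also have "\<dots> \<longleftrightarrow> ((\<lambda>s. norm ((f (t + s) - f t) / complex_of_real s - D)) \<longlongrightarrow> 0) (at 0)"
  proof (rule tendsto_cong, rule eventually_at_filter[THEN iffD2, OF always_eventually], intro allI impI)
    fix s :: real assume "s \<noteq> 0"
    then have "(f (t + s) - f t) / complex_of_real s - D = (f (t + s) - f t - s *\<^sub>R D) / complex_of_real s"
      by (simp add: field_simps scaleR_conv_of_real)
    then show "norm (f (t + s) - f t - s *\<^sub>R D) / norm s = norm ((f (t + s) - f t) / complex_of_real s - D)"
      by (simp add: norm_divide)
  qed
  finally show ?thesis by (simp add: tendsto_norm_zero_iff LIM_zero_iff)
qed

text \<open>Dominated convergence: by the mean value inequality the quotients of \<open>v\<close>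
  are bounded by a bound for its partial derivative, uniformly in the step.\<close>

lemma difference_quotient_integral_tendsto:
  assumes z: "integrable lebesgue z" and v: "v \<in> test_functions S"
  shows "((\<lambda>s. \<integral>x. z x * ((v (x + s *\<^sub>R axis k 1) - v x) / complex_of_real s) \<partial>lebesgue)
    \<longlongrightarrow> (\<integral>x. z x * partial_deriv k v x \<partial>lebesgue)) (at 0)"
proof -
  obtain B where B: "B > 0" "\<And>x. norm (partial_deriv k v x) \<le> B"
    using test_functions_bounded[OF test_functions_partial_deriv[OF v]] by blast
  have quot: "norm ((v (x + s *\<^sub>R axis k 1) - v x) / complex_of_real s) \<le> B" if "s \<noteq> 0" for x s
    using norm_vector_derivative_bound[of 0 s, OF test_functions_line_derivative[OF v, of x k] B(2)] that
    by (simp add: norm_divide divide_le_eq)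
  have lim: "((\<lambda>s. (v (x + s *\<^sub>R axis k 1) - v x) / complex_of_real s) \<longlongrightarrow> partial_deriv k v x) (at 0)" for x
    using test_functions_line_derivative[OF v, of x k 0] by (simp add: has_vector_derivative_iff_quotient)
  show ?thesis
  proof (subst tendsto_at_iff_sequentially, intro allI impI)
    fix X :: "nat \<Rightarrow> real"
    assume X: "\<forall>i. X i \<in> UNIV - {0}" "X \<longlonglongrightarrow> 0"
    show "((\<lambda>s. \<integral>x. z x * ((v (x + s *\<^sub>R axis k 1) - v x) / complex_of_real s) \<partial>lebesgue) \<circ> X)
        \<longlonglongrightarrow> (\<integral>x. z x * partial_deriv k v x \<partial>lebesgue)"
      unfolding comp_def
    proof (rule integral_dominated_convergence[where w = "\<lambda>x. norm (z x) * B"])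
      have zm: "z \<in> borel_measurable lebesgue" using z by auto
      show "(\<lambda>x. z x * partial_deriv k v x) \<in> borel_measurable lebesgue"
        by (intro borel_measurable_times zm test_functions_borel[OF test_functions_partial_deriv[OF v]])
      show "(\<lambda>x. z x * ((v (x + X i *\<^sub>R axis k 1) - v x) / complex_of_real (X i))) \<in> borel_measurable lebesgue" for i
        by (intro borel_measurable_times borel_measurable_divide borel_measurable_diff zm
            measurable_compose[OF lebesgue_measurable_translate test_functions_borel[OF v]]
            test_functions_borel[OF v]) simp
      show "integrable lebesgue (\<lambda>x. norm (z x) * B)" using z by simp
      show "AE x in lebesgue. (\<lambda>i. z x * ((v (x + X i *\<^sub>R axis k 1) - v x) / complex_of_real (X i)))
          \<longlonglongrightarrow> z x * partial_deriv k v x"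
        using lim X unfolding tendsto_at_iff_sequentially comp_def
        by (intro AE_I2 tendsto_mult tendsto_const) blast
      show "AE x in lebesgue. norm (z x * ((v (x + X i *\<^sub>R axis k 1) - v x) / complex_of_real (X i)))
          \<le> norm (z x) * B" for i
        unfolding norm_mult[of "z _"] using X(1) by (intro AE_I2 mult_left_mono quot) auto
    qed
  qed
qed

section \<open>Density of test functions, duality and difference quotients\<close>

context bounded_open
begin

text \<open>Instead of mollifying, \<open>f\<close> is projected onto the closure of the test
  functions by near-minimisers of the distance; the error \<open>w\<close> is orthogonal to all real
  test functions, hence 0 by the fundamental lemma.\<close>

lemma test_functions_dense_L2:
  assumes f: "f \<in> L2 M"
  obtains v where "\<And>n. v n \<in> test_functions \<Omega>" "(\<lambda>n. L2_norm M (\<lambda>x. v n x - f x)) \<longlonglongrightarrow> 0"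
proof -
  have TL: "v \<in> L2 M" if "v \<in> test_functions \<Omega>" for v using that by (rule test_functions_L2)
  obtain v where v: "\<And>n. v n \<in> test_functions \<Omega>"
    and min: "\<And>n y. y \<in> test_functions \<Omega> \<Longrightarrow>
      (L2_norm M (\<lambda>x. v n x - f x))\<^sup>2 \<le> (L2_norm M (\<lambda>x. y x - f x))\<^sup>2 + 1 / (real n + 1)"
    and C: "\<And>e. e > 0 \<Longrightarrow> \<exists>N. \<forall>m\<ge>N. \<forall>n\<ge>N. (L2_norm M (\<lambda>x. v m x - v n x))\<^sup>2 < e"
  proof (rule near_minimisers_Cauchy[of "\<lambda>_. test_functions \<Omega>" "\<lambda>u v x. (1/2) * (u x + v x)"
      "\<lambda>u v. (L2_norm M (\<lambda>x. u x - v x))\<^sup>2" "\<lambda>u. (L2_norm M (\<lambda>x. u x - f x))\<^sup>2" "(L2_norm M f)\<^sup>2"])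
    show "(\<lambda>x. (1/2) * (u x + v x)) \<in> test_functions \<Omega>"
      if "u \<in> test_functions \<Omega>" "v \<in> test_functions \<Omega>" for u v
      by (rule test_functions_cmult[OF test_functions_add[OF that]])
    show "(L2_norm M (\<lambda>x. u x - v x))\<^sup>2 \<le> 2 * (L2_norm M (\<lambda>x. u x - f x))\<^sup>2 +
        2 * (L2_norm M (\<lambda>x. v x - f x))\<^sup>2 - 4 * (L2_norm M (\<lambda>x. (1/2) * (u x + v x) - f x))\<^sup>2"
      if "u \<in> test_functions \<Omega>" "v \<in> test_functions \<Omega>" for u v
    proof -
      have "(\<lambda>x. (1/2) * (u x + v x) - f x) = (\<lambda>x. ((u x - f x) + (v x - f x)) / 2)"
        by (auto simp: field_simps)
      then show ?thesis
        using L2_norm_parallelogram[OF L2_diff[OF TL[OF that(1)] f] L2_diff[OF TL[OF that(2)] f]]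
        by simp
    qed
    show "\<exists>u\<in>test_functions \<Omega>. (L2_norm M (\<lambda>x. u x - f x))\<^sup>2 \<le> (L2_norm M f)\<^sup>2"
      by (rule bexI[of _ "\<lambda>x. 0"]) auto
  qed auto
  have "\<exists>N. \<forall>m\<ge>N. \<forall>n\<ge>N. L2_norm M (\<lambda>x. v m x - v n x) < e" if "e > 0" for e
    using C[of "e\<^sup>2"] that power_less_imp_less_base[of _ 2 e] by (simp add: less_imp_le) blast
  then obtain g where g: "g \<in> L2 M" "(\<lambda>n. L2_norm M (\<lambda>x. v n x - g x)) \<longlonglongrightarrow> 0"
    using L2_complete[of v M, OF TL[OF v]] by blast
  define w where "w x = g x - f x" for x
  have w: "w \<in> L2 M" unfolding w_def by (rule L2_diff[OF g(1) f])
  have minimal: "(L2_norm M w)\<^sup>2 \<le> (L2_norm M (\<lambda>x. w x + c * u x))\<^sup>2" if u: "u \<in> test_functions \<Omega>" for u c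
  proof (rule LIMSEQ_le)
    have cu: "(\<lambda>x. c * u x) \<in> L2 M" by (rule L2_cmult[OF TL[OF u]])
    show "(\<lambda>n. (L2_norm M (\<lambda>x. v n x - f x))\<^sup>2) \<longlonglongrightarrow> (L2_norm M w)\<^sup>2"
      unfolding w_def
      by (intro tendsto_power L2_norm_tendsto) (use g TL[OF v] f in \<open>auto intro: L2_diff\<close>)
    have "(\<lambda>n. (L2_norm M (\<lambda>x. v n x + c * u x - f x))\<^sup>2 + inverse (real (Suc n)))
        \<longlonglongrightarrow> (L2_norm M (\<lambda>x. w x + c * u x))\<^sup>2 + 0"
    proof (intro tendsto_add tendsto_power LIMSEQ_inverse_real_of_nat L2_norm_tendsto)
      show "(\<lambda>x. v n x + c * u x - f x) \<in> L2 M" for n by (intro L2_diff[OF L2_add] TL v cu f)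
      show "(\<lambda>x. w x + c * u x) \<in> L2 M" by (rule L2_add[OF w cu])
      have "(\<lambda>x. v n x + c * u x - f x - (w x + c * u x)) = (\<lambda>x. v n x - g x)" for n
        by (auto simp: w_def)
      then show "(\<lambda>n. L2_norm M (\<lambda>x. v n x + c * u x - f x - (w x + c * u x))) \<longlonglongrightarrow> 0"
        using g(2) by simp
    qed
    then show "(\<lambda>n. (L2_norm M (\<lambda>x. v n x + c * u x - f x))\<^sup>2 + inverse (real (Suc n)))
        \<longlonglongrightarrow> (L2_norm M (\<lambda>x. w x + c * u x))\<^sup>2" by simp
    show "\<exists>N. \<forall>n\<ge>N. (L2_norm M (\<lambda>x. v n x - f x))\<^sup>2
        \<le> (L2_norm M (\<lambda>x. v n x + c * u x - f x))\<^sup>2 + inverse (real (Suc n))"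
    proof (intro exI allI impI)
      fix n
      show "(L2_norm M (\<lambda>x. v n x - f x))\<^sup>2
        \<le> (L2_norm M (\<lambda>x. v n x + c * u x - f x))\<^sup>2 + inverse (real (Suc n))"
        using min[OF test_functions_add[OF v[of n] test_functions_cmult[OF u, of c]], of n]
        by (simp add: inverse_eq_divide add.commute)
    qed
  qed
  have "AE x in M. w x = 0"
  proof (rule fundamental_lemma_calculus_of_variations[OF open_Omega L2_imp_L1_loc[OF w]])
    fix u assume u: "u \<in> test_functions \<Omega>" and real: "\<And>x. cnj (u x) = u x"
    \<comment> \<open>With \<open>c = - r * J\<close> the squared distance drops by at least
      \<open>r\<close> times the square of \<open>norm J\<close>: the linear term gains twice this
      amount, and the quadratic term costs at most once, as \<open>r\<close> times the squared norm
      of \<open>u\<close> is at most 1. The summand 1 in the denominator covers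
      \<open>u = 0\<close>.\<close>
    define J where "J = (\<integral>x. w x * u x \<partial>M)"
    define r where "r = 1 / ((L2_norm M u)\<^sup>2 + 1)"
    define c where "c = - complex_of_real r * J"
    have rpos: "r > 0" "r * (L2_norm M u)\<^sup>2 \<le> 1"
      using add_nonneg_pos[OF zero_le_power2[of "L2_norm M u"] zero_less_one]
      by (auto simp: r_def divide_le_eq)
    have wu: "integrable M (\<lambda>x. w x * u x)" by (rule L2_mult_integrable[OF w TL[OF u]])
    define R where "R x = Re (cnj c * (w x * u x))" for x
    have pt: "(norm (w x + c * u x))\<^sup>2 = (norm (w x))\<^sup>2 + 2 * R x + (norm (c * u x))\<^sup>2" for x
    proof -
      have "Im (u x) = 0" using real[of x] by (simp add: complex_eq_iff)
      then show ?thesis unfolding cmod_power2 R_def by (simp add: power2_eq_square algebra_simps)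
    qed
    have "(L2_norm M (\<lambda>x. w x + c * u x))\<^sup>2
        = (L2_norm M w)\<^sup>2 + 2 * Re (cnj c * J) + (L2_norm M (\<lambda>x. c * u x))\<^sup>2"
    proof -
      have "integrable M R" unfolding R_def using wu by (intro integrable_Re) simp
      moreover have "(\<integral>x. R x \<partial>M) = Re (cnj c * J)"
        unfolding R_def using wu by (subst integral_Re) (simp_all add: J_def)
      ultimately show ?thesis
        unfolding L2_norm_squared pt
        using L2_integrable[OF w] L2_integrable[OF L2_cmult[OF TL[OF u], of c]] by simp
    qed
    also have "Re (cnj c * J) = - r * (norm J)\<^sup>2"
      unfolding c_def cmod_power2 by (simp add: power2_eq_square algebra_simps)
    also have "(L2_norm M (\<lambda>x. c * u x))\<^sup>2 = r * (norm J)\<^sup>2 * (r * (L2_norm M u)\<^sup>2)"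
      unfolding L2_norm_cmult c_def norm_mult using rpos by (simp add: power2_eq_square)
    also have "\<dots> \<le> r * (norm J)\<^sup>2 * 1" using rpos by (intro mult_left_mono) auto
    finally have "(L2_norm M (\<lambda>x. w x + c * u x))\<^sup>2 \<le> (L2_norm M w)\<^sup>2 - r * (norm J)\<^sup>2" by simp
    with minimal[OF u, of c] have "r * (norm J)\<^sup>2 \<le> 0" by linarith
    then have "J = 0" using rpos by (simp add: mult_le_0_iff)
    then show "(\<integral>x. w x * u x \<partial>M) = 0" by (simp add: J_def)
  qed
  then have "L2_norm M (\<lambda>x. v n x - f x) = L2_norm M (\<lambda>x. v n x - g x)" for n
    by (intro L2_norm_cong_AE L2_measurable L2_diff TL v f g)
       (auto simp: w_def elim!: eventually_mono)
  then have "(\<lambda>n. L2_norm M (\<lambda>x. v n x - f x)) \<longlonglongrightarrow> 0" using g(2) by simp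
  with v show thesis by (rule that)
qed

text \<open>Conjugates of test functions approximating \<open>f\<close> are inserted; the pairings
  then tend to the squared norm of \<open>f\<close>.\<close>

lemma L2_norm_le_by_duality:
  assumes f: "f \<in> L2 M" and "B \<ge> 0"
    and B: "\<And>v. v \<in> test_functions \<Omega> \<Longrightarrow> norm (\<integral>x. f x * v x \<partial>M) \<le> B * L2_norm M v"
  shows "L2_norm M f \<le> B"
proof -
  obtain v where v: "\<And>n. v n \<in> test_functions \<Omega>" "(\<lambda>n. L2_norm M (\<lambda>x. v n x - f x)) \<longlonglongrightarrow> 0"
    using test_functions_dense_L2[OF f] by blast
  have cnj: "L2_norm M (\<lambda>x. cnj (g x)) = L2_norm M g" for g by (simp add: L2_norm_def)
  have "(\<lambda>n. L2_norm M (\<lambda>x. cnj (v n x) - cnj (f x))) \<longlonglongrightarrow> 0"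
    using v(2) unfolding complex_cnj_diff[symmetric] cnj .
  then have "(\<lambda>n. \<integral>x. cnj (v n x) * f x \<partial>M) \<longlonglongrightarrow> (\<integral>x. cnj (f x) * f x \<partial>M)"
    by (intro L2_integral_tendsto L2_cnj f test_functions_L2[of _ \<Omega>] v)
  also have "(\<integral>x. cnj (f x) * f x \<partial>M) = (\<integral>x. complex_of_real ((norm (f x))\<^sup>2) \<partial>M)"
    by (simp only: complex_norm_square mult.commute)
  also have "\<dots> = complex_of_real ((L2_norm M f)\<^sup>2)"
    unfolding L2_norm_squared by (rule integral_complex_of_real)
  finally have "(\<lambda>n. norm (\<integral>x. cnj (v n x) * f x \<partial>M)) \<longlonglongrightarrow> norm (complex_of_real ((L2_norm M f)\<^sup>2))"
    by (rule tendsto_norm)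
  moreover have "(\<lambda>n. B * L2_norm M (v n)) \<longlonglongrightarrow> B * L2_norm M f"
    by (intro tendsto_mult tendsto_const L2_norm_tendsto f v test_functions_L2[of _ \<Omega>])
  ultimately have "norm (complex_of_real ((L2_norm M f)\<^sup>2)) \<le> B * L2_norm M f"
  proof (rule LIMSEQ_le)
    show "\<exists>N. \<forall>n\<ge>N. norm (\<integral>x. cnj (v n x) * f x \<partial>M) \<le> B * L2_norm M (v n)"
      using B[OF test_functions_cnj[OF v(1)]] by (auto simp: cnj mult.commute)
  qed
  then have "L2_norm M f * L2_norm M f \<le> B * L2_norm M f"
    unfolding norm_of_real by (simp add: power2_eq_square)
  then show ?thesis
    using \<open>B \<ge> 0\<close> L2_norm_nonneg[of M f] by (cases "L2_norm M f = 0") (auto simp: mult_le_cancel_right)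
qed


definition ext :: "(real ^ 'n \<Rightarrow> complex) \<Rightarrow> real ^ 'n \<Rightarrow> complex" where
  "ext z x = (if x \<in> \<Omega> then z x else 0)"

lemma ext_borel: "z \<in> borel_measurable M \<Longrightarrow> ext z \<in> borel_measurable lebesgue"
  unfolding ext_def by (simp add: borel_measurable_if)

lemma ext_integrable: "integrable M z \<Longrightarrow> integrable lebesgue (ext z)"
  unfolding ext_def by (simp add: Lebesgue_Measure.integrable_restrict_UNIV)

lemma integral_ext_mult: "(\<integral>x. ext z x * f x \<partial>lebesgue) = (\<integral>x. z x * f x \<partial>M)"
proof -
  have "(\<integral>x. ext z x * f x \<partial>lebesgue) = (\<integral>x. (if x \<in> \<Omega> then z x * f x else 0) \<partial>lebesgue)"
    by (intro Bochner_Integration.integral_cong) (auto simp: ext_def)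
  then show ?thesis by (simp add: Lebesgue_Measure.integral_restrict_UNIV)
qed

lemma L2_norm_ext:
  "L2_norm lebesgue (ext f) = L2_norm M f"
proof -
  have "(\<integral>x. (norm (ext f x))\<^sup>2 \<partial>lebesgue) = (\<integral>x. (if x \<in> \<Omega> then (norm (f x))\<^sup>2 else 0) \<partial>lebesgue)"
    by (intro Bochner_Integration.integral_cong) (auto simp: ext_def)
  then show ?thesis by (simp add: L2_norm_def Lebesgue_Measure.integral_restrict_UNIV)
qed

lemma L2_ext:
  assumes "f \<in> L2 M"
  shows "ext f \<in> L2 lebesgue"
proof (rule L2_I[OF ext_borel[OF L2_measurable[OF assms]]])
  have "(\<lambda>x. (norm (ext f x))\<^sup>2) = (\<lambda>x. if x \<in> \<Omega> then (norm (f x))\<^sup>2 else 0)"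
    by (auto simp: ext_def)
  then show "integrable lebesgue (\<lambda>x. (norm (ext f x))\<^sup>2)"
    using L2_integrable[OF assms] by (simp add: Lebesgue_Measure.integrable_restrict_UNIV)
qed

lemma ext_test_function: "v \<in> test_functions \<Omega> \<Longrightarrow> ext v = v"
  by (rule ext, erule test_functionsE) (auto simp: ext_def)

text \<open>Distance is measured to the complement rather than to the boundary, so that it vanishes
  off \<open>\<Omega>\<close> and the set lies inside \<open>\<Omega>\<close> for
  \<open>h \<ge> 0\<close>. Translations of length at most \<open>h\<close> do not lead out of
  \<open>\<Omega>\<close> from here.\<close>

definition inner_domain :: "real \<Rightarrow> (real ^ 'n) set" where
  "inner_domain h = {x. h < infdist x (- \<Omega>)}"

lemma complement_nonempty: "- \<Omega> \<noteq> {}"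
proof
  assume "- \<Omega> = {}"
  then have "\<Omega> = UNIV" by auto
  with bounded_Omega show False by (simp add: not_bounded_UNIV)
qed

lemma open_inner_domain: "open (inner_domain h)"
  unfolding inner_domain_def by (intro open_Collect_less continuous_intros)

lemma inner_domain_subset: "h \<ge> 0 \<Longrightarrow> inner_domain h \<subseteq> \<Omega>"
proof
  fix x assume hx: "h \<ge> 0" "x \<in> inner_domain h"
  show "x \<in> \<Omega>"
  proof (rule ccontr)
    assume "x \<notin> \<Omega>"
    then have "infdist x (- \<Omega>) = 0" by (intro infdist_zero) simp
    with hx show False by (simp add: inner_domain_def)
  qed
qed

lemma inner_domain_translate:
  assumes "x \<in> inner_domain h" "\<bar>t\<bar> \<le> h"
  shows "x + t *\<^sub>R axis k 1 \<in> \<Omega>"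
proof (rule ccontr)
  assume "x + t *\<^sub>R axis k 1 \<notin> \<Omega>"
  then have "infdist x (- \<Omega>) \<le> dist x (x + t *\<^sub>R axis k 1)" by (intro infdist_le) simp
  also have "\<dots> \<le> h" using assms(2) by (simp add: dist_norm)
  finally show False using assms(1) by (simp add: inner_domain_def)
qed

lemma compact_subset_inner_domain:
  assumes "compact K" "K \<subseteq> \<Omega>"
  obtains d where "d > 0" "\<And>h. h < d \<Longrightarrow> K \<subseteq> inner_domain h"
proof -
  obtain d where d: "d > 0" "\<And>x y. x \<in> K \<Longrightarrow> y \<in> - \<Omega> \<Longrightarrow> d \<le> dist x y"
  proof -
    have "closed (- \<Omega>)" "K \<inter> - \<Omega> = {}" using open_Omega assms(2) by auto
    from separate_compact_closed[OF assms(1) this] show thesis using that by blast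
  qed
  have "d \<le> infdist x (- \<Omega>)" if "x \<in> K" for x
    unfolding infdist_notempty[OF complement_nonempty]
    using d(2)[OF that] complement_nonempty by (intro cINF_greatest) auto
  then have "K \<subseteq> inner_domain h" if "h < d" for h
    using that by (force simp: inner_domain_def)
  with d(1) show thesis by (rule that)
qed

lemma bounded_open_inner_domain: "h \<ge> 0 \<Longrightarrow> bounded_open (inner_domain h)"
  by (intro bounded_open.intro open_inner_domain bounded_subset[OF bounded_Omega inner_domain_subset])

lemma ext_mult_translate_integrable:
  assumes z: "z \<in> L2 M" and v: "v \<in> test_functions S"
  shows "integrable lebesgue (\<lambda>x. ext z x * v (x + b))"
proof -
  obtain B where B: "B > 0" "\<And>x. norm (v x) \<le> B" using test_functions_bounded[OF v] by blast
  have zi: "integrable lebesgue (ext z)" by (intro ext_integrable L2_integrable_self z)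
  have vm: "(\<lambda>x. v (x + b)) \<in> borel_measurable lebesgue"
    by (rule measurable_compose[OF lebesgue_measurable_translate test_functions_borel[OF v]])
  show ?thesis
  proof (rule Bochner_Integration.integrable_bound[of _ "\<lambda>x. complex_of_real B * ext z x"])
    show "(\<lambda>x. ext z x * v (x + b)) \<in> borel_measurable lebesgue"
      using zi vm by (intro borel_measurable_times) auto
    show "AE x in lebesgue. norm (ext z x * v (x + b)) \<le> norm (complex_of_real B * ext z x)"
      using B by (intro AE_I2) (auto simp: norm_mult mult.commute[of B] intro!: mult_left_mono)
  qed (use zi in simp)
qed

lemma integral_translate_adjoint:
  assumes z: "z \<in> L2 M" and v: "v \<in> test_functions S"
  shows "(\<integral>x. (ext z (x + a) - ext z x) * v x \<partial>lebesgue) = (\<integral>x. ext z x * (v (x - a) - v x) \<partial>lebesgue)"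
proof -
  have int: "integrable lebesgue (\<lambda>x. ext z x * v (x - b))" for b
    using ext_mult_translate_integrable[OF z v, of "- b"] by simp
  have "(\<integral>x. ext z (x + a) * v x \<partial>lebesgue) = (\<integral>x. ext z x * v (x - a) \<partial>lebesgue)"
    using integral_lebesgue_translate[of "\<lambda>x. ext z x * v (x - a)" a] int[of a] by auto
  moreover have "integrable lebesgue (\<lambda>x. ext z (x + a) * v x)"
    using integrable_lebesgue_translate[OF int[of a], of a] by simp
  ultimately show ?thesis
    using int[of 0] int[of a] by (simp add: left_diff_distrib right_diff_distrib)
qed

text \<open>Mean value inequality for \<open>G\<close> as a function of the translation length: its
  derivative pairs \<open>z\<close> with a partial derivative of a translated test function, so the
  weak derivative takes over and Cauchy-Schwarz applies. All differentiation falls on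
  \<open>v\<close>, none on \<open>z\<close>.\<close>

lemma difference_quotient_pairing_bound:
  assumes z: "z \<in> H1 \<Omega>" and h: "h > 0" and v: "v \<in> test_functions (inner_domain h)"
  shows "norm (\<integral>x. ext z x * (v (x - h *\<^sub>R axis k 1) - v x) \<partial>lebesgue) \<le> h * (L2_norm M (wd k z) * L2_norm M v)"
proof -
  let ?e = "axis k (1::real)"
  define G where "G t = (\<integral>x. ext z x * v (x + t *\<^sub>R ?e) \<partial>lebesgue)" for t
  define G' where "G' t = (\<integral>x. ext z x * partial_deriv k (\<lambda>x. v (x + t *\<^sub>R ?e)) x \<partial>lebesgue)" for t
  have v\<Omega>: "v \<in> test_functions \<Omega>"
    using test_functions_mono[OF inner_domain_subset v] h by simp
  have zi: "integrable lebesgue (ext z)" by (intro ext_integrable L2_integrable_self H1_L2 z)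
  have int: "integrable lebesgue (\<lambda>x. ext z x * v (x + b))" for b
    by (rule ext_mult_translate_integrable[OF H1_L2[OF z] v])
  \<comment> \<open>The support in \<open>inner_domain h\<close> is what keeps all these translates
    test functions of \<open>\<Omega>\<close>.\<close>
  have vt: "(\<lambda>x. v (x + t *\<^sub>R ?e)) \<in> test_functions \<Omega>" if "\<bar>t\<bar> \<le> h" for t
    using inner_domain_translate[of _ h "- t" k] that by (intro test_functions_translate[OF v]) simp
  have der: "(G has_vector_derivative G' t) (at t)" if "\<bar>t\<bar> \<le> h" for t
  proof -
    have l: "((\<lambda>s. \<integral>x. ext z x * ((v (x + s *\<^sub>R ?e + t *\<^sub>R ?e) - v (x + t *\<^sub>R ?e)) / complex_of_real s) \<partial>lebesgue)
        \<longlongrightarrow> G' t) (at 0)"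
      unfolding G'_def by (rule difference_quotient_integral_tendsto[OF zi vt[OF that]])
    have e: "(\<integral>x. ext z x * ((v (x + s *\<^sub>R ?e + t *\<^sub>R ?e) - v (x + t *\<^sub>R ?e)) / complex_of_real s) \<partial>lebesgue)
        = (G (t + s) - G t) / complex_of_real s" for s
    proof -
      have "(\<integral>x. ext z x * ((v (x + s *\<^sub>R ?e + t *\<^sub>R ?e) - v (x + t *\<^sub>R ?e)) / complex_of_real s) \<partial>lebesgue)
        = (\<integral>x. (ext z x * v (x + (t + s) *\<^sub>R ?e) - ext z x * v (x + t *\<^sub>R ?e)) / complex_of_real s \<partial>lebesgue)"
        by (intro Bochner_Integration.integral_cong refl)
           (simp add: right_diff_distrib scaleR_add_left add_ac)
      also have "\<dots> = (G (t + s) - G t) / complex_of_real s"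
        unfolding G_def integral_divide_zero
        by (subst Bochner_Integration.integral_diff[OF int int]) simp
      finally show ?thesis .
    qed
    show ?thesis unfolding has_vector_derivative_iff_quotient using l unfolding e .
  qed
  have bound: "norm (G' t) \<le> L2_norm M (wd k z) * L2_norm M v" if "\<bar>t\<bar> \<le> h" for t
  proof -
    let ?v = "\<lambda>x. v (x + t *\<^sub>R ?e)"
    have "G' t = - (\<integral>x. wd k z x * ?v x \<partial>M)"
      unfolding G'_def integral_ext_mult by (rule is_weak_derivD[OF H1_weak_deriv[OF z] vt[OF that]])
    then have "norm (G' t) \<le> L2_norm M (wd k z) * L2_norm M ?v"
      using L2_Cauchy_Schwarz[OF H1_wd_L2[OF z] test_functions_L2[OF vt[OF that]]] by simp
    also have "L2_norm M ?v = L2_norm lebesgue ?v"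
      using L2_norm_ext[of ?v] ext_test_function[OF vt[OF that]] by simp
    also have "\<dots> = L2_norm lebesgue v"
    proof -
      have "(\<lambda>x. (norm (v x))\<^sup>2) \<in> borel_measurable lebesgue"
        using test_functions_borel[OF v] by measurable
      from integral_lebesgue_translate[OF this] show ?thesis by (simp add: L2_norm_def)
    qed
    also have "\<dots> = L2_norm M v" using L2_norm_ext[of v] ext_test_function[OF v\<Omega>] by simp
    finally show ?thesis .
  qed
  have seg: "\<bar>t\<bar> \<le> h" if "t \<in> closed_segment 0 (- h)" for t
    using that h by (auto simp: closed_segment_eq_real_ivl split: if_splits)
  have "(\<integral>x. ext z x * (v (x - h *\<^sub>R ?e) - v x) \<partial>lebesgue) = G (- h) - G 0"
    using int[of "- (h *\<^sub>R ?e)"] int[of 0] by (simp add: G_def right_diff_distrib)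
  then show ?thesis
    using norm_vector_derivative_bound[of 0 "- h" G G', OF der[OF seg] bound[OF seg]] h
    by (simp add: mult.commute)
qed

text \<open>By duality: the shift is moved onto the test function, whose pairing with
  \<open>z\<close> is already estimated.\<close>

lemma difference_quotient_L2_bound:
  fixes k :: 'n
  assumes z: "z \<in> H1 \<Omega>" and h: "h > 0"
  defines "Q \<equiv> \<lambda>x. (ext z (x + h *\<^sub>R axis k 1) - ext z x) / complex_of_real h"
  shows "Q \<in> L2 (lebesgue_on (inner_domain h))"
    and "L2_norm (lebesgue_on (inner_domain h)) Q \<le> L2_norm M (wd k z)"
proof -
  interpret I: bounded_open "inner_domain h" using h by (intro bounded_open_inner_domain) simp
  have ez: "ext z \<in> L2 lebesgue" by (rule L2_ext[OF H1_L2[OF z]])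
  have ezt: "(\<lambda>x. ext z (x + h *\<^sub>R axis k 1)) \<in> L2 lebesgue"
    by (rule L2_I[OF measurable_compose[OF lebesgue_measurable_translate L2_measurable[OF ez]]
          integrable_lebesgue_translate[OF L2_integrable[OF ez]]])
  have QL: "Q \<in> L2 lebesgue"
    using L2_cmult[OF L2_diff[OF ezt ez], of "1 / complex_of_real h"] by (simp add: Q_def)
  show Q: "Q \<in> L2 I.M"
  proof (rule L2_I)
    show "Q \<in> borel_measurable I.M" using L2_measurable[OF QL] by (rule measurable_restrict_space1)
    show "integrable I.M (\<lambda>x. (norm (Q x))\<^sup>2)"
      using integrable_mult_indicator[OF I.Omega_sets L2_integrable[OF QL]]
      by (simp add: integrable_restrict_space)
  qed
  show "L2_norm I.M Q \<le> L2_norm M (wd k z)"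
  proof (rule I.L2_norm_le_by_duality[OF Q L2_norm_nonneg])
    fix v assume v: "v \<in> test_functions (inner_domain h)"
    have v\<Omega>: "v \<in> test_functions \<Omega>"
      using test_functions_mono[OF inner_domain_subset v] h by simp
    have "(\<integral>x. Q x * v x \<partial>I.M) = (\<integral>x. v x * Q x \<partial>I.M)" by (simp add: mult.commute)
    also have "\<dots> = (\<integral>x. v x * Q x \<partial>lebesgue)"
      using I.integral_ext_mult[of v Q] I.ext_test_function[OF v] by simp
    also have "\<dots> = (\<integral>x. (ext z (x + h *\<^sub>R axis k 1) - ext z x) * v x / complex_of_real h \<partial>lebesgue)"
      by (intro Bochner_Integration.integral_cong) (auto simp: Q_def mult.commute)
    also have "\<dots> = (\<integral>x. ext z x * (v (x - h *\<^sub>R axis k 1) - v x) \<partial>lebesgue) / complex_of_real h"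
      unfolding integral_divide_zero integral_translate_adjoint[OF H1_L2[OF z] v] ..
    finally have "norm (\<integral>x. Q x * v x \<partial>I.M) \<le> L2_norm M (wd k z) * L2_norm M v"
      using difference_quotient_pairing_bound[OF z h v, of k] h by (simp add: norm_divide divide_le_eq mult.commute)
    also have "L2_norm M v = L2_norm I.M v"
      using L2_norm_ext[of v] ext_test_function[OF v\<Omega>] I.L2_norm_ext[of v] I.ext_test_function[OF v] by simp
    finally show "norm (\<integral>x. Q x * v x \<partial>I.M) \<le> L2_norm M (wd k z) * L2_norm I.M v" .
  qed
qed

text \<open>Difference quotients of the composition are dominated pointwise by those of
  \<open>z\<close>, hence bounded in \<open>L2\<close>, and a weak limit of them is a weak
  derivative. In place of a chain rule this gives only a norm inequality, which is all that
  truncation asks for.\<close>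

lemma Lipschitz_weak_deriv:
  assumes z: "z \<in> H1 \<Omega>" and P: "\<And>s t. norm (P s - P t) \<le> norm (s - t)" "P 0 = 0"
  obtains G where "G \<in> L2 M" "L2_norm M G \<le> L2_norm M (wd k z)" "is_weak_deriv \<Omega> k (\<lambda>x. P (z x)) G"
proof -
  define w where "w x = P (z x)" for x
  define h where "h n = inverse (real (Suc n))" for n
  have hpos: "h n > 0" for n by (simp add: h_def)
  \<comment> \<open>The cut to \<open>inner_domain (h n)\<close> avoids the jump of the zero
    extension at the boundary; a compact subset of \<open>\<Omega>\<close> is eventually untouched
    by it.\<close>
  define F where "F n x = (if x \<in> inner_domain (h n)
    then (ext w (x + h n *\<^sub>R axis k 1) - ext w x) / complex_of_real (h n) else 0)" for n x
  have Pcont: "continuous_on UNIV P"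
    using P(1) by (intro lipschitz_on_continuous_on[of 1]) (auto simp: lipschitz_on_def dist_norm)
  have wm: "w \<in> borel_measurable M"
    unfolding w_def by (rule borel_measurable_continuous_on[OF Pcont L2_measurable[OF H1_L2[OF z]]])
  have w: "w \<in> L2 M"
    by (rule L2_dominated[OF H1_L2[OF z] wm]) (use P(1)[of _ 0] P(2) in \<open>simp add: w_def\<close>)
  have ext_w: "ext w x = P (ext z x)" for x by (simp add: ext_def w_def P(2))
  define q where "q n x = (if x \<in> inner_domain (h n)
    then (ext z (x + h n *\<^sub>R axis k 1) - ext z x) / complex_of_real (h n) else 0)" for n x
  have sub: "inner_domain (h n) \<subseteq> \<Omega>" for n using inner_domain_subset hpos less_imp_le by blast
  have si: "inner_domain (h n) \<in> sets lebesgue" for n using open_inner_domain by simp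
  have q: "q n \<in> L2 M" "L2_norm M (q n) \<le> L2_norm M (wd k z)" for n
  proof -
    note Q = difference_quotient_L2_bound[OF z hpos[of n], of k]
    show "q n \<in> L2 M"
    proof (rule L2_I)
      show "q n \<in> borel_measurable M"
        unfolding q_def using L2_measurable[OF Q(1)] sub
        by (subst borel_measurable_if_lebesgue_on) (auto simp: si)
      have "(\<lambda>x. (norm (q n x))\<^sup>2) = (\<lambda>x. if x \<in> inner_domain (h n)
          then (norm ((ext z (x + h n *\<^sub>R axis k 1) - ext z x) / complex_of_real (h n)))\<^sup>2 else 0)"
        by (auto simp: q_def)
      then have "integrable lebesgue (\<lambda>x. (norm (q n x))\<^sup>2)"
        using L2_integrable[OF Q(1)] by (simp only: Lebesgue_Measure.integrable_restrict_UNIV[OF si])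
      then show "integrable M (\<lambda>x. (norm (q n x))\<^sup>2)"
        using integrable_mult_indicator[OF Omega_sets, of "\<lambda>x. (norm (q n x))\<^sup>2"]
        by (simp add: integrable_restrict_space)
    qed
    have "(\<integral>x. (norm (q n x))\<^sup>2 \<partial>M) = (\<integral>x. (if x \<in> inner_domain (h n)
          then (norm ((ext z (x + h n *\<^sub>R axis k 1) - ext z x) / complex_of_real (h n)))\<^sup>2 else 0) \<partial>M)"
      by (intro Bochner_Integration.integral_cong) (auto simp: q_def)
    also have "\<dots> = (\<integral>x. (norm ((ext z (x + h n *\<^sub>R axis k 1) - ext z x) / complex_of_real (h n)))\<^sup>2
        \<partial>lebesgue_on (inner_domain (h n)))"
      by (rule Lebesgue_Measure.integral_restrict[OF sub si Omega_sets])
    finally show "L2_norm M (q n) \<le> L2_norm M (wd k z)" using Q(2) by (simp add: L2_norm_def)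
  qed
  have Fq: "norm (F n x) \<le> norm (q n x)" for n x
    using P(1) hpos[of n] by (auto simp: F_def q_def ext_w norm_divide intro!: divide_right_mono)
  have Fm: "F n \<in> borel_measurable M" for n
  proof -
    have e: "ext w \<in> borel_measurable lebesgue" by (rule ext_borel[OF wm])
    have "(\<lambda>x. (ext w (x + h n *\<^sub>R axis k 1) - ext w x) / complex_of_real (h n)) \<in> borel_measurable lebesgue"
      by (intro borel_measurable_divide borel_measurable_diff e
          measurable_compose[OF lebesgue_measurable_translate e]) simp
    then have "(\<lambda>x. (ext w (x + h n *\<^sub>R axis k 1) - ext w x) / complex_of_real (h n))
        \<in> borel_measurable (lebesgue_on (inner_domain (h n)))"
      by (rule measurable_restrict_space1)
    then show ?thesis
      unfolding F_def using sub by (subst borel_measurable_if_lebesgue_on) (auto simp: si)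
  qed
  have F: "F n \<in> L2 M" "L2_norm M (F n) \<le> L2_norm M (wd k z)" for n
  proof -
    have AE: "AE x in M. norm (F n x) \<le> norm (q n x)" using Fq by simp
    show "F n \<in> L2 M" by (rule L2_dominated[OF q(1) Fm AE])
    show "L2_norm M (F n) \<le> L2_norm M (wd k z)"
      using L2_norm_mono[OF q(1) Fm AE] q(2) by (rule order_trans)
  qed
  have lim: "(\<lambda>n. \<integral>x. F n x * v x \<partial>M) \<longlonglongrightarrow> - (\<integral>x. w x * partial_deriv k v x \<partial>M)"
    if v: "v \<in> test_functions \<Omega>" for v
  proof -
    obtain K where K: "compact K" "K \<subseteq> \<Omega>" "\<And>x. x \<notin> K \<Longrightarrow> v x = 0"
      using v by (auto elim: test_functionsE)
    obtain d where d: "d > 0" "\<And>h. h < d \<Longrightarrow> K \<subseteq> inner_domain h"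
      using compact_subset_inner_domain[OF K(1,2)] by blast
    have l0: "((\<lambda>s. \<integral>x. ext w x * ((v (x + s *\<^sub>R axis k 1) - v x) / complex_of_real s) \<partial>lebesgue)
        \<longlongrightarrow> (\<integral>x. ext w x * partial_deriv k v x \<partial>lebesgue)) (at 0)"
      by (rule difference_quotient_integral_tendsto[OF ext_integrable[OF L2_integrable_self[OF w]] v])
    \<comment> \<open>Moving a shift by \<open>h n\<close> onto the test function turns it into a
      shift by \<open>- h n\<close>, so the limit is taken along negative steps.\<close>
    moreover have "(\<lambda>n. - h n) \<longlonglongrightarrow> 0"
      using tendsto_minus[OF LIMSEQ_inverse_real_of_nat] by (simp add: h_def)
    moreover have "- h n \<in> UNIV - {0}" for n using hpos[of n] by simp
    ultimately have l: "(\<lambda>n. \<integral>x. ext w x * ((v (x + (- h n) *\<^sub>R axis k 1) - v x) / complex_of_real (- h n)) \<partial>lebesgue)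
        \<longlonglongrightarrow> (\<integral>x. ext w x * partial_deriv k v x \<partial>lebesgue)"
      using l0[unfolded tendsto_at_iff_sequentially comp_def, rule_format, of "\<lambda>n. - h n"] by blast
    have eq: "(\<integral>x. F n x * v x \<partial>M)
      = - (\<integral>x. ext w x * ((v (x + (- h n) *\<^sub>R axis k 1) - v x) / complex_of_real (- h n)) \<partial>lebesgue)"
      if "h n < d" for n
    proof -
      have "(\<integral>x. F n x * v x \<partial>M) = (\<integral>x. v x * F n x \<partial>lebesgue)"
        using integral_ext_mult[of v "F n"] ext_test_function[OF v] by (simp add: mult.commute)
      also have "\<dots> = (\<integral>x. (ext w (x + h n *\<^sub>R axis k 1) - ext w x) * v x / complex_of_real (h n) \<partial>lebesgue)"
        using K(3) d(2)[OF that]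
        by (intro Bochner_Integration.integral_cong refl) (auto simp: F_def mult.commute)
      also have "\<dots> = (\<integral>x. ext w x * (v (x - h n *\<^sub>R axis k 1) - v x) \<partial>lebesgue) / complex_of_real (h n)"
        unfolding integral_divide_zero integral_translate_adjoint[OF w v] ..
      also have "\<dots> = - (\<integral>x. ext w x * (v (x + (- h n) *\<^sub>R axis k 1) - v x) / complex_of_real (- h n) \<partial>lebesgue)"
        unfolding integral_divide_zero by simp
      finally show ?thesis by simp
    qed
    have "\<forall>\<^sub>F n in sequentially. h n < d"
      unfolding h_def by (rule order_tendstoD(2)[OF LIMSEQ_inverse_real_of_nat d(1)])
    then have "\<forall>\<^sub>F n in sequentially. - (\<integral>x. ext w x * ((v (x + (- h n) *\<^sub>R axis k 1) - v x) / complex_of_real (- h n)) \<partial>lebesgue)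
        = (\<integral>x. F n x * v x \<partial>M)"
      by eventually_elim (simp only: eq)
    from Lim_transform_eventually[OF tendsto_minus[OF l] this] show ?thesis
      by (simp add: integral_ext_mult)
  qed
  obtain G where G: "G \<in> L2 M" "L2_norm M G \<le> L2_norm M (wd k z)"
    "\<And>v. v \<in> test_functions \<Omega> \<Longrightarrow> (\<integral>x. G x * v x \<partial>M) = - (\<integral>x. w x * partial_deriv k v x \<partial>M)"
    using L2_weak_limit[of F M "L2_norm M (wd k z)" "test_functions \<Omega>"
        "\<lambda>v. - (\<integral>x. w x * partial_deriv k v x \<partial>M)", OF F _ lim] test_functions_L2 by blast
  have "is_weak_deriv \<Omega> k w G" using G(3) by (intro is_weak_derivI[OF w G(1)]) simp
  then have "is_weak_deriv \<Omega> k (\<lambda>x. P (z x)) G" by (simp add: w_def[abs_def])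
  with G(1,2) show thesis by (rule that)
qed

lemma Lipschitz_H1:
  assumes z: "z \<in> H1 \<Omega>" and P: "\<And>s t. norm (P s - P t) \<le> norm (s - t)" "P 0 = 0"
  shows "(\<lambda>x. P (z x)) \<in> H1 \<Omega>" "H1_norm \<Omega> (\<lambda>x. P (z x)) \<le> H1_norm \<Omega> z"
proof -
  have "\<forall>k. \<exists>G. G \<in> L2 M \<and> L2_norm M G \<le> L2_norm M (wd k z) \<and> is_weak_deriv \<Omega> k (\<lambda>x. P (z x)) G"
    using Lipschitz_weak_deriv[of z P, OF z P] by blast
  from choice[OF this] obtain G where G: "\<And>k. G k \<in> L2 M" "\<And>k. L2_norm M (G k) \<le> L2_norm M (wd k z)"
    "\<And>k. is_weak_deriv \<Omega> k (\<lambda>x. P (z x)) (G k)" by blast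
  have Pcont: "continuous_on UNIV P"
    using P(1) by (intro lipschitz_on_continuous_on[of 1]) (auto simp: lipschitz_on_def dist_norm)
  have wm: "(\<lambda>x. P (z x)) \<in> borel_measurable M"
    by (rule borel_measurable_continuous_on[OF Pcont L2_measurable[OF H1_L2[OF z]]])
  have le: "AE x in M. norm (P (z x)) \<le> norm (z x)" using P(1)[of _ 0] P(2) by simp
  have w: "(\<lambda>x. P (z x)) \<in> L2 M" by (rule L2_dominated[OF H1_L2[OF z] wm le])
  show H: "(\<lambda>x. P (z x)) \<in> H1 \<Omega>" by (rule H1_I[OF w G(1) G(3)])
  show "H1_norm \<Omega> (\<lambda>x. P (z x)) \<le> H1_norm \<Omega> z"
  proof (rule H1_norm_mono[OF L2_norm_mono[OF H1_L2[OF z] wm le]])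
    show "L2_norm M (wd k (\<lambda>x. P (z x))) \<le> L2_norm M (wd k z)" for k
      using L2_norm_cong_AE[OF wd_eq_AE[OF G(3)] L2_measurable[OF H1_wd_L2[OF H]] L2_measurable[OF G(1)]]
        G(2)[of k] by simp
  qed
qed

end

section \<open>Smooth functions, H10 and traces\<close>

text \<open>The function vanishes as soon as \<open>norm x\<close> reaches \<open>R - 1\<close>;
  this margin leaves room for translations of length below 1.\<close>

lemma test_functions_ball:
  assumes "v \<in> test_functions S"
  obtains R where "v \<in> test_functions (ball 0 R)" "\<And>x. R \<le> norm x + 1 \<Longrightarrow> v x = 0"
proof -
  obtain K where K: "compact K" "K \<subseteq> S" "\<And>x. x \<notin> K \<Longrightarrow> v x = 0"
    using assms by (auto elim: test_functionsE)
  obtain R where R: "\<And>x. x \<in> K \<Longrightarrow> norm x \<le> R"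
    using compact_imp_bounded[OF K(1)] by (auto simp: bounded_iff)
  have "v \<in> test_functions (ball 0 (R + 2))"
    using K R by (intro test_functionsI[of v K] test_functions_C_k[OF assms]) force+
  moreover have "v x = 0" if "R + 2 \<le> norm x + 1" for x
    using K(3)[of x] R[of x] that by force
  ultimately show thesis by (rule that)
qed

text \<open>By translation invariance the difference quotients of \<open>v\<close> integrate to 0,
  and their limit is the partial derivative. The indicator of a large ball stands in for the
  constant 1, which is not integrable over the whole space.\<close>

lemma integral_partial_deriv_test_function:
  assumes v: "v \<in> test_functions S"
  shows "(\<integral>x. partial_deriv k v x \<partial>lebesgue) = 0"
proof -
  obtain R where vR: "v \<in> test_functions (ball 0 R)" and out: "\<And>x. R \<le> norm x + 1 \<Longrightarrow> v x = 0"
    using test_functions_ball[OF v] by blast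
  interpret B: bounded_open "ball 0 R :: (real ^ 'a) set" by unfold_locales auto
  let ?z = "B.ext (\<lambda>x. 1)"
  define J where "J s = (\<integral>x. ?z x * ((v (x + s *\<^sub>R axis k 1) - v x) / complex_of_real s) \<partial>lebesgue)" for s
  have J0: "J s = 0" if "\<bar>s\<bar> < 1" for s
  proof -
    have zero: "(?z (x + - (s *\<^sub>R axis k 1)) - ?z x) * v x = 0" for x
    proof (cases "R \<le> norm x + 1")
      case False
      then have "norm (x + - (s *\<^sub>R axis k 1)) < R"
        using norm_triangle_ineq4[of x "s *\<^sub>R axis k 1"] that by simp
      with False show ?thesis by (simp add: B.ext_def)
    qed (simp add: out)
    have "(\<integral>x. (?z (x + - (s *\<^sub>R axis k 1)) - ?z x) * v x \<partial>lebesgue) = 0"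
      unfolding zero by simp
    then have "(\<integral>x. ?z x * (v (x + s *\<^sub>R axis k 1) - v x) \<partial>lebesgue) = 0"
      using B.integral_translate_adjoint[OF B.L2_const vR, of 1 "- (s *\<^sub>R axis k 1)"] by simp
    then show ?thesis unfolding J_def times_divide_eq_right integral_divide_zero by simp
  qed
  then have "\<forall>\<^sub>F s in at 0. J s = 0"
    unfolding eventually_at by (intro exI[of _ 1]) (simp add: dist_real_def)
  moreover have "(J \<longlongrightarrow> (\<integral>x. ?z x * partial_deriv k v x \<partial>lebesgue)) (at 0)"
    unfolding J_def by (intro difference_quotient_integral_tendsto[OF _ v] B.ext_integrable) simp
  ultimately have "((\<lambda>s. 0::complex) \<longlongrightarrow> (\<integral>x. ?z x * partial_deriv k v x \<partial>lebesgue)) (at (0::real))"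
    by (rule Lim_transform_eventually[rotated])
  then have "(\<integral>x. ?z x * partial_deriv k v x \<partial>lebesgue) = 0"
    by (simp add: tendsto_const_iff)
  then show ?thesis
    using B.integral_ext_mult[of "\<lambda>x. 1" "partial_deriv k v"]
      B.integral_ext_mult[of "partial_deriv k v" "\<lambda>x. 1"]
      B.ext_test_function[OF test_functions_partial_deriv[OF vR]] by simp
qed

context bounded_open
begin

lemma continuous_L2:
  assumes "continuous_on UNIV f"
  shows "f \<in> L2 M"
proof -
  have "compact (closure \<Omega>)" using bounded_Omega by (simp add: compact_closure)
  then have "bounded (f ` closure \<Omega>)"
    by (intro compact_imp_bounded compact_continuous_image continuous_on_subset[OF assms]) auto
  then obtain B where B: "\<And>x. x \<in> \<Omega> \<Longrightarrow> norm (f x) \<le> B"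
    using closure_subset[of \<Omega>] by (fastforce simp: bounded_iff)
  have "f \<in> borel_measurable M"
    using borel_measurable_continuous_onI[OF assms]
    by (intro measurable_restrict_space1) (auto intro: measurable_completion)
  then show ?thesis by (rule L2_bounded[of _ B]) (use B in auto)
qed

text \<open>Integration by parts: the product \<open>f * v\<close> is again a test function, so its
  partial derivative integrates to 0, and the product rule splits this integral.\<close>

lemma smooth_is_weak_deriv:
  assumes f: "\<And>m. C_k m f"
  shows "is_weak_deriv \<Omega> k f (partial_deriv k f)"
proof (rule is_weak_derivI)
  have pf: "C_k m (partial_deriv k f)" for m using f[of "Suc m"] by simp
  show fL: "f \<in> L2 M" "partial_deriv k f \<in> L2 M"
    using f pf by (auto intro: continuous_L2 C_k_imp_continuous)
  fix v assume v: "v \<in> test_functions \<Omega>"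
  obtain K where K: "compact K" "K \<subseteq> \<Omega>" "\<And>x. x \<notin> K \<Longrightarrow> v x = 0"
    using v by (auto elim: test_functionsE)
  have fv: "(\<lambda>x. f x * v x) \<in> test_functions \<Omega>"
    using K by (intro test_functionsI[of _ K] C_k_mult f test_functions_C_k[OF v]) auto
  have pd: "partial_deriv k (\<lambda>x. f x * v x) x = f x * partial_deriv k v x + partial_deriv k f x * v x" for x
    using f[of "Suc 0"] test_functions_differentiable[OF v] by (intro partial_deriv_mult) auto
  have "0 = (\<integral>x. partial_deriv k (\<lambda>x. f x * v x) x \<partial>M)"
    using integral_partial_deriv_test_function[OF fv, of k]
      integral_ext_mult[of "partial_deriv k (\<lambda>x. f x * v x)" "\<lambda>x. 1"]
      ext_test_function[OF test_functions_partial_deriv[OF fv, of k]] by simp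
  also have "\<dots> = (\<integral>x. f x * partial_deriv k v x \<partial>M) + (\<integral>x. partial_deriv k f x * v x \<partial>M)"
    unfolding pd
    by (intro Bochner_Integration.integral_add L2_mult_integrable fL
        test_functions_L2[OF v] test_functions_L2[OF test_functions_partial_deriv[OF v]])
  finally show "(\<integral>x. f x * partial_deriv k v x \<partial>M) = - (\<integral>x. partial_deriv k f x * v x \<partial>M)"
    by (simp add: eq_neg_iff_add_eq_0)
qed

lemma smooth_H1:
  assumes f: "\<And>m. C_k m f"
  shows "f \<in> H1 \<Omega>"
proof (rule H1_I)
  have "C_k m (partial_deriv k f)" for m k using f[of "Suc m"] by simp
  then show "f \<in> L2 M" "partial_deriv k f \<in> L2 M" for k
    using f[of 0] by (auto intro: continuous_L2 C_k_imp_continuous)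
qed (rule smooth_is_weak_deriv[OF f])

lemma test_functions_H1: "v \<in> test_functions \<Omega> \<Longrightarrow> v \<in> H1 \<Omega>"
  using smooth_H1 test_functions_C_k by blast

lemma wd_test_function: "v \<in> test_functions \<Omega> \<Longrightarrow> AE x in M. wd k v x = partial_deriv k v x"
  using wd_eq_AE[OF smooth_is_weak_deriv] test_functions_C_k by blast

lemma L2_norm_partial_deriv_test:
  assumes v: "v \<in> test_functions \<Omega>"
  shows "L2_norm M (partial_deriv k v) = L2_norm M (wd k v)"
proof (rule L2_norm_cong_AE)
  show "AE x in M. partial_deriv k v x = wd k v x"
    using wd_test_function[OF v, of k] by eventually_elim simp
qed (intro L2_measurable H1_wd_L2 test_functions_H1[OF v]
      test_functions_L2[OF test_functions_partial_deriv[OF v]])+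

section \<open>The space \<open>H1_0\<close>: approximation, linearity, weak closedness\<close>

lemma H1_0_H1: "u \<in> H1_0 \<Omega> \<Longrightarrow> u \<in> H1 \<Omega>"
  by (simp add: H1_0_def)

lemma H1_0_approx:
  assumes "u \<in> H1_0 \<Omega>" "e > 0"
  obtains v where "v \<in> test_functions \<Omega>" "H1_norm \<Omega> (\<lambda>x. v x - u x) < e"
proof -
  obtain v where v: "\<And>n. v n \<in> test_functions \<Omega>" "(\<lambda>n. H1_norm \<Omega> (\<lambda>x. v n x - u x)) \<longlonglongrightarrow> 0"
    using assms(1) by (auto simp: H1_0_def)
  have "\<forall>\<^sub>F n in sequentially. H1_norm \<Omega> (\<lambda>x. v n x - u x) < e"
    by (rule order_tendstoD(2)[OF v(2) assms(2)])
  then obtain n where "H1_norm \<Omega> (\<lambda>x. v n x - u x) < e" by (auto simp: eventually_sequentially)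
  with v(1) show thesis by (rule that)
qed

lemma H1_0I:
  assumes u: "u \<in> H1 \<Omega>"
    and approx: "\<And>e. e > 0 \<Longrightarrow> \<exists>v\<in>test_functions \<Omega>. H1_norm \<Omega> (\<lambda>x. v x - u x) < e"
  shows "u \<in> H1_0 \<Omega>"
proof -
  have "\<forall>n. \<exists>v. v \<in> test_functions \<Omega> \<and> H1_norm \<Omega> (\<lambda>x. v x - u x) < inverse (real (Suc n))"
    using approx by (metis inverse_positive_iff_positive of_nat_0_less_iff zero_less_Suc)
  from choice[OF this] obtain v where v: "\<And>n. v n \<in> test_functions \<Omega>"
    "\<And>n. H1_norm \<Omega> (\<lambda>x. v n x - u x) < inverse (real (Suc n))" by blast
  have "(\<lambda>n. H1_norm \<Omega> (\<lambda>x. v n x - u x)) \<longlonglongrightarrow> 0"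
    by (rule tendsto_sandwich[OF _ _ tendsto_const LIMSEQ_inverse_real_of_nat])
       (use v(2) in \<open>auto intro!: always_eventually less_imp_le simp del: of_nat_Suc\<close>)
  with u v(1) show ?thesis by (auto simp: H1_0_def)
qed

lemma H1_0_closed:
  assumes u: "\<And>n. u n \<in> H1_0 \<Omega>" and w: "w \<in> H1 \<Omega>"
    and lim: "(\<lambda>n. H1_norm \<Omega> (\<lambda>x. u n x - w x)) \<longlonglongrightarrow> 0"
  shows "w \<in> H1_0 \<Omega>"
proof (rule H1_0I[OF w])
  fix e :: real assume "e > 0"
  have "\<forall>\<^sub>F n in sequentially. H1_norm \<Omega> (\<lambda>x. u n x - w x) < e / 2"
    by (rule order_tendstoD(2)[OF lim]) (use \<open>e > 0\<close> in simp)
  then obtain n where n: "H1_norm \<Omega> (\<lambda>x. u n x - w x) < e / 2" by (auto simp: eventually_sequentially)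
  obtain v where v: "v \<in> test_functions \<Omega>" "H1_norm \<Omega> (\<lambda>x. v x - u n x) < e / 2"
    using H1_0_approx[OF u[of n], of "e / 2"] \<open>e > 0\<close> by auto
  have "H1_norm \<Omega> (\<lambda>x. v x - w x) < e"
    using H1_norm_triangle_sub[OF test_functions_H1[OF v(1)] H1_0_H1[OF u[of n]] w] n v(2) by simp
  with v(1) show "\<exists>v\<in>test_functions \<Omega>. H1_norm \<Omega> (\<lambda>x. v x - w x) < e" by blast
qed

lemma H1_0_linear:
  assumes u: "u \<in> H1_0 \<Omega>" and v: "v \<in> H1_0 \<Omega>"
  shows "(\<lambda>x. a * u x + b * v x) \<in> H1_0 \<Omega>"
proof (rule H1_0I)
  note H = H1_0_H1[OF u] H1_0_H1[OF v]
  show "(\<lambda>x. a * u x + b * v x) \<in> H1 \<Omega>" by (rule H1_linear[OF H])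
  fix e :: real assume "e > 0"
  define d where "d = e / (norm a + norm b + 1)"
  have pos: "norm a + norm b + 1 > 0" by (intro add_nonneg_pos add_nonneg_nonneg) auto
  then have d: "d > 0" "d * (norm a + norm b + 1) = e" using \<open>e > 0\<close> by (auto simp: d_def)
  obtain f where f: "f \<in> test_functions \<Omega>" "H1_norm \<Omega> (\<lambda>x. f x - u x) < d"
    using H1_0_approx[OF u d(1)] by blast
  obtain g where g: "g \<in> test_functions \<Omega>" "H1_norm \<Omega> (\<lambda>x. g x - v x) < d"
    using H1_0_approx[OF v d(1)] by blast
  note D = H1_diff[OF test_functions_H1[OF f(1)] H(1)] H1_diff[OF test_functions_H1[OF g(1)] H(2)]
  have D': "(\<lambda>x. a * (f x - u x)) \<in> H1 \<Omega>" "(\<lambda>x. b * (g x - v x)) \<in> H1 \<Omega>"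
    using H1_linear[OF D(1,1), of a 0] H1_linear[OF D(2,2), of b 0] by simp_all
  have "(\<lambda>x. a * f x + b * g x - (a * u x + b * v x)) = (\<lambda>x. a * (f x - u x) + b * (g x - v x))"
    by (auto simp: algebra_simps)
  then have "H1_norm \<Omega> (\<lambda>x. a * f x + b * g x - (a * u x + b * v x))
      \<le> norm a * H1_norm \<Omega> (\<lambda>x. f x - u x) + norm b * H1_norm \<Omega> (\<lambda>x. g x - v x)"
    using H1_norm_triangle[OF D'] by (simp add: H1_norm_cmult[OF D(1)] H1_norm_cmult[OF D(2)])
  also have "\<dots> \<le> norm a * d + norm b * d"
    using f g by (intro add_mono mult_left_mono) auto
  also have "\<dots> < e" using d by (simp add: algebra_simps)
  finally show "\<exists>w\<in>test_functions \<Omega>. H1_norm \<Omega> (\<lambda>x. w x - (a * u x + b * v x)) < e"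
    by (intro bexI[of _ "\<lambda>x. a * f x + b * g x"] test_functions_add test_functions_cmult f g)
qed

lemma H1_0_add: "u \<in> H1_0 \<Omega> \<Longrightarrow> v \<in> H1_0 \<Omega> \<Longrightarrow> (\<lambda>x. u x + v x) \<in> H1_0 \<Omega>"
  and H1_0_midpoint: "u \<in> H1_0 \<Omega> \<Longrightarrow> v \<in> H1_0 \<Omega> \<Longrightarrow> (\<lambda>x. (u x + v x) / 2) \<in> H1_0 \<Omega>"
  using H1_0_linear[of u v 1 1] H1_0_linear[of u v "1/2" "1/2"]
  by (simp_all add: add_divide_distrib)

text \<open>Convergence in \<open>L2\<close> with an \<open>H1\<close> bound is all that truncated
  sequences provide; stability of \<open>H1_0\<close> under midpoints and its closedness in
  \<open>H1\<close> make that sufficient.\<close>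

lemma H1_0_bounded_L2_limit:
  assumes u: "\<And>n. u n \<in> H1_0 \<Omega>" "\<And>n. H1_norm \<Omega> (u n) \<le> B"
    and v: "v \<in> L2 M" "(\<lambda>n. L2_norm M (\<lambda>x. u n x - v x)) \<longlonglongrightarrow> 0"
  shows "v \<in> H1_0 \<Omega>"
proof -
  obtain w where "\<And>n. w n \<in> H1_0 \<Omega>" "v \<in> H1 \<Omega>" "(\<lambda>n. H1_norm \<Omega> (\<lambda>x. w n x - v x)) \<longlonglongrightarrow> 0"
    using H1_bounded_L2_limit[of "H1_0 \<Omega>" u B v, OF _ H1_0_midpoint u v] H1_0_H1 by blast
  then show ?thesis by (rule H1_0_closed)
qed

subsection \<open>The boundary measure\<close>

abbreviation \<sigma> where "\<sigma> \<equiv> boundary_measure \<Omega>"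

text \<open>The construction \<open>measure_of\<close> fixes the sigma-algebra whatever the set
  function is, so additivity of the outer measure does not enter.\<close>

lemma sets_hausdorff_measure: "sets (hausdorff_measure s) = (sets borel :: (real ^ 'n) set set)"
  unfolding hausdorff_measure_def using sets.sigma_sets_eq[of borel] by (simp add: sets_measure_of)

lemma sets_boundary_measure: "sets \<sigma> = sets (restrict_space borel (frontier \<Omega>))"
  unfolding boundary_measure_def by (intro sets_restrict_space_cong sets_hausdorff_measure)

lemma space_boundary_measure: "space \<sigma> = frontier \<Omega>"
  using sets_eq_imp_space_eq[OF sets_boundary_measure] by (simp add: space_restrict_space)

lemma continuous_measurable_boundary:
  "continuous_on (frontier \<Omega>) f \<Longrightarrow> f \<in> borel_measurable \<sigma>"
  using borel_measurable_continuous_on_restrict measurable_cong_sets[OF sets_boundary_measure refl] by blast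

lemma continuous_L2_boundary:
  assumes fin: "emeasure (hausdorff_measure (CARD('n) - 1)) (frontier \<Omega>) < \<infinity>"
    and f: "continuous_on (frontier \<Omega>) f"
  shows "f \<in> L2 \<sigma>"
proof -
  have "emeasure \<sigma> (space \<sigma>) = emeasure (hausdorff_measure (CARD('n) - 1)) (frontier \<Omega>)"
    unfolding space_boundary_measure unfolding boundary_measure_def
  proof (rule emeasure_restrict_space)
    show "frontier \<Omega> \<inter> space (hausdorff_measure (CARD('n) - 1)) \<in> sets (hausdorff_measure (CARD('n) - 1))"
      unfolding sets_hausdorff_measure sets_eq_imp_space_eq[OF sets_hausdorff_measure] by simp
  qed simp
  then interpret finite_measure \<sigma> using fin by (intro finite_measureI) auto
  have "compact (frontier \<Omega>)" using bounded_Omega by (simp add: compact_frontier_bounded)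
  then have "bounded (f ` frontier \<Omega>)" using f by (intro compact_imp_bounded compact_continuous_image)
  then obtain B where B: "\<And>x. x \<in> frontier \<Omega> \<Longrightarrow> norm (f x) \<le> B" by (auto simp: bounded_iff)
  show ?thesis
  proof (rule L2_dominated[OF _ continuous_measurable_boundary[OF f]])
    show "(\<lambda>x. complex_of_real B) \<in> L2 \<sigma>" by (rule L2_I) auto
    show "AE x in \<sigma>. norm (f x) \<le> norm (complex_of_real B)"
      using B by (intro AE_I2) (auto simp: space_boundary_measure intro: order_trans[OF _ abs_ge_self])
  qed
qed

lemma L2_norm_boundary_cong:
  "(\<And>z. z \<in> frontier \<Omega> \<Longrightarrow> f z = g z) \<Longrightarrow> L2_norm \<sigma> f = L2_norm \<sigma> g"
  unfolding L2_norm_def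
  by (intro arg_cong[of _ _ sqrt] Bochner_Integration.integral_cong) (auto simp: space_boundary_measure)

lemma frontier_subset_closure: "frontier \<Omega> \<subseteq> closure \<Omega>"
  by (auto simp: frontier_def)

text \<open>The constant sequence serves as approximation. Together with the assumed identity for
  \<open>H1_0\<close>, this places functions in \<open>H1_0\<close> by their boundary values
  alone.\<close>

lemma is_trace_zeroI:
  assumes "f \<in> H1 \<Omega>" "continuous_on (closure \<Omega>) f" "\<And>z. z \<in> frontier \<Omega> \<Longrightarrow> f z = 0"
    and fin: "emeasure (hausdorff_measure (CARD('n) - 1)) (frontier \<Omega>) < \<infinity>"
  shows "is_trace \<Omega> f (\<lambda>z. 0)"
proof -
  have fL: "f \<in> L2 \<sigma>"
    by (rule continuous_L2_boundary[OF fin continuous_on_subset[OF assms(2) frontier_subset_closure]])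
  have n0: "L2_norm \<sigma> (\<lambda>z. f z - 0) = 0" using L2_norm_boundary_cong[of f "\<lambda>z. 0"] assms(3) by simp
  have h0: "H1_norm \<Omega> (\<lambda>x. f x - f x) = 0" using H1_norm_cmult[OF assms(1), of 0] by simp
  show ?thesis
    unfolding is_trace_def using assms(1,2) fL n0 h0 by (intro conjI exI[of _ "\<lambda>n. f"]) auto
qed

end

subsection \<open>Radial truncation\<close>

text \<open>Radial truncation encoded as the nearest-point map of a disc: the Lipschitz constant 1
  then follows from convexity, without a case distinction.\<close>

definition trunc :: "real \<Rightarrow> complex \<Rightarrow> complex" where
  "trunc e z = closest_point (cball 0 e) z"

lemma trunc_Lipschitz: "e \<ge> 0 \<Longrightarrow> norm (trunc e s - trunc e t) \<le> norm (s - t)"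
  using closest_point_lipschitz[of "cball (0::complex) e" s t] by (simp add: trunc_def dist_norm)

lemma trunc_bound: "e \<ge> 0 \<Longrightarrow> norm (trunc e z) \<le> e"
  using closest_point_in_set[of "cball (0::complex) e" z] by (simp add: trunc_def)

lemma trunc_id: "norm z \<le> e \<Longrightarrow> trunc e z = z"
  unfolding trunc_def by (intro closest_point_self) simp

lemma trunc_0: "e \<ge> 0 \<Longrightarrow> trunc e 0 = 0"
  by (simp add: trunc_id)

lemma continuous_on_trunc:
  assumes "e \<ge> 0" "continuous_on S f"
  shows "continuous_on S (\<lambda>x. trunc e (f x))"
proof -
  have "continuous_on UNIV (trunc e)"
    using trunc_Lipschitz[OF assms(1)]
    by (intro lipschitz_on_continuous_on[of 1]) (auto simp: lipschitz_on_def dist_norm)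
  then show ?thesis using assms(2) by (rule continuous_on_compose2) auto
qed

lemma (in bounded_open) trunc_H1:
  assumes "u \<in> H1 \<Omega>" "e \<ge> 0"
  shows "(\<lambda>x. trunc e (u x)) \<in> H1 \<Omega>" "H1_norm \<Omega> (\<lambda>x. trunc e (u x)) \<le> H1_norm \<Omega> u"
  using Lipschitz_H1[OF assms(1), of "trunc e"] trunc_Lipschitz[OF assms(2)] trunc_0[OF assms(2)] by auto

section \<open>The sesquilinear form\<close>

locale elliptic_operator = bounded_open \<Omega> for \<Omega> :: "(real ^ 'n::finite) set" +
  fixes a :: "'n \<Rightarrow> 'n \<Rightarrow> real ^ 'n \<Rightarrow> real"
    and b :: "'n \<Rightarrow> real ^ 'n \<Rightarrow> complex"
    and c :: "'n \<Rightarrow> real ^ 'n \<Rightarrow> real"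
    and c0 :: "real ^ 'n \<Rightarrow> complex"
    and \<mu> :: real
  assumes a: "\<And>k l. a k l \<in> borel_measurable (lebesgue_on \<Omega>)" "\<And>k l. bounded (a k l ` \<Omega>)"
    and b: "\<And>k. b k \<in> borel_measurable (lebesgue_on \<Omega>)" "\<And>k. bounded (b k ` \<Omega>)"
    and c: "\<And>k. c k \<in> borel_measurable (lebesgue_on \<Omega>)" "\<And>k. bounded (c k ` \<Omega>)"
    and c0: "c0 \<in> borel_measurable (lebesgue_on \<Omega>)" "bounded (c0 ` \<Omega>)"
    and mu: "0 < \<mu>"
    and elliptic: "\<And>x (\<xi> :: complex ^ 'n). x \<in> \<Omega> \<Longrightarrow>
      Re (\<Sum>k\<in>UNIV. \<Sum>l\<in>UNIV. complex_of_real (a k l x) * \<xi> $ k * cnj (\<xi> $ l)) \<ge> \<mu> * (norm \<xi>)\<^sup>2"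
begin

text \<open>A common interface for all four kinds of coefficients; the real ones enter through
  \<open>complex_of_real\<close>.\<close>

definition coefficient :: "real \<Rightarrow> (real ^ 'n \<Rightarrow> complex) \<Rightarrow> bool" where
  "coefficient \<Lambda> m \<longleftrightarrow> m \<in> borel_measurable M \<and> (\<forall>x\<in>\<Omega>. norm (m x) \<le> \<Lambda>)"

abbreviation A where "A u v \<equiv> A_pairing \<Omega> a b c c0 u v"

lemma coefficient_exists:
  assumes "m \<in> borel_measurable M" "bounded (m ` \<Omega>)"
  shows "\<exists>\<Lambda>. coefficient \<Lambda> m"
  using assms by (auto simp: coefficient_def bounded_iff)

lemma coefficients:
  obtains \<Lambda> where "\<Lambda> \<ge> 0" "\<And>k l. coefficient \<Lambda> (\<lambda>x. complex_of_real (a k l x))"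
    "\<And>k. coefficient \<Lambda> (b k)" "\<And>k. coefficient \<Lambda> (\<lambda>x. complex_of_real (c k x))" "coefficient \<Lambda> c0"
proof -
  have "\<forall>k l. \<exists>\<Lambda>. coefficient \<Lambda> (\<lambda>x. complex_of_real (a k l x))"
    using a(1) by (auto intro!: coefficient_exists simp: bounded_iff)
       (use a(2) in \<open>simp add: bounded_iff\<close>)
  then obtain \<Lambda>a where 1: "\<And>k l. coefficient (\<Lambda>a k l) (\<lambda>x. complex_of_real (a k l x))" by metis
  have "\<forall>k. \<exists>\<Lambda>. coefficient \<Lambda> (b k)" using b by (auto intro!: coefficient_exists)
  then obtain \<Lambda>b where 2: "\<And>k. coefficient (\<Lambda>b k) (b k)" by metis
  have "\<forall>k. \<exists>\<Lambda>. coefficient \<Lambda> (\<lambda>x. complex_of_real (c k x))"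
    using c(1) by (auto intro!: coefficient_exists simp: bounded_iff)
       (use c(2) in \<open>simp add: bounded_iff\<close>)
  then obtain \<Lambda>c where 3: "\<And>k. coefficient (\<Lambda>c k) (\<lambda>x. complex_of_real (c k x))" by metis
  obtain \<Lambda>0 where 4: "coefficient \<Lambda>0 c0" using coefficient_exists[OF c0] by blast
  define \<Lambda> where "\<Lambda> = (\<Sum>k\<in>UNIV. \<Sum>l\<in>UNIV. \<bar>\<Lambda>a k l\<bar>) + (\<Sum>k\<in>UNIV. \<bar>\<Lambda>b k\<bar>) + (\<Sum>k\<in>UNIV. \<bar>\<Lambda>c k\<bar>) + \<bar>\<Lambda>0\<bar>"
  have nn: "0 \<le> (\<Sum>k\<in>UNIV. \<Sum>l\<in>UNIV. \<bar>\<Lambda>a k l\<bar>)" "0 \<le> (\<Sum>k\<in>UNIV. \<bar>\<Lambda>b k\<bar>)" "0 \<le> (\<Sum>k\<in>UNIV. \<bar>\<Lambda>c k\<bar>)"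
    by (auto intro!: sum_nonneg)
  have mono: "coefficient s m \<Longrightarrow> s \<le> \<Lambda> \<Longrightarrow> coefficient \<Lambda> m" for s m
    by (auto simp: coefficient_def intro: order_trans)
  have "\<Lambda>a k l \<le> \<Lambda>" for k l
  proof -
    have "\<bar>\<Lambda>a k l\<bar> \<le> (\<Sum>l\<in>UNIV. \<bar>\<Lambda>a k l\<bar>)" by (rule member_le_sum) auto
    also have "\<dots> \<le> (\<Sum>k\<in>UNIV. \<Sum>l\<in>UNIV. \<bar>\<Lambda>a k l\<bar>)"
      by (rule member_le_sum[of k UNIV "\<lambda>k. \<Sum>l\<in>UNIV. \<bar>\<Lambda>a k l\<bar>"]) (auto intro!: sum_nonneg)
    finally show ?thesis unfolding \<Lambda>_def using nn by linarith
  qed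
  moreover have "\<Lambda>b k \<le> \<Lambda>" for k
  proof -
    have "\<bar>\<Lambda>b k\<bar> \<le> (\<Sum>k\<in>UNIV. \<bar>\<Lambda>b k\<bar>)" by (rule member_le_sum) auto
    then show ?thesis unfolding \<Lambda>_def using nn by linarith
  qed
  moreover have "\<Lambda>c k \<le> \<Lambda>" for k
  proof -
    have "\<bar>\<Lambda>c k\<bar> \<le> (\<Sum>k\<in>UNIV. \<bar>\<Lambda>c k\<bar>)" by (rule member_le_sum) auto
    then show ?thesis unfolding \<Lambda>_def using nn by linarith
  qed
  moreover have "\<Lambda>0 \<le> \<Lambda>" "0 \<le> \<Lambda>" using nn unfolding \<Lambda>_def by linarith+
  ultimately show thesis using 1 2 3 4 mono that[of \<Lambda>] by blast
qed

section \<open>Linearity, continuity and coercivity of the form\<close>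

lemma
  assumes m: "coefficient \<Lambda> m" and "\<Lambda> \<ge> 0" and f: "f \<in> L2 M" and g: "g \<in> L2 M"
  shows coefficient_integrable: "integrable M (\<lambda>x. m x * f x * cnj (g x))"
    and coefficient_bound: "norm (\<integral>x. m x * f x * cnj (g x) \<partial>M) \<le> \<Lambda> * (L2_norm M f * L2_norm M g)"
proof -
  have mf: "(\<lambda>x. m x * f x) \<in> borel_measurable M"
    using m L2_measurable[OF f] by (auto simp: coefficient_def)
  have le: "AE x in M. norm (m x * f x) \<le> norm (complex_of_real \<Lambda> * f x)"
    using m \<open>\<Lambda> \<ge> 0\<close> by (intro AE_I2) (auto simp: coefficient_def norm_mult intro!: mult_right_mono)
  have \<Lambda>f: "(\<lambda>x. complex_of_real \<Lambda> * f x) \<in> L2 M" by (rule L2_cmult[OF f])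
  have mfL: "(\<lambda>x. m x * f x) \<in> L2 M" by (rule L2_dominated[OF \<Lambda>f mf le])
  show "integrable M (\<lambda>x. m x * f x * cnj (g x))" by (rule L2_mult_integrable[OF mfL L2_cnj[OF g]])
  have "norm (\<integral>x. m x * f x * cnj (g x) \<partial>M) \<le> L2_norm M (\<lambda>x. m x * f x) * L2_norm M (\<lambda>x. cnj (g x))"
    by (rule L2_Cauchy_Schwarz[OF mfL L2_cnj[OF g]])
  also have "L2_norm M (\<lambda>x. cnj (g x)) = L2_norm M g" by (simp add: L2_norm_def)
  also have "L2_norm M (\<lambda>x. m x * f x) \<le> L2_norm M (\<lambda>x. complex_of_real \<Lambda> * f x)"
    by (rule L2_norm_mono[OF \<Lambda>f mf le])
  also have "\<dots> = \<Lambda> * L2_norm M f" unfolding L2_norm_cmult using \<open>\<Lambda> \<ge> 0\<close> by simp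
  finally show "norm (\<integral>x. m x * f x * cnj (g x) \<partial>M) \<le> \<Lambda> * (L2_norm M f * L2_norm M g)"
    by (simp add: mult_right_mono mult.assoc)
qed

text \<open>The linear relation is assumed only almost everywhere because the chosen weak
  derivatives satisfy no more than that.\<close>

lemma coefficient_linear:
  assumes m: "coefficient \<Lambda> m" and "\<Lambda> \<ge> 0" and f: "f1 \<in> L2 M" "f2 \<in> L2 M" "f \<in> L2 M" and g: "g \<in> L2 M"
    and eq: "AE x in M. f x = \<alpha> * f1 x + \<beta> * f2 x"
  shows "(\<integral>x. m x * f x * cnj (g x) \<partial>M) =
    \<alpha> * (\<integral>x. m x * f1 x * cnj (g x) \<partial>M) + \<beta> * (\<integral>x. m x * f2 x * cnj (g x) \<partial>M)"
proof -
  note I = coefficient_integrable[OF assms(1,2) _ g]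
  have "(\<integral>x. m x * f x * cnj (g x) \<partial>M)
      = (\<integral>x. \<alpha> * (m x * f1 x * cnj (g x)) + \<beta> * (m x * f2 x * cnj (g x)) \<partial>M)"
  proof (rule integral_cong_AE)
    show "AE x in M. m x * f x * cnj (g x) = \<alpha> * (m x * f1 x * cnj (g x)) + \<beta> * (m x * f2 x * cnj (g x))"
      using eq by eventually_elim (simp add: algebra_simps)
  qed (use I[OF f(1)] I[OF f(2)] I[OF f(3)] in auto)
  then show ?thesis using I[OF f(1)] I[OF f(2)] by simp
qed

lemma A_linear:
  assumes u: "u \<in> H1 \<Omega>" and w: "w \<in> H1 \<Omega>" and v: "v \<in> test_functions \<Omega>"
  shows "A (\<lambda>x. \<alpha> * u x + \<beta> * w x) v = \<alpha> * A u v + \<beta> * A w v"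
proof -
  obtain \<Lambda> where \<Lambda>: "\<Lambda> \<ge> 0" "\<And>k l. coefficient \<Lambda> (\<lambda>x. complex_of_real (a k l x))"
    "\<And>k. coefficient \<Lambda> (b k)" "\<And>k. coefficient \<Lambda> (\<lambda>x. complex_of_real (c k x))" "coefficient \<Lambda> c0"
    by (rule coefficients) blast
  note vL = test_functions_L2[OF v] test_functions_L2[OF test_functions_partial_deriv[OF v]]
  note H = H1_linear[OF u w, of \<alpha> \<beta>]
  note D = coefficient_linear[OF _ \<Lambda>(1) H1_wd_L2[OF u] H1_wd_L2[OF w] H1_wd_L2[OF H] _ wd_linear[OF u w]]
  have eq: "AE x in M. \<alpha> * u x + \<beta> * w x = \<alpha> * u x + \<beta> * w x" by simp
  note D0 = coefficient_linear[OF _ \<Lambda>(1) H1_L2[OF u] H1_L2[OF w] H1_L2[OF H] _ eq]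
  show ?thesis
    unfolding A_pairing_def D[OF \<Lambda>(2) vL(2)] D0[OF \<Lambda>(3) vL(2)] D[OF \<Lambda>(4) vL(1)] D0[OF \<Lambda>(5) vL(1)]
    by (simp add: sum.distrib sum_distrib_left distrib_left add_ac)
qed

lemma A_vanishes_linear:
  assumes "u \<in> H1 \<Omega>" "w \<in> H1 \<Omega>" "A_vanishes \<Omega> a b c c0 u" "A_vanishes \<Omega> a b c c0 w"
  shows "A_vanishes \<Omega> a b c c0 (\<lambda>x. \<alpha> * u x + \<beta> * w x)"
  using assms by (auto simp: A_vanishes_def A_linear)

lemma A_vanishes_diff:
  assumes "u \<in> H1 \<Omega>" "w \<in> H1 \<Omega>" "A_vanishes \<Omega> a b c c0 u" "A_vanishes \<Omega> a b c c0 w"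
  shows "A_vanishes \<Omega> a b c c0 (\<lambda>x. u x - w x)"
proof -
  have "(\<lambda>x. u x - w x) = (\<lambda>x. 1 * u x + (-1) * w x)" by auto
  then show ?thesis using A_vanishes_linear[OF assms, of 1 "-1"] by simp
qed

lemma A_diff:
  "u \<in> H1 \<Omega> \<Longrightarrow> w \<in> H1 \<Omega> \<Longrightarrow> v \<in> test_functions \<Omega> \<Longrightarrow> A (\<lambda>x. u x - w x) v = A u v - A w v"
  using A_linear[of u w v 1 "-1"] by simp

text \<open>Continuity and Garding's inequality with a shared constant. Each lower-order term has a
  factor without derivatives; keeping the product \<open>L2_norm M v * H1_norm \<Omega> v\<close>
  makes it unnecessary to absorb anything into the left-hand side.\<close>

lemma A_bounds:
  obtains K where "K \<ge> 0"
    "\<And>u v. u \<in> H1 \<Omega> \<Longrightarrow> v \<in> test_functions \<Omega> \<Longrightarrow> norm (A u v) \<le> K * (H1_norm \<Omega> u * H1_norm \<Omega> v)"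
    "\<And>v. v \<in> test_functions \<Omega> \<Longrightarrow>
      \<mu> * (H1_norm \<Omega> v)\<^sup>2 \<le> Re (A v v) + K * (L2_norm M v * H1_norm \<Omega> v)"
proof -
  obtain \<Lambda> where \<Lambda>: "\<Lambda> \<ge> 0" "\<And>k l. coefficient \<Lambda> (\<lambda>x. complex_of_real (a k l x))"
    "\<And>k. coefficient \<Lambda> (b k)" "\<And>k. coefficient \<Lambda> (\<lambda>x. complex_of_real (c k x))" "coefficient \<Lambda> c0"
    by (rule coefficients) blast
  define d where "d = real CARD('n)"
  have d: "d \<ge> 0" by (simp add: d_def)
  define A0 where "A0 u v = (\<Sum>k\<in>UNIV. \<Sum>l\<in>UNIV. \<integral>x. complex_of_real (a k l x) * wd l u x *
        cnj (partial_deriv k v x) \<partial>M)" for u v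
  define Ab where "Ab u v = (\<Sum>k\<in>UNIV. \<integral>x. b k x * u x * cnj (partial_deriv k v x) \<partial>M)" for u v
  define Ac where "Ac u v = (\<Sum>k\<in>UNIV. \<integral>x. complex_of_real (c k x) * wd k u x * cnj (v x) \<partial>M)" for u v
  define Az where "Az u v = (\<integral>x. c0 x * u x * cnj (v x) \<partial>M)" for u v
  have A: "A u v = A0 u v + Ab u v + Ac u v + Az u v" for u v
    by (simp add: A_pairing_def A0_def Ab_def Ac_def Az_def)
  have sum_bound: "norm (\<Sum>k\<in>UNIV. f k) \<le> d * B" if "\<And>k. norm (f k) \<le> B" for f :: "'n \<Rightarrow> complex" and B
    using sum_norm_bound[of UNIV f B] that by (simp add: d_def)
  have bounds: "norm (A0 u v) \<le> d * (d * (\<Lambda> * (H1_norm \<Omega> u * H1_norm \<Omega> v)))"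
    "norm (Ab u v) \<le> d * (\<Lambda> * (L2_norm M u * H1_norm \<Omega> v))"
    "norm (Ac u v) \<le> d * (\<Lambda> * (H1_norm \<Omega> u * L2_norm M v))"
    "norm (Az u v) \<le> \<Lambda> * (L2_norm M u * H1_norm \<Omega> v)"
    if u: "u \<in> H1 \<Omega>" and v: "v \<in> test_functions \<Omega>" for u v
  proof -
    note vL = test_functions_L2[OF v] test_functions_L2[OF test_functions_partial_deriv[OF v]]
    have pd: "L2_norm M (partial_deriv k v) \<le> H1_norm \<Omega> v" for k
      using L2_norm_partial_deriv_test[OF v] L2_norm_wd_le_H1_norm by simp
    show "norm (A0 u v) \<le> d * (d * (\<Lambda> * (H1_norm \<Omega> u * H1_norm \<Omega> v)))"
      unfolding A0_def
      by (intro sum_bound order_trans[OF coefficient_bound[OF \<Lambda>(2,1) H1_wd_L2[OF u] vL(2)]]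
          mult_left_mono mult_mono L2_norm_wd_le_H1_norm pd \<Lambda>(1)) auto
    show "norm (Ab u v) \<le> d * (\<Lambda> * (L2_norm M u * H1_norm \<Omega> v))"
      unfolding Ab_def
      by (intro sum_bound order_trans[OF coefficient_bound[OF \<Lambda>(3,1) H1_L2[OF u] vL(2)]]
          mult_left_mono pd \<Lambda>(1)) auto
    show "norm (Ac u v) \<le> d * (\<Lambda> * (H1_norm \<Omega> u * L2_norm M v))"
      unfolding Ac_def
      by (intro sum_bound order_trans[OF coefficient_bound[OF \<Lambda>(4,1) H1_wd_L2[OF u] vL(1)]]
          mult_left_mono mult_right_mono L2_norm_wd_le_H1_norm \<Lambda>(1)) auto
    show "norm (Az u v) \<le> \<Lambda> * (L2_norm M u * H1_norm \<Omega> v)"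
      unfolding Az_def
      by (intro order_trans[OF coefficient_bound[OF \<Lambda>(5,1) H1_L2[OF u] vL(1)]]
          mult_left_mono L2_norm_le_H1_norm \<Lambda>(1)) auto
  qed
  have coercive: "\<mu> * (\<Sum>k\<in>UNIV. (L2_norm M (wd k v))\<^sup>2) \<le> Re (A0 v v)" if v: "v \<in> test_functions \<Omega>" for v
  proof -
    note vL = test_functions_L2[OF v] test_functions_L2[OF test_functions_partial_deriv[OF v]]
    let ?p = "\<lambda>k. partial_deriv k v"
    let ?t = "\<lambda>k l x. complex_of_real (a k l x) * ?p l x * cnj (?p k x)"
    have I: "integrable M (?t k l)" for k l by (rule coefficient_integrable[OF \<Lambda>(2,1) vL(2,2)])
    have "A0 v v = (\<Sum>k\<in>UNIV. \<Sum>l\<in>UNIV. \<integral>x. ?t k l x \<partial>M)"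
      unfolding A0_def
    proof (intro sum.cong refl integral_cong_AE)
      fix k l
      show "AE x in M. complex_of_real (a k l x) * wd l v x * cnj (?p k x) = ?t k l x"
        using wd_test_function[OF v, of l] by eventually_elim simp
      show "(\<lambda>x. complex_of_real (a k l x) * wd l v x * cnj (?p k x)) \<in> borel_measurable M"
        using coefficient_integrable[OF \<Lambda>(2,1) H1_wd_L2[OF test_functions_H1[OF v]] vL(2)] by auto
    qed (use I in auto)
    also have "\<dots> = (\<integral>x. (\<Sum>k\<in>UNIV. \<Sum>l\<in>UNIV. ?t k l x) \<partial>M)"
      using I by (simp add: Bochner_Integration.integral_sum)
    finally have eq: "Re (A0 v v) = (\<integral>x. Re (\<Sum>k\<in>UNIV. \<Sum>l\<in>UNIV. ?t k l x) \<partial>M)"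
      using I by (subst integral_Re) auto
    have "\<mu> * (\<Sum>k\<in>UNIV. (L2_norm M (wd k v))\<^sup>2) = (\<integral>x. \<mu> * (\<Sum>k\<in>UNIV. (norm (?p k x))\<^sup>2) \<partial>M)"
      using L2_integrable[OF vL(2)]
      by (simp add: Bochner_Integration.integral_sum L2_norm_squared flip: L2_norm_partial_deriv_test[OF v])
    also have "\<dots> \<le> (\<integral>x. Re (\<Sum>k\<in>UNIV. \<Sum>l\<in>UNIV. ?t k l x) \<partial>M)"
    proof (rule integral_mono)
      show "integrable M (\<lambda>x. \<mu> * (\<Sum>k\<in>UNIV. (norm (?p k x))\<^sup>2))"
        using L2_integrable[OF vL(2)] by simp
      show "integrable M (\<lambda>x. Re (\<Sum>k\<in>UNIV. \<Sum>l\<in>UNIV. ?t k l x))"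
        using I by (intro integrable_Re Bochner_Integration.integrable_sum)
      fix x assume "x \<in> space M"
      then have x: "x \<in> \<Omega>" by simp
      \<comment> \<open>The form pairs \<open>a k l\<close> with
        \<open>?p l x * cnj (?p k x)\<close>, whereas ellipticity is stated with
        \<open>\<xi> $ k * cnj (\<xi> $ l)\<close>; the conjugated gradient reconciles the two
        without symmetry of \<open>a\<close>.\<close>
      let ?\<xi> = "\<chi> k. cnj (?p k x)"
      have "(norm ?\<xi>)\<^sup>2 = (\<Sum>k\<in>UNIV. (norm (?p k x))\<^sup>2)"
        by (simp add: norm_vec_def L2_set_def sum_nonneg)
      then show "\<mu> * (\<Sum>k\<in>UNIV. (norm (?p k x))\<^sup>2) \<le> Re (\<Sum>k\<in>UNIV. \<Sum>l\<in>UNIV. ?t k l x)"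
        using elliptic[OF x, of ?\<xi>] by (simp add: mult_ac)
    qed
    finally show ?thesis using eq by simp
  qed
  \<comment> \<open>The first summand bounds the leading terms, the next two the lower-order ones;
    \<open>\<mu>\<close> pays for the \<open>L2\<close> part of the \<open>H1\<close> norm, which
    ellipticity does not see.\<close>
  define K where "K = d * (d * \<Lambda>) + 2 * d * \<Lambda> + \<Lambda> + \<mu>"
  have K0: "K \<ge> 0" using d \<Lambda>(1) mu by (simp add: K_def)
  show thesis
  proof (rule that[OF K0])
    fix u v assume u: "u \<in> H1 \<Omega>" and v: "v \<in> test_functions \<Omega>"
    let ?N = "H1_norm \<Omega> u * H1_norm \<Omega> v"
    have "L2_norm M u * H1_norm \<Omega> v \<le> ?N" "H1_norm \<Omega> u * L2_norm M v \<le> ?N"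
      by (auto intro!: mult_right_mono mult_left_mono L2_norm_le_H1_norm)
    then have "norm (Ab u v) \<le> d * (\<Lambda> * ?N)" "norm (Ac u v) \<le> d * (\<Lambda> * ?N)" "norm (Az u v) \<le> \<Lambda> * ?N"
      using d \<Lambda>(1) by (auto intro!: order_trans[OF bounds(2)[OF u v]] order_trans[OF bounds(3)[OF u v]]
          order_trans[OF bounds(4)[OF u v]] mult_left_mono)
    then have "norm (A u v) \<le> d * (d * (\<Lambda> * ?N)) + d * (\<Lambda> * ?N) + d * (\<Lambda> * ?N) + \<Lambda> * ?N"
      unfolding A using bounds(1)[OF u v] by (intro norm_triangle_le add_mono)
    also have "\<dots> = (K - \<mu>) * ?N" by (simp add: K_def algebra_simps)
    also have "\<dots> \<le> K * ?N" using mu by (intro mult_right_mono) auto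
    finally show "norm (A u v) \<le> K * ?N" .
  next
    fix v assume v: "v \<in> test_functions \<Omega>"
    let ?N = "L2_norm M v * H1_norm \<Omega> v"
    note B = bounds[OF test_functions_H1[OF v] v]
    have "\<mu> * (H1_norm \<Omega> v)\<^sup>2 \<le> \<mu> * (L2_norm M v)\<^sup>2 + Re (A0 v v)"
      using coercive[OF v] unfolding H1_norm_squared by (simp add: distrib_left)
    also have "\<mu> * (L2_norm M v)\<^sup>2 \<le> \<mu> * ?N"
      using mu by (auto simp: power2_eq_square intro!: mult_left_mono L2_norm_le_H1_norm)
    also have "Re (A0 v v) = Re (A v v) - Re (Ab v v) - Re (Ac v v) - Re (Az v v)" by (simp add: A)
    also have "\<mu> * ?N + (Re (A v v) - Re (Ab v v) - Re (Ac v v) - Re (Az v v))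
        \<le> \<mu> * ?N + (Re (A v v) + d * (\<Lambda> * ?N) + d * (\<Lambda> * ?N) + \<Lambda> * ?N)"
    proof -
      have "- Re (Ab v v) \<le> d * (\<Lambda> * ?N)" "- Re (Ac v v) \<le> d * (\<Lambda> * ?N)" "- Re (Az v v) \<le> \<Lambda> * ?N"
        using B(2-4) abs_Re_le_cmod[of "Ab v v"] abs_Re_le_cmod[of "Ac v v"] abs_Re_le_cmod[of "Az v v"]
        by (simp_all add: mult.commute)
      then show ?thesis by linarith
    qed
    also have "\<dots> = Re (A v v) + (K - d * (d * \<Lambda>)) * ?N" by (simp add: K_def algebra_simps)
    also have "\<dots> \<le> Re (A v v) + K * ?N"
      using d \<Lambda>(1) by (intro add_left_mono mult_right_mono) auto
    finally show "\<mu> * (H1_norm \<Omega> v)\<^sup>2 \<le> Re (A v v) + K * ?N" by simp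
  qed
qed

lemma A_vanishes_limit:
  assumes u: "\<And>n. u n \<in> H1 \<Omega>" "\<And>n. A_vanishes \<Omega> a b c c0 (u n)" and w: "w \<in> H1 \<Omega>"
    and lim: "(\<lambda>n. H1_norm \<Omega> (\<lambda>x. u n x - w x)) \<longlonglongrightarrow> 0"
  shows "A_vanishes \<Omega> a b c c0 w"
  unfolding A_vanishes_def
proof
  fix v assume v: "v \<in> test_functions \<Omega>"
  obtain K where K: "\<And>u v. u \<in> H1 \<Omega> \<Longrightarrow> v \<in> test_functions \<Omega> \<Longrightarrow> norm (A u v) \<le> K * (H1_norm \<Omega> u * H1_norm \<Omega> v)"
    by (rule A_bounds) blast
  have "norm (A w v) \<le> K * (H1_norm \<Omega> (\<lambda>x. u n x - w x) * H1_norm \<Omega> v)" for n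
  proof -
    have "A (u n) v = 0" using u(2)[of n] v by (simp add: A_vanishes_def)
    then have "A (\<lambda>x. u n x - w x) v = - A w v" using A_diff[OF u(1) w v] by simp
    then show ?thesis using K[OF H1_diff[OF u(1) w] v, of n] by simp
  qed
  moreover have "(\<lambda>n. K * (H1_norm \<Omega> (\<lambda>x. u n x - w x) * H1_norm \<Omega> v)) \<longlonglongrightarrow> K * (0 * H1_norm \<Omega> v)"
    by (intro tendsto_intros lim)
  ultimately have "norm (A w v) \<le> K * (0 * H1_norm \<Omega> v)"
    by (intro LIMSEQ_le_const) auto
  then show "A w v = 0" by simp
qed

text \<open>
  Controlling the \<open>L\<^sub>2\<close> norm of \<open>h\<close> by other means makes it unnecessary to
  invert the operator, and hence to use the compactness of the embedding of \<open>H10\<close>.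
\<close>

lemma Garding:
  obtains K where "K \<ge> 0"
    "\<And>p h. p \<in> H1 \<Omega> \<Longrightarrow> h \<in> H1_0 \<Omega> \<Longrightarrow> A_vanishes \<Omega> a b c c0 (\<lambda>x. p x - h x) \<Longrightarrow>
      H1_norm \<Omega> h \<le> K * (H1_norm \<Omega> p + L2_norm M h)"
proof -
  obtain K where K: "K \<ge> 0"
    "\<And>u v. u \<in> H1 \<Omega> \<Longrightarrow> v \<in> test_functions \<Omega> \<Longrightarrow> norm (A u v) \<le> K * (H1_norm \<Omega> u * H1_norm \<Omega> v)"
    "\<And>v. v \<in> test_functions \<Omega> \<Longrightarrow>
      \<mu> * (H1_norm \<Omega> v)\<^sup>2 \<le> Re (A v v) + K * (L2_norm M v * H1_norm \<Omega> v)"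
    by (rule A_bounds) blast
  show thesis
  proof (rule that[of "K / \<mu>"])
    show "K / \<mu> \<ge> 0" using K(1) mu by simp
    fix p h assume p: "p \<in> H1 \<Omega>" and h: "h \<in> H1_0 \<Omega>" and van: "A_vanishes \<Omega> a b c c0 (\<lambda>x. p x - h x)"
    note hH = H1_0_H1[OF h]
    obtain v where v: "\<And>n. v n \<in> test_functions \<Omega>" "(\<lambda>n. H1_norm \<Omega> (\<lambda>x. v n x - h x)) \<longlonglongrightarrow> 0"
      using h by (auto simp: H1_0_def)
    note vH = test_functions_H1[OF v(1)]
    \<comment> \<open>The second argument of \<open>A\<close> has to be a test function, so the
      estimate is made for approximations \<open>v n\<close> of \<open>h\<close> and passed to the
      limit. The vanishing of \<open>A\<close> at \<open>p - h\<close> replaces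
      \<open>A h (v n)\<close> by \<open>A p (v n)\<close>.\<close>
    have "\<mu> * H1_norm \<Omega> (v n) \<le> K * (H1_norm \<Omega> p + H1_norm \<Omega> (\<lambda>x. v n x - h x) + L2_norm M (v n))" for n
    proof (cases "H1_norm \<Omega> (v n) = 0")
      case True
      then show ?thesis using K(1) by (auto intro!: mult_nonneg_nonneg add_nonneg_nonneg)
    next
      case False
      then have pos: "H1_norm \<Omega> (v n) > 0" by (simp add: order_less_le)
      have "A h (v n) = A p (v n)" using van v(1) A_diff[OF p hH v(1)] by (simp add: A_vanishes_def)
      then have "A (v n) (v n) = A p (v n) + A (\<lambda>x. v n x - h x) (v n)"
        using A_diff[OF vH hH v(1)] by simp
      then have "Re (A (v n) (v n)) \<le> norm (A p (v n)) + norm (A (\<lambda>x. v n x - h x) (v n))"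
        using complex_Re_le_cmod[of "A p (v n)"] complex_Re_le_cmod[of "A (\<lambda>x. v n x - h x) (v n)"] by simp
      also have "\<dots> \<le> K * (H1_norm \<Omega> p * H1_norm \<Omega> (v n)) + K * (H1_norm \<Omega> (\<lambda>x. v n x - h x) * H1_norm \<Omega> (v n))"
        by (intro add_mono K(2) p v H1_diff[OF vH hH])
      finally have "\<mu> * (H1_norm \<Omega> (v n))\<^sup>2 \<le> K * (H1_norm \<Omega> p * H1_norm \<Omega> (v n)) +
          K * (H1_norm \<Omega> (\<lambda>x. v n x - h x) * H1_norm \<Omega> (v n)) + K * (L2_norm M (v n) * H1_norm \<Omega> (v n))"
        using K(3)[OF v(1)[of n]] by linarith
      then have "(\<mu> * H1_norm \<Omega> (v n)) * H1_norm \<Omega> (v n)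
          \<le> (K * (H1_norm \<Omega> p + H1_norm \<Omega> (\<lambda>x. v n x - h x) + L2_norm M (v n))) * H1_norm \<Omega> (v n)"
        by (simp add: power2_eq_square algebra_simps)
      then show ?thesis using pos by (rule mult_right_le_imp_le)
    qed
    moreover have "(\<lambda>n. \<mu> * H1_norm \<Omega> (v n)) \<longlonglongrightarrow> \<mu> * H1_norm \<Omega> h"
      by (intro tendsto_intros H1_norm_tendsto vH hH v(2))
    moreover have "(\<lambda>n. K * (H1_norm \<Omega> p + H1_norm \<Omega> (\<lambda>x. v n x - h x) + L2_norm M (v n)))
        \<longlonglongrightarrow> K * (H1_norm \<Omega> p + 0 + L2_norm M h)"
      by (intro tendsto_intros v(2) L2_norm_tendsto H1_L2 vH hH H1_norm_tendsto_0D(1)[OF vH hH v(2)])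
    ultimately have "\<mu> * H1_norm \<Omega> h \<le> K * (H1_norm \<Omega> p + 0 + L2_norm M h)"
      by (intro LIMSEQ_le) auto
    then show "H1_norm \<Omega> h \<le> K / \<mu> * (H1_norm \<Omega> p + L2_norm M h)"
      using mu by (simp add: field_simps)
  qed
qed

end

section \<open>The Perron solution\<close>

locale perron_solution = elliptic_operator \<Omega> a b c c0 \<mu>
  for \<Omega> :: "(real ^ 'n::finite) set" and a b c c0 \<mu> +
  fixes T :: "(real ^ 'n \<Rightarrow> complex) \<Rightarrow> (real ^ 'n \<Rightarrow> complex)"
  assumes not_eigenvalue: "\<And>u. u \<in> H1_0 \<Omega> \<Longrightarrow> A_vanishes \<Omega> a b c c0 u \<Longrightarrow>
      (AE x in lebesgue_on \<Omega>. u x = 0)"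
    and perron: "perron_operator \<Omega> a b c c0 T"
    and finite_boundary: "emeasure (hausdorff_measure (CARD('n) - 1)) (frontier \<Omega>) < \<infinity>"
    and H1_0_eq: "H1_0 \<Omega> = {u \<in> H1 \<Omega>. is_trace \<Omega> u (\<lambda>z. 0)}"
begin

section \<open>Elementary properties of the Perron operator\<close>

lemma T_continuous: "continuous_on (frontier \<Omega>) \<phi> \<Longrightarrow> continuous_on \<Omega> (T \<phi>)"
  and T_harmonic: "continuous_on (frontier \<Omega>) \<phi> \<Longrightarrow> A_harmonic \<Omega> a b c c0 (T \<phi>)"
  and T_H1_0: "\<Phi> \<in> H1 \<Omega> \<Longrightarrow> continuous_on (closure \<Omega>) \<Phi> \<Longrightarrow> (\<lambda>x. \<Phi> x - T \<Phi> x) \<in> H1_0 \<Omega>"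
  using perron by (simp_all add: perron_operator_def)

lemma T_vanishes: "continuous_on (frontier \<Omega>) \<phi> \<Longrightarrow> A_vanishes \<Omega> a b c c0 (T \<phi>)"
  using T_harmonic by (simp add: A_harmonic_def)

lemma T_diff:
  assumes \<phi>: "continuous_on (frontier \<Omega>) \<phi>" and \<psi>: "continuous_on (frontier \<Omega>) \<psi>" and x: "x \<in> \<Omega>"
  shows "T (\<lambda>y. \<phi> y - \<psi> y) x = T \<phi> x - T \<psi> x"
proof -
  have m: "continuous_on (frontier \<Omega>) (\<lambda>y. (-1) * \<psi> y)" using \<psi> by (intro continuous_intros)
  have "T (\<lambda>y. \<phi> y + (-1) * \<psi> y) x = T \<phi> x + T (\<lambda>y. (-1) * \<psi> y) x"
    using perron \<phi> m x unfolding perron_operator_def by blast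
  also have "T (\<lambda>y. (-1) * \<psi> y) x = (-1) * T \<psi> x"
    using perron \<psi> x unfolding perron_operator_def by blast
  finally show ?thesis by simp
qed

text \<open>Replaces the supremum by an arbitrary bound and the constant by a nonnegative one. The
  supremum is meaningful because a nonempty bounded open set has nonempty boundary.\<close>

lemma T_bounded:
  obtains C where "C \<ge> 0" "\<And>\<phi> B x. continuous_on (frontier \<Omega>) \<phi> \<Longrightarrow>
    (\<And>y. y \<in> frontier \<Omega> \<Longrightarrow> norm (\<phi> y) \<le> B) \<Longrightarrow> x \<in> \<Omega> \<Longrightarrow> norm (T \<phi> x) \<le> C * B"
proof -
  obtain C where C: "\<And>\<phi> x. continuous_on (frontier \<Omega>) \<phi> \<Longrightarrow> x \<in> \<Omega> \<Longrightarrow>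
      norm (T \<phi> x) \<le> C * (SUP y\<in>frontier \<Omega>. norm (\<phi> y))"
    using perron unfolding perron_operator_def by blast
  show thesis
  proof (rule that[of "max C 0"])
    fix \<phi> :: "real ^ 'n \<Rightarrow> complex" and B x assume \<phi>: "continuous_on (frontier \<Omega>) \<phi>"
      and B: "\<And>y. y \<in> frontier \<Omega> \<Longrightarrow> norm (\<phi> y) \<le> B" and x: "x \<in> \<Omega>"
    have ne: "frontier \<Omega> \<noteq> {}"
      using x bounded_Omega not_bounded_UNIV frontier_eq_empty[of \<Omega>] by auto
    then obtain y where y: "y \<in> frontier \<Omega>" by blast
    have "bdd_above ((\<lambda>y. norm (\<phi> y)) ` frontier \<Omega>)" using B by (auto intro!: bdd_aboveI2)
    from cSUP_upper[OF y this] have S0: "0 \<le> (SUP y\<in>frontier \<Omega>. norm (\<phi> y))"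
      using norm_ge_zero[of "\<phi> y"] by linarith
    have "(SUP y\<in>frontier \<Omega>. norm (\<phi> y)) \<le> B" by (rule cSUP_least[OF ne B])
    then have "max C 0 * (SUP y\<in>frontier \<Omega>. norm (\<phi> y)) \<le> max C 0 * B" by (intro mult_left_mono) auto
    moreover have "C * (SUP y\<in>frontier \<Omega>. norm (\<phi> y)) \<le> max C 0 * (SUP y\<in>frontier \<Omega>. norm (\<phi> y))"
      using S0 by (intro mult_right_mono) auto
    ultimately show "norm (T \<phi> x) \<le> max C 0 * B" using C[OF \<phi> x] by linarith
  qed simp
qed

lemma H1_diff_cancel:
  assumes "u \<in> H1 \<Omega>" "(\<lambda>x. u x - w x) \<in> H1 \<Omega>"
  shows "w \<in> H1 \<Omega>"
  using H1_diff[OF assms] by simp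

lemma T_H1: "\<Phi> \<in> H1 \<Omega> \<Longrightarrow> continuous_on (closure \<Omega>) \<Phi> \<Longrightarrow> T \<Phi> \<in> H1 \<Omega>"
  using H1_diff_cancel H1_0_H1[OF T_H1_0] by blast

lemma continuous_frontier: "continuous_on (closure \<Omega>) f \<Longrightarrow> continuous_on (frontier \<Omega>) f"
  by (rule continuous_on_subset[OF _ frontier_subset_closure])

text \<open>Stone-Weierstrass for the real and the imaginary part. Polynomials belong to
  \<open>H1\<close> and are continuous on the closure, which is what ties their images under
  \<open>T\<close> to \<open>H1_0\<close>.\<close>

lemma smooth_approximation:
  assumes \<phi>: "continuous_on (frontier \<Omega>) \<phi>" and "e > 0"
  obtains \<Phi> where "\<And>m. C_k m \<Phi>" "\<And>z. z \<in> frontier \<Omega> \<Longrightarrow> norm (\<phi> z - \<Phi> z) \<le> e"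
proof -
  have c: "compact (frontier \<Omega>)" using bounded_Omega by (simp add: compact_frontier_bounded)
  have re: "continuous_on (frontier \<Omega>) (\<lambda>z. Re (\<phi> z))" and im: "continuous_on (frontier \<Omega>) (\<lambda>z. Im (\<phi> z))"
    using \<phi> by (auto intro: continuous_intros)
  obtain p where p: "real_polynomial_function p" "\<And>z. z \<in> frontier \<Omega> \<Longrightarrow> \<bar>Re (\<phi> z) - p z\<bar> < e / 2"
    using Stone_Weierstrass_real_polynomial_function[OF c re, of "e/2"] \<open>e > 0\<close> by auto
  obtain q where q: "real_polynomial_function q" "\<And>z. z \<in> frontier \<Omega> \<Longrightarrow> \<bar>Im (\<phi> z) - q z\<bar> < e / 2"
    using Stone_Weierstrass_real_polynomial_function[OF c im, of "e/2"] \<open>e > 0\<close> by auto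
  let ?\<Phi> = "\<lambda>z. complex_of_real (p z) + \<i> * complex_of_real (q z)"
  show thesis
  proof (rule that[of ?\<Phi>])
    show "C_k m ?\<Phi>" for m
      by (intro C_k_add C_k_mult C_k_const C_k_real_polynomial_function p q)
    show "norm (\<phi> z - ?\<Phi> z) \<le> e" if "z \<in> frontier \<Omega>" for z
      using cmod_le[of "\<phi> z - ?\<Phi> z"] p(2)[OF that] q(2)[OF that] by simp
  qed
qed

lemma smooth_continuous: "(\<And>m. C_k m \<Phi>) \<Longrightarrow> continuous_on S \<Phi>"
  using C_k_imp_continuous continuous_on_subset by blast

text \<open>The maximum estimate for (a): \<open>u - T \<Phi>\<close> should be the solution with
  boundary values \<open>\<phi> - \<Phi>\<close>, and \<open>T\<close> is bounded. That bound is a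
  hypothesis here so that one constant \<open>C\<close> serves all \<open>e\<close> and all
  \<open>\<Phi>\<close>.\<close>

lemma variational_solution_near_smooth:
  assumes C: "C \<ge> 0" "\<And>\<phi> B x. continuous_on (frontier \<Omega>) \<phi> \<Longrightarrow>
      (\<And>y. y \<in> frontier \<Omega> \<Longrightarrow> norm (\<phi> y) \<le> B) \<Longrightarrow> x \<in> \<Omega> \<Longrightarrow> norm (T \<phi> x) \<le> C * B"
    and u: "variational_solution \<Omega> a b c c0 \<phi> u"
    and e: "e > 0" and \<Phi>: "\<Phi> \<in> H1 \<Omega>" "continuous_on (closure \<Omega>) \<Phi>"
      "\<And>z. z \<in> frontier \<Omega> \<Longrightarrow> norm (\<phi> z - \<Phi> z) \<le> e"
  shows "AE x in M. norm (u x - T \<Phi> x) \<le> C * e"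
proof -
  have uH: "u \<in> H1 \<Omega>" and uA: "A_vanishes \<Omega> a b c c0 u" and tr: "is_trace \<Omega> u \<phi>"
    using u by (auto simp: variational_solution_def A_harmonic_def)
  have \<phi>L: "\<phi> \<in> L2 \<sigma>" using tr by (simp add: is_trace_def)
  have bL: "f \<in> L2 \<sigma>" if "continuous_on (closure \<Omega>) f" for f
    by (rule continuous_L2_boundary[OF finite_boundary continuous_frontier[OF that]])
  obtain w where w: "\<And>n. w n \<in> H1 \<Omega>" "\<And>n. continuous_on (closure \<Omega>) (w n)"
    "(\<lambda>n. H1_norm \<Omega> (\<lambda>x. w n x - u x)) \<longlonglongrightarrow> 0" "(\<lambda>n. L2_norm \<sigma> (\<lambda>z. w n z - \<phi> z)) \<longlonglongrightarrow> 0"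
    using tr unfolding is_trace_def by blast
  define z where "z x = u x - \<Phi> x" for x
  have zH: "z \<in> H1 \<Omega>" unfolding z_def by (rule H1_diff[OF uH \<Phi>(1)])
  define \<zeta> where "\<zeta> n x = w n x - \<Phi> x" for n x
  \<comment> \<open>On the boundary \<open>\<zeta> n\<close> tends in \<open>L2\<close> to
    \<open>\<phi> - \<Phi>\<close>, which \<open>trunc e\<close> fixes; so \<open>p n\<close> has
    the same boundary limit but never exceeds \<open>e\<close>.\<close>
  define p where "p n x = trunc e (\<zeta> n x)" for n x
  define h where "h n x = p n x - T (p n) x" for n x
  have \<zeta>: "\<zeta> n \<in> H1 \<Omega>" "continuous_on (closure \<Omega>) (\<zeta> n)" for n
    unfolding \<zeta>_def by (auto intro!: H1_diff w \<Phi> continuous_intros)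
  have p: "p n \<in> H1 \<Omega>" "H1_norm \<Omega> (p n) \<le> H1_norm \<Omega> (\<zeta> n)" "continuous_on (closure \<Omega>) (p n)" for n
    unfolding p_def using trunc_H1[OF \<zeta>(1)] continuous_on_trunc[OF _ \<zeta>(2)] e by auto
  have h: "h n \<in> H1_0 \<Omega>" for n unfolding h_def by (rule T_H1_0[OF p(1,3)])
  have Tp: "p n x - h n x = T (p n) x" for n x by (simp add: h_def)
  have Tp_bound: "norm (p n x - h n x) \<le> C * e" if "x \<in> \<Omega>" for n x
    unfolding Tp using e that
    by (intro C(2) continuous_frontier p) (auto simp: p_def trunc_bound)
  have Tp_van: "A_vanishes \<Omega> a b c c0 (\<lambda>x. p n x - h n x)" for n
    unfolding Tp by (intro T_vanishes continuous_frontier p)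
  have \<zeta>z: "(\<lambda>x. \<zeta> n x - z x) = (\<lambda>x. w n x - u x)" for n by (auto simp: \<zeta>_def z_def)
  \<comment> \<open>The factor 2 consists of one copy of \<open>w n - \<phi>\<close> for replacing
    \<open>\<zeta> n\<close> by its boundary limit and another from the Lipschitz bound for
    \<open>trunc e\<close>.\<close>
  have \<zeta>p: "L2_norm \<sigma> (\<lambda>y. \<zeta> n y - p n y) \<le> 2 * L2_norm \<sigma> (\<lambda>y. w n y - \<phi> y)" for n
  proof -
    have D: "(\<lambda>y. w n y - \<phi> y) \<in> L2 \<sigma>" by (rule L2_diff[OF bL[OF w(2)] \<phi>L])
    have "L2_norm \<sigma> (\<lambda>y. \<zeta> n y - p n y) \<le> L2_norm \<sigma> (\<lambda>y. 2 * (w n y - \<phi> y))"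
    proof (rule L2_norm_mono[OF L2_cmult[OF D]])
      show "(\<lambda>y. \<zeta> n y - p n y) \<in> borel_measurable \<sigma>"
        by (rule L2_measurable[OF L2_diff[OF bL[OF \<zeta>(2)] bL[OF p(3)]]])
      show "AE y in \<sigma>. norm (\<zeta> n y - p n y) \<le> norm (2 * (w n y - \<phi> y))"
      proof (rule AE_I2)
        fix y assume "y \<in> space \<sigma>"
        then have "trunc e (\<phi> y - \<Phi> y) = \<phi> y - \<Phi> y"
          using \<Phi>(3) by (intro trunc_id) (simp add: space_boundary_measure)
        then have "\<zeta> n y - p n y = (w n y - \<phi> y) + (trunc e (\<phi> y - \<Phi> y) - trunc e (\<zeta> n y))"
          by (simp add: p_def \<zeta>_def)
        also have "norm \<dots> \<le> norm (w n y - \<phi> y) + norm ((\<phi> y - \<Phi> y) - \<zeta> n y)"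
          using e by (intro order_trans[OF norm_triangle_ineq] add_left_mono trunc_Lipschitz) simp
        also have "(\<phi> y - \<Phi> y) - \<zeta> n y = - (w n y - \<phi> y)" by (simp add: \<zeta>_def)
        finally show "norm (\<zeta> n y - p n y) \<le> norm (2 * (w n y - \<phi> y))"
          unfolding norm_minus_cancel norm_mult by simp
      qed
    qed
    then show ?thesis unfolding L2_norm_cmult by simp
  qed
  obtain G where G: "G \<ge> 0" "\<And>p h. p \<in> H1 \<Omega> \<Longrightarrow> h \<in> H1_0 \<Omega> \<Longrightarrow>
      A_vanishes \<Omega> a b c c0 (\<lambda>x. p x - h x) \<Longrightarrow> H1_norm \<Omega> h \<le> G * (H1_norm \<Omega> p + L2_norm M h)"
    by (rule Garding) blast
  \<comment> \<open>\<open>Bp\<close> bounds \<open>\<zeta> m\<close>, and with it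
    \<open>p m\<close>, once \<open>w m\<close> is within 1 of \<open>u\<close>. \<open>Bh\<close>
    is the resulting Garding bound: the \<open>L2\<close> norm of \<open>h\<close> is at most that
    of \<open>p\<close> plus that of \<open>p - h\<close>, which is bounded pointwise by
    \<open>C * e\<close>.\<close>
  define Bp where "Bp = 1 + H1_norm \<Omega> z"
  define Bh where "Bh = G * (Bp + (Bp + C * e * L2_norm M (\<lambda>x. 1)))"
  have h_bound: "H1_norm \<Omega> (h n) \<le> Bh" if "H1_norm \<Omega> (p n) \<le> Bp" for n
  proof -
    note phL = L2_diff[OF H1_L2[OF p(1)[of n]] H1_L2[OF H1_0_H1[OF h[of n]]]]
    have "L2_norm M (h n) = L2_norm M (\<lambda>x. p n x - (p n x - h n x))" by simp
    also have "\<dots> \<le> L2_norm M (p n) + L2_norm M (\<lambda>x. p n x - h n x)"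
      using L2_norm_triangle[OF H1_L2[OF p(1)[of n]] L2_uminus[OF phL]]
        L2_norm_uminus[of M "\<lambda>x. p n x - h n x"] by simp
    also have "\<dots> \<le> Bp + C * e * L2_norm M (\<lambda>x. 1)"
      using L2_norm_le_H1_norm[of "p n"] that C(1) e Tp_bound
      by (intro add_mono L2_norm_bounded_le L2_measurable[OF phL]) auto
    finally have "H1_norm \<Omega> (p n) + L2_norm M (h n) \<le> Bp + (Bp + C * e * L2_norm M (\<lambda>x. 1))"
      using that by simp
    then show ?thesis
      unfolding Bh_def using G(2)[OF p(1) h Tp_van, of n] mult_left_mono[OF _ G(1)] by (meson order_trans)
  qed
  \<comment> \<open>The triples imitate \<open>\<zeta>\<close>, \<open>p\<close>, \<open>h\<close>.
    Only properties stable under midpoints are recorded, because midpoints of truncations are not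
    truncations of anything given. The functional \<open>Q\<close> below omits \<open>f\<close>,
    whose convergence to \<open>z\<close> is built into \<open>K n\<close>.\<close>
  define K where "K n = {(f, q, g). f \<in> H1 \<Omega> \<and> q \<in> H1 \<Omega> \<and> continuous_on (closure \<Omega>) f \<and>
    continuous_on (closure \<Omega>) q \<and> g \<in> H1_0 \<Omega> \<and> A_vanishes \<Omega> a b c c0 (\<lambda>x. q x - g x) \<and>
    (\<forall>x\<in>\<Omega>. norm (q x - g x) \<le> C * e) \<and> H1_norm \<Omega> (\<lambda>x. f x - z x) \<le> inverse (real (Suc n)) \<and>
    L2_norm \<sigma> (\<lambda>y. f y - q y) \<le> inverse (real (Suc n))}" for n
  define mid where "mid = (\<lambda>(f, q, g) (f', q', g').
    ((\<lambda>x. (f x + f' x) / 2) :: real ^ 'n \<Rightarrow> complex, (\<lambda>x. (q x + q' x) / 2) :: real ^ 'n \<Rightarrow> complex,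
     (\<lambda>x. (g x + g' x) / 2) :: real ^ 'n \<Rightarrow> complex))"
  define Q where "Q = (\<lambda>(f :: real ^ 'n \<Rightarrow> complex, q, g). (H1_norm \<Omega> q)\<^sup>2 + (H1_norm \<Omega> g)\<^sup>2)"
  define D where "D = (\<lambda>(f :: real ^ 'n \<Rightarrow> complex, q, g) (f' :: real ^ 'n \<Rightarrow> complex, q', g').
    (H1_norm \<Omega> (\<lambda>x. q x - q' x))\<^sup>2 + (H1_norm \<Omega> (\<lambda>x. g x - g' x))\<^sup>2)"
  obtain X where X: "\<And>n. X n \<in> K n" "\<And>\<epsilon>. \<epsilon> > 0 \<Longrightarrow> \<exists>N. \<forall>m\<ge>N. \<forall>n\<ge>N. D (X m) (X n) < \<epsilon>"
  proof (rule near_minimisers_Cauchy[of K mid D Q "Bp\<^sup>2 + Bh\<^sup>2"])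
    show "K (Suc n) \<subseteq> K n" for n
    proof -
      have "inverse (real (Suc (Suc n))) \<le> inverse (real (Suc n))" by (intro le_imp_inverse_le) auto
      then show ?thesis unfolding K_def by (auto simp del: of_nat_Suc intro: order_trans)
    qed
  next
    fix n X Y assume X: "X \<in> K n" and Y: "Y \<in> K n"
    obtain f q g where Xe: "X = (f, q, g)" by (cases X) auto
    obtain f' q' g' where Ye: "Y = (f', q', g')" by (cases Y) auto
    note X' = X[unfolded K_def Xe, simplified] and Y' = Y[unfolded K_def Ye, simplified]
    have half: "(\<lambda>x. (F x + G x) / 2 - (F' x + G' x) / 2) = (\<lambda>x. (1/2) * (F x - F' x) + (1/2) * (G x - G' x))"
      for F G F' G' :: "real ^ 'n \<Rightarrow> complex" by (auto simp: field_simps)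
    have "(\<lambda>x. (f x + f' x) / 2) \<in> H1 \<Omega>" "(\<lambda>x. (q x + q' x) / 2) \<in> H1 \<Omega>" "(\<lambda>x. (g x + g' x) / 2) \<in> H1_0 \<Omega>"
      using X' Y' by (auto intro: H1_midpoint H1_0_midpoint)
    moreover have "continuous_on (closure \<Omega>) (\<lambda>x. (f x + f' x) / 2)" "continuous_on (closure \<Omega>) (\<lambda>x. (q x + q' x) / 2)"
      using X' Y' by (auto intro!: continuous_intros)
    moreover have "A_vanishes \<Omega> a b c c0 (\<lambda>x. (q x + q' x) / 2 - (g x + g' x) / 2)"
      unfolding half using X' Y' by (intro A_vanishes_linear H1_diff) (auto intro: H1_0_H1)
    moreover have "norm ((q x + q' x) / 2 - (g x + g' x) / 2) \<le> C * e" if "x \<in> \<Omega>" for x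
    proof -
      have le: "norm (q x - g x) \<le> C * e" "norm (q' x - g' x) \<le> C * e" using X' Y' that by auto
      have eq: "(q x + q' x) / 2 - (g x + g' x) / 2 = ((q x - g x) + (q' x - g' x)) / 2"
        by (simp add: field_simps)
      show ?thesis
        unfolding eq using norm_triangle_ineq[of "q x - g x" "q' x - g' x"] le by (simp add: norm_divide)
    qed
    moreover have "H1_norm \<Omega> (\<lambda>x. (f x + f' x) / 2 - z x) \<le> inverse (real (Suc n))"
    proof -
      have H: "(\<lambda>x. f x - z x) \<in> H1 \<Omega>" "(\<lambda>x. f' x - z x) \<in> H1 \<Omega>" using X' Y' zH by (auto intro: H1_diff)
      have "(\<lambda>x. (f x + f' x) / 2 - z x) = (\<lambda>x. (1/2) * ((f x - z x) + (f' x - z x)))"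
        by (auto simp: field_simps)
      then have "H1_norm \<Omega> (\<lambda>x. (f x + f' x) / 2 - z x) = (1/2) * H1_norm \<Omega> (\<lambda>x. (f x - z x) + (f' x - z x))"
        using H1_norm_cmult[OF H1_add[OF H], of "1/2"] by simp
      also have "\<dots> \<le> inverse (real (Suc n))"
        using H1_norm_triangle[OF H] X' Y' by simp
      finally show ?thesis .
    qed
    moreover have "L2_norm \<sigma> (\<lambda>x. (f x + f' x) / 2 - (q x + q' x) / 2) \<le> inverse (real (Suc n))"
    proof -
      have H: "(\<lambda>x. f x - q x) \<in> L2 \<sigma>" "(\<lambda>x. f' x - q' x) \<in> L2 \<sigma>" using X' Y' by (auto intro: L2_diff[OF bL bL])
      have "(\<lambda>x. (f x + f' x) / 2 - (q x + q' x) / 2) = (\<lambda>x. (1/2) * ((f x - q x) + (f' x - q' x)))"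
        by (auto simp: field_simps)
      then have "L2_norm \<sigma> (\<lambda>x. (f x + f' x) / 2 - (q x + q' x) / 2)
          = (1/2) * L2_norm \<sigma> (\<lambda>x. (f x - q x) + (f' x - q' x))"
        using L2_norm_cmult[of \<sigma> "1/2"] by simp
      also have "\<dots> \<le> inverse (real (Suc n))"
        using L2_norm_triangle[OF H] X' Y' by simp
      finally show ?thesis .
    qed
    ultimately show "mid X Y \<in> K n" unfolding Xe Ye mid_def K_def by simp
  next
    fix X Y assume X: "X \<in> K 0" and Y: "Y \<in> K 0"
    obtain f q g where Xe: "X = (f, q, g)" by (cases X) auto
    obtain f' q' g' where Ye: "Y = (f', q', g')" by (cases Y) auto
    have H: "q \<in> H1 \<Omega>" "g \<in> H1 \<Omega>" "q' \<in> H1 \<Omega>" "g' \<in> H1 \<Omega>"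
      using X Y H1_0_H1 unfolding K_def Xe Ye by auto
    show "D X Y \<le> 2 * Q X + 2 * Q Y - 4 * Q (mid X Y)"
      unfolding Xe Ye D_def Q_def mid_def
      using H1_norm_parallelogram[OF H(1,3)] H1_norm_parallelogram[OF H(2,4)] by simp
  next
    fix X show "0 \<le> Q X" by (cases X) (simp add: Q_def)
  next
    fix n
    have "\<forall>\<^sub>F m in sequentially. H1_norm \<Omega> (\<lambda>x. w m x - u x) < inverse (real (Suc n))"
      by (rule order_tendstoD(2)[OF w(3)]) simp
    \<comment> \<open>Half the tolerance, because \<open>\<zeta>p\<close> doubles it.\<close>
    moreover have "\<forall>\<^sub>F m in sequentially. L2_norm \<sigma> (\<lambda>y. w m y - \<phi> y) < inverse (real (Suc n)) / 2"
      by (rule order_tendstoD(2)[OF w(4)]) simp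
    ultimately have "\<forall>\<^sub>F m in sequentially. H1_norm \<Omega> (\<lambda>x. w m x - u x) < inverse (real (Suc n)) \<and>
        L2_norm \<sigma> (\<lambda>y. w m y - \<phi> y) < inverse (real (Suc n)) / 2" by (rule eventually_conj)
    then obtain m where m: "H1_norm \<Omega> (\<lambda>x. w m x - u x) < inverse (real (Suc n))"
        "L2_norm \<sigma> (\<lambda>y. w m y - \<phi> y) < inverse (real (Suc n)) / 2"
      by (auto simp: eventually_sequentially)
    have inK: "(\<zeta> m, p m, h m) \<in> K n"
      unfolding K_def using \<zeta>[of m] p[of m] h[of m] Tp_van[of m] Tp_bound m \<zeta>p[of m] \<zeta>z[of m]
      by (simp del: of_nat_Suc)
    have "inverse (real (Suc n)) \<le> 1" by (simp add: inverse_eq_divide)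
    then have "H1_norm \<Omega> (\<lambda>x. \<zeta> m x - z x) \<le> 1" using m(1) \<zeta>z[of m] by simp
    then have "H1_norm \<Omega> (\<zeta> m) \<le> Bp"
      unfolding Bp_def using H1_norm_triangle[OF H1_diff[OF \<zeta>(1)[of m] zH] zH] by simp
    then have pB: "H1_norm \<Omega> (p m) \<le> Bp" using p(2)[of m] by simp
    have "Q (\<zeta> m, p m, h m) \<le> Bp\<^sup>2 + Bh\<^sup>2"
      unfolding Q_def using pB h_bound[OF pB] by (auto intro!: add_mono power_mono)
    with inK show "\<exists>X\<in>K n. Q X \<le> Bp\<^sup>2 + Bh\<^sup>2" by blast
  qed blast
  define f q g where "f n = fst (X n)" and "q n = fst (snd (X n))" and "g n = snd (snd (X n))" for n
  have fqg: "f n \<in> H1 \<Omega>" "q n \<in> H1 \<Omega>" "continuous_on (closure \<Omega>) (f n)" "continuous_on (closure \<Omega>) (q n)"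
    "g n \<in> H1_0 \<Omega>" "A_vanishes \<Omega> a b c c0 (\<lambda>x. q n x - g n x)" "\<And>x. x \<in> \<Omega> \<Longrightarrow> norm (q n x - g n x) \<le> C * e"
    "H1_norm \<Omega> (\<lambda>x. f n x - z x) \<le> inverse (real (Suc n))"
    "L2_norm \<sigma> (\<lambda>y. f n y - q n y) \<le> inverse (real (Suc n))" for n
    using X(1)[of n] unfolding K_def f_def q_def g_def by (auto simp: split_beta)
  have Dqg: "D (X m) (X n) = (H1_norm \<Omega> (\<lambda>x. q m x - q n x))\<^sup>2 + (H1_norm \<Omega> (\<lambda>x. g m x - g n x))\<^sup>2" for m n
    unfolding D_def q_def g_def by (simp add: split_beta)
  have Cq: "\<exists>N. \<forall>m\<ge>N. \<forall>n\<ge>N. H1_norm \<Omega> (\<lambda>x. q m x - q n x) < \<epsilon>"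
    and Cg: "\<exists>N. \<forall>m\<ge>N. \<forall>n\<ge>N. H1_norm \<Omega> (\<lambda>x. g m x - g n x) < \<epsilon>" if "\<epsilon> > 0" for \<epsilon>
  proof -
    have "\<epsilon>\<^sup>2 > 0" using that by simp
    from X(2)[OF this] obtain N where N: "\<And>m n. m \<ge> N \<Longrightarrow> n \<ge> N \<Longrightarrow> D (X m) (X n) < \<epsilon>\<^sup>2"
      by blast
    have "(H1_norm \<Omega> (\<lambda>x. q m x - q n x))\<^sup>2 < \<epsilon>\<^sup>2" "(H1_norm \<Omega> (\<lambda>x. g m x - g n x))\<^sup>2 < \<epsilon>\<^sup>2"
      if "m \<ge> N" "n \<ge> N" for m n
      using N[OF that] zero_le_power2[of "H1_norm \<Omega> (\<lambda>x. q m x - q n x)"]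
        zero_le_power2[of "H1_norm \<Omega> (\<lambda>x. g m x - g n x)"] unfolding Dqg by linarith+
    then have "H1_norm \<Omega> (\<lambda>x. q m x - q n x) < \<epsilon>" "H1_norm \<Omega> (\<lambda>x. g m x - g n x) < \<epsilon>"
      if "m \<ge> N" "n \<ge> N" for m n
      using that power_less_imp_less_base[of _ 2 \<epsilon>] \<open>\<epsilon> > 0\<close> less_imp_le by blast+
    then show "\<exists>N. \<forall>m\<ge>N. \<forall>n\<ge>N. H1_norm \<Omega> (\<lambda>x. q m x - q n x) < \<epsilon>"
      "\<exists>N. \<forall>m\<ge>N. \<forall>n\<ge>N. H1_norm \<Omega> (\<lambda>x. g m x - g n x) < \<epsilon>" by blast+
  qed
  obtain q' where q': "q' \<in> H1 \<Omega>" "(\<lambda>n. H1_norm \<Omega> (\<lambda>x. q n x - q' x)) \<longlonglongrightarrow> 0"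
    using H1_complete[of q, OF fqg(2) Cq] by blast
  note gH = H1_0_H1[OF fqg(5)]
  obtain g' where g': "g' \<in> H1 \<Omega>" "(\<lambda>n. H1_norm \<Omega> (\<lambda>x. g n x - g' x)) \<longlonglongrightarrow> 0"
    using H1_complete[of g, OF gH Cg] by blast
  have g'0: "g' \<in> H1_0 \<Omega>" by (rule H1_0_closed[OF fqg(5) g'])
  have limqg: "(\<lambda>n. H1_norm \<Omega> (\<lambda>x. (q n x - g n x) - (q' x - g' x))) \<longlonglongrightarrow> 0"
  proof (rule tendsto_sandwich[OF _ _ tendsto_const])
    have "(\<lambda>x. (q n x - g n x) - (q' x - g' x)) = (\<lambda>x. (q n x - q' x) - (g n x - g' x))" for n by auto
    then show "\<forall>\<^sub>F n in sequentially. H1_norm \<Omega> (\<lambda>x. (q n x - g n x) - (q' x - g' x))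
        \<le> H1_norm \<Omega> (\<lambda>x. q n x - q' x) + H1_norm \<Omega> (\<lambda>x. g n x - g' x)"
      using H1_norm_triangle_diff[OF H1_diff[OF fqg(2) q'(1)] H1_diff[OF gH g'(1)]] by simp
    show "(\<lambda>n. H1_norm \<Omega> (\<lambda>x. q n x - q' x) + H1_norm \<Omega> (\<lambda>x. g n x - g' x)) \<longlonglongrightarrow> 0"
      using tendsto_add[OF q'(2) g'(2)] by simp
  qed simp
  note qgH = H1_diff[OF fqg(2) gH] and qg'H = H1_diff[OF q'(1) g'(1)]
  have van: "A_vanishes \<Omega> a b c c0 (\<lambda>x. q' x - g' x)"
    by (rule A_vanishes_limit[OF qgH fqg(6) qg'H limqg])
  have bound: "AE x in M. norm (q' x - g' x) \<le> C * e"
    by (rule L2_limit_norm_le[OF H1_L2[OF qgH] _ H1_L2[OF qg'H] H1_norm_tendsto_0D(1)[OF qgH qg'H limqg]])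
       (use fqg(7) C(1) e in auto)
  \<comment> \<open>The total effect of truncation, \<open>z - q'\<close>, has trace 0:
    \<open>f n - q n\<close> tends to it in \<open>H1\<close> and to 0 on the boundary. The assumed
    description of \<open>H1_0\<close> turns this into membership.\<close>
  have zq: "(\<lambda>x. z x - q' x) \<in> H1_0 \<Omega>"
  proof -
    have 1: "(\<lambda>n. H1_norm \<Omega> (\<lambda>x. (f n x - q n x) - (z x - q' x))) \<longlonglongrightarrow> 0"
    proof (rule tendsto_sandwich[OF _ _ tendsto_const])
      have "(\<lambda>x. (f n x - q n x) - (z x - q' x)) = (\<lambda>x. (f n x - z x) - (q n x - q' x))" for n by auto
      then have "H1_norm \<Omega> (\<lambda>x. (f n x - q n x) - (z x - q' x))
          \<le> inverse (real (Suc n)) + H1_norm \<Omega> (\<lambda>x. q n x - q' x)" for n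
        using H1_norm_triangle_diff[OF H1_diff[OF fqg(1) zH] H1_diff[OF fqg(2) q'(1)], of n n] fqg(8)[of n]
        by simp
      then show "\<forall>\<^sub>F n in sequentially. H1_norm \<Omega> (\<lambda>x. (f n x - q n x) - (z x - q' x))
          \<le> inverse (real (Suc n)) + H1_norm \<Omega> (\<lambda>x. q n x - q' x)" by simp
      show "(\<lambda>n. inverse (real (Suc n)) + H1_norm \<Omega> (\<lambda>x. q n x - q' x)) \<longlonglongrightarrow> 0"
        using tendsto_add[OF LIMSEQ_inverse_real_of_nat q'(2)] by simp
    qed simp
    have 2: "(\<lambda>n. L2_norm \<sigma> (\<lambda>y. (f n y - q n y) - 0)) \<longlonglongrightarrow> 0"
      by (rule tendsto_sandwich[OF _ _ tendsto_const LIMSEQ_inverse_real_of_nat])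
         (use fqg(9) in \<open>auto simp del: of_nat_Suc\<close>)
    have "is_trace \<Omega> (\<lambda>x. z x - q' x) (\<lambda>z. 0)"
      unfolding is_trace_def
    proof (intro conjI exI[of _ "\<lambda>n x. f n x - q n x"] allI)
      show "continuous_on (closure \<Omega>) (\<lambda>x. f n x - q n x)" for n
        using fqg(3,4) by (intro continuous_intros)
    qed (use 1 2 H1_diff[OF zH q'(1)] H1_diff[OF fqg(1,2)] L2_diff[OF bL[OF fqg(3)] bL[OF fqg(4)]] in auto)
    then show ?thesis unfolding H1_0_eq using H1_diff[OF zH q'(1)] by simp
  qed
  \<comment> \<open>The truncation error, the Perron correction of \<open>\<Phi>\<close> and the
    limit of the corrections for \<open>q\<close> add up to the difference of
    \<open>u - T \<Phi>\<close> and \<open>q' - g'\<close>. \<open>A\<close> vanishes at both, so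
    the eigenvalue assumption makes them equal.\<close>
  have "(\<lambda>x. ((z x - q' x) + (\<Phi> x - T \<Phi> x)) + g' x) \<in> H1_0 \<Omega>"
    by (intro H1_0_add zq T_H1_0 \<Phi> g'0)
  also have "(\<lambda>x. ((z x - q' x) + (\<Phi> x - T \<Phi> x)) + g' x) = (\<lambda>x. (u x - T \<Phi> x) - (q' x - g' x))"
    by (auto simp: z_def)
  finally have "(\<lambda>x. (u x - T \<Phi> x) - (q' x - g' x)) \<in> H1_0 \<Omega>" .
  moreover have "A_vanishes \<Omega> a b c c0 (\<lambda>x. (u x - T \<Phi> x) - (q' x - g' x))"
  proof -
    have TH: "T \<Phi> \<in> H1 \<Omega>" by (rule T_H1[OF \<Phi>(1,2)])
    have TA: "A_vanishes \<Omega> a b c c0 (T \<Phi>)" by (intro T_vanishes continuous_frontier \<Phi>)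
    show ?thesis
      by (rule A_vanishes_diff[OF H1_diff[OF uH TH] qg'H A_vanishes_diff[OF uH TH uA TA] van])
  qed
  ultimately have "AE x in M. (u x - T \<Phi> x) - (q' x - g' x) = 0" by (rule not_eigenvalue)
  with bound show ?thesis by eventually_elim simp
qed


text \<open>\<open>T \<phi> - \<Phi>\<close> splits into \<open>T \<phi> - T \<Phi>\<close>, of size
  at most \<open>C * e\<close> on \<open>\<Omega>\<close>, and an element of \<open>H1_0\<close>.
  Removing the level \<open>C * e\<close> kills the first part wherever the second vanishes; so
  approximating the second by test functions leaves remainders that vanish near the
  boundary.\<close>

lemma truncated_difference_H1_0:
  assumes C: "C \<ge> 0" "\<And>\<phi> B x. continuous_on (frontier \<Omega>) \<phi> \<Longrightarrow>
      (\<And>y. y \<in> frontier \<Omega> \<Longrightarrow> norm (\<phi> y) \<le> B) \<Longrightarrow> x \<in> \<Omega> \<Longrightarrow> norm (T \<phi> x) \<le> C * B"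
    and \<phi>: "continuous_on (frontier \<Omega>) \<phi>" and u: "T \<phi> \<in> H1 \<Omega>"
    and e: "e > 0" and \<Phi>: "\<Phi> \<in> H1 \<Omega>" "continuous_on (closure \<Omega>) \<Phi>"
      "\<And>z. z \<in> frontier \<Omega> \<Longrightarrow> norm (\<phi> z - \<Phi> z) \<le> e"
  shows "(\<lambda>x. (T \<phi> x - \<Phi> x) - trunc (C * e) (T \<phi> x - \<Phi> x)) \<in> H1_0 \<Omega>"
proof -
  \<comment> \<open>Soft thresholding. The Lipschitz constant 2 below is the plain sum of those of
    the identity and of \<open>trunc\<close>, and it is good enough.\<close>
  define S where "S t = t - trunc (C * e) t" for t
  have Ce: "C * e \<ge> 0" using C(1) e by simp
  have S_Lip: "norm (S s - S t) \<le> 2 * norm (s - t)" for s t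
  proof -
    have "S s - S t = (s - t) - (trunc (C * e) s - trunc (C * e) t)" by (simp add: S_def)
    then have "norm (S s - S t) \<le> norm (s - t) + norm (trunc (C * e) s - trunc (C * e) t)"
      by (metis norm_triangle_ineq4)
    then show ?thesis using trunc_Lipschitz[OF Ce, of s t] by simp
  qed
  have S_0: "S t = 0" if "norm t \<le> C * e" for t using that by (simp add: S_def trunc_id)
  have S_H1: "(\<lambda>x. S (f x)) \<in> H1 \<Omega>" "H1_norm \<Omega> (\<lambda>x. S (f x)) \<le> 2 * H1_norm \<Omega> f" if "f \<in> H1 \<Omega>" for f
    unfolding S_def using H1_diff[OF that trunc_H1(1)[OF that Ce]]
      H1_norm_triangle_diff[OF that trunc_H1(1)[OF that Ce]] trunc_H1(2)[OF that Ce] by auto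
  have S_cont: "continuous_on X (\<lambda>x. S (f x))" if "continuous_on X f" for X and f :: "real ^ 'n \<Rightarrow> complex"
    unfolding S_def using that by (intro continuous_on_diff continuous_on_trunc Ce)
  have \<Phi>F: "continuous_on (frontier \<Omega>) \<Phi>" by (rule continuous_frontier[OF \<Phi>(2)])
  have TH: "T \<Phi> \<in> H1 \<Omega>" by (rule T_H1[OF \<Phi>(1,2)])
  define g where "g x = \<Phi> x - T \<Phi> x" for x
  have g: "g \<in> H1_0 \<Omega>" unfolding g_def by (rule T_H1_0[OF \<Phi>(1,2)])
  define f where "f x = T \<phi> x - \<Phi> x" for x
  have fH: "f \<in> H1 \<Omega>" unfolding f_def by (rule H1_diff[OF u \<Phi>(1)])
  have "\<forall>n. \<exists>v. v \<in> test_functions \<Omega> \<and> H1_norm \<Omega> (\<lambda>x. v x - g x) < inverse (real (Suc n))"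
  proof
    fix n show "\<exists>v. v \<in> test_functions \<Omega> \<and> H1_norm \<Omega> (\<lambda>x. v x - g x) < inverse (real (Suc n))"
      using H1_0_approx[OF g, of "inverse (real (Suc n))"] by auto
  qed
  from choice[OF this] obtain v where v: "\<And>n. v n \<in> test_functions \<Omega>"
    "\<And>n. H1_norm \<Omega> (\<lambda>x. v n x - g x) < inverse (real (Suc n))" by blast
  \<comment> \<open>\<open>g\<close> is replaced by the test function \<open>v n\<close>: then
    \<open>fv n\<close> tends to \<open>f\<close> in \<open>H1\<close>, and off the support of
    \<open>v n\<close> it equals \<open>T \<phi> - T \<Phi>\<close>, which \<open>S\<close> sends to
    0 on \<open>\<Omega>\<close>.\<close>
  define fv where "fv n x = T \<phi> x - T \<Phi> x - v n x" for n x
  have fvH: "fv n \<in> H1 \<Omega>" for n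
    unfolding fv_def by (intro H1_diff u TH test_functions_H1 v)
  have fv_f: "(\<lambda>x. fv n x - f x) = (\<lambda>x. - (v n x - g x))" for n
    by (auto simp: fv_def f_def g_def)
  have vgH: "(\<lambda>x. v n x - g x) \<in> H1 \<Omega>" for n by (intro H1_diff test_functions_H1 v H1_0_H1 g)
  have fv_f_norm: "H1_norm \<Omega> (\<lambda>x. fv n x - f x) \<le> inverse (real (Suc n))" for n
    unfolding fv_f using H1_norm_cmult[OF vgH[of n], of "-1"] v(2)[of n] by simp
  \<comment> \<open>The values off \<open>\<Omega>\<close> are set to 0 because
    \<open>T \<phi>\<close> is arbitrary there, while continuity on the closure is wanted.\<close>
  define s where "s n x = (if x \<in> \<Omega> then S (fv n x) else 0)" for n x
  have s_S: "AE x in M. s n x = S (fv n x)" for n by (rule AE_I2) (simp add: s_def)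
  have sm: "s n \<in> borel_measurable M" for n
    using L2_measurable[OF H1_L2[OF S_H1(1)[OF fvH[of n]]]]
    by (subst measurable_lebesgue_cong[of _ _ "\<lambda>x. S (fv n x)"]) (auto simp: s_def)
  have sH: "s n \<in> H1 \<Omega>" for n by (rule H1_cong_AE[OF S_H1(1)[OF fvH] sm s_S])
  have s0: "s n \<in> H1_0 \<Omega>" for n
  proof -
    obtain K where K: "compact K" "K \<subseteq> \<Omega>" "\<And>x. x \<notin> K \<Longrightarrow> v n x = 0"
      using v(1)[of n] by (auto elim: test_functionsE)
    have out: "s n x = 0" if "x \<notin> K" for x
    proof (cases "x \<in> \<Omega>")
      case True
      have "norm (T (\<lambda>y. \<phi> y - \<Phi> y) x) \<le> C * e"
        by (intro C(2) True continuous_on_diff \<phi> \<Phi>F \<Phi>(3))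
      then have "norm (fv n x) \<le> C * e" using K(3)[OF that] T_diff[OF \<phi> \<Phi>F True] by (simp add: fv_def)
      then show ?thesis using True by (simp add: s_def S_0)
    qed (simp add: s_def)
    have "continuous_on \<Omega> (fv n)"
      unfolding fv_def by (intro continuous_on_diff T_continuous \<phi> \<Phi>F test_functions_continuous[OF v(1)])
    then have "continuous_on \<Omega> (\<lambda>x. S (fv n x))" by (rule S_cont)
    then have "continuous_on \<Omega> (s n)" by (rule continuous_on_eq) (simp add: s_def)
    moreover have "continuous_on (- K) (s n)"
      by (rule continuous_on_eq[OF continuous_on_const[of _ 0]]) (simp add: out)
    ultimately have "continuous_on (\<Omega> \<union> - K) (s n)"
      using open_Omega K(1) by (intro continuous_on_open_Un) (auto simp: compact_imp_closed)
    then have "continuous_on (closure \<Omega>) (s n)"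
      by (rule continuous_on_subset) (use K(2) in auto)
    moreover have "s n z = 0" if "z \<in> frontier \<Omega>" for z
      using that open_Omega by (auto simp: s_def frontier_def interior_open)
    ultimately have "is_trace \<Omega> (s n) (\<lambda>z. 0)"
      by (intro is_trace_zeroI sH finite_boundary)
    then show ?thesis unfolding H1_0_eq using sH by simp
  qed
  have s_bound: "H1_norm \<Omega> (s n) \<le> 2 * (1 + H1_norm \<Omega> f)" for n
  proof -
    have "H1_norm \<Omega> (s n) = H1_norm \<Omega> (\<lambda>x. S (fv n x))"
      by (rule H1_norm_cong_AE[OF S_H1(1)[OF fvH] sm s_S])
    also have "\<dots> \<le> 2 * H1_norm \<Omega> (fv n)" by (rule S_H1(2)[OF fvH])
    also have "H1_norm \<Omega> (fv n) \<le> H1_norm \<Omega> (\<lambda>x. fv n x - f x) + H1_norm \<Omega> f"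
      using H1_norm_triangle[OF H1_diff[OF fvH[of n] fH] fH] by simp
    also have "\<dots> \<le> 1 + H1_norm \<Omega> f"
    proof -
      have "inverse (real (Suc n)) \<le> 1" by (simp add: inverse_eq_divide)
      then show ?thesis using fv_f_norm[of n] by simp
    qed
    finally show ?thesis by simp
  qed
  \<comment> \<open>The Lipschitz bound for \<open>S\<close> gives convergence of \<open>s n\<close>
    in \<open>L2\<close> only; the uniform \<open>H1\<close> bound and weak closedness of
    \<open>H1_0\<close> make up for this.\<close>
  have "(\<lambda>x. S (f x)) \<in> H1_0 \<Omega>"
  proof (rule H1_0_bounded_L2_limit[OF s0 s_bound H1_L2[OF S_H1(1)[OF fH]]])
    show "(\<lambda>n. L2_norm M (\<lambda>x. s n x - S (f x))) \<longlonglongrightarrow> 0"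
    proof (rule tendsto_sandwich[OF _ _ tendsto_const])
      have "L2_norm M (\<lambda>x. s n x - S (f x)) \<le> 2 * inverse (real (Suc n))" for n
      proof -
        have "L2_norm M (\<lambda>x. s n x - S (f x)) \<le> L2_norm M (\<lambda>x. 2 * (fv n x - f x))"
        proof (rule L2_norm_mono)
          show "(\<lambda>x. 2 * (fv n x - f x)) \<in> L2 M" by (intro L2_cmult H1_L2 H1_diff fvH fH)
          show "(\<lambda>x. s n x - S (f x)) \<in> borel_measurable M"
            by (intro L2_measurable H1_L2 H1_diff sH S_H1(1) fH)
          show "AE x in M. norm (s n x - S (f x)) \<le> norm (2 * (fv n x - f x))"
            unfolding norm_mult using S_Lip by (intro AE_I2) (simp add: s_def)
        qed
        also have "\<dots> = 2 * L2_norm M (\<lambda>x. fv n x - f x)" unfolding L2_norm_cmult by simp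
        finally show ?thesis
          using L2_norm_le_H1_norm[of "\<lambda>x. fv n x - f x"] fv_f_norm[of n] by linarith
      qed
      then show "\<forall>\<^sub>F n in sequentially. L2_norm M (\<lambda>x. s n x - S (f x)) \<le> 2 * inverse (real (Suc n))" by simp
      show "(\<lambda>n. 2 * inverse (real (Suc n))) \<longlonglongrightarrow> 0"
        using tendsto_mult[OF tendsto_const[of 2] LIMSEQ_inverse_real_of_nat] by simp
    qed simp
  qed
  then show ?thesis by (simp add: S_def f_def)
qed

text \<open>Near the boundary \<open>T \<phi> - e k\<close> equals \<open>\<Phi> k + P k\<close>,
  which comes within about \<open>(1 + C) * \<epsilon> k\<close> of \<open>\<phi>\<close>, but a
  single \<open>k\<close> never attains the boundary values. The telescoping sum yields one
  correction that agrees with each \<open>e k\<close> up to \<open>2 * \<eta> k\<close> on a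
  neighbourhood of the boundary depending on \<open>k\<close>.\<close>

lemma continuous_approximation_with_boundary_values:
  assumes \<phi>: "continuous_on (frontier \<Omega>) \<phi>" and u: "T \<phi> \<in> H1 \<Omega>" and \<delta>: "\<delta> > 0"
  obtains w where "w \<in> H1 \<Omega>" "continuous_on (closure \<Omega>) w" "\<And>z. z \<in> frontier \<Omega> \<Longrightarrow> w z = \<phi> z"
    "H1_norm \<Omega> (\<lambda>x. w x - T \<phi> x) \<le> 5 * \<delta>"
proof -
  obtain C where C: "C \<ge> 0" "\<And>\<phi> B x. continuous_on (frontier \<Omega>) \<phi> \<Longrightarrow>
    (\<And>y. y \<in> frontier \<Omega> \<Longrightarrow> norm (\<phi> y) \<le> B) \<Longrightarrow> x \<in> \<Omega> \<Longrightarrow> norm (T \<phi> x) \<le> C * B"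
    by (rule T_bounded) blast
  define \<epsilon> where "\<epsilon> k = (1/2 :: real) ^ k" for k :: nat
  have \<epsilon>: "\<epsilon> k > 0" "\<epsilon> (Suc k) = \<epsilon> k / 2" for k by (simp_all add: \<epsilon>_def)
  have \<epsilon>0: "\<epsilon> \<longlonglongrightarrow> 0" unfolding \<epsilon>_def by (rule LIMSEQ_realpow_zero) auto
  have "\<forall>k. \<exists>\<Phi>. (\<forall>m. C_k m \<Phi>) \<and> (\<forall>z\<in>frontier \<Omega>. norm (\<phi> z - \<Phi> z) \<le> \<epsilon> k)"
    using smooth_approximation[OF \<phi> \<epsilon>(1)] by metis
  from choice[OF this] obtain \<Phi> where \<Phi>: "\<And>k m. C_k m (\<Phi> k)"
    "\<And>k z. z \<in> frontier \<Omega> \<Longrightarrow> norm (\<phi> z - \<Phi> k z) \<le> \<epsilon> k" by blast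
  have \<Phi>c: "continuous_on X (\<Phi> k)" for X k by (rule smooth_continuous[OF \<Phi>(1)])
  have \<Phi>H: "\<Phi> k \<in> H1 \<Omega>" for k by (rule smooth_H1[OF \<Phi>(1)])
  have Ce: "C * \<epsilon> k \<ge> 0" for k using C(1) \<epsilon>(1)[of k] by simp
  define P where "P k x = trunc (C * \<epsilon> k) (T \<phi> x - \<Phi> k x)" for k x
  define S where "S k x = (T \<phi> x - \<Phi> k x) - P k x" for k x
  have P_bound: "norm (P k x) \<le> C * \<epsilon> k" for k x unfolding P_def by (rule trunc_bound[OF Ce])
  have S0: "S k \<in> H1_0 \<Omega>" for k
    unfolding S_def P_def by (rule truncated_difference_H1_0[OF C \<phi> u \<epsilon>(1) \<Phi>H \<Phi>c \<Phi>(2)])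
  \<comment> \<open>The tolerance \<open>\<delta> * \<epsilon> k\<close> makes the \<open>H1\<close>
    norms of the corrections summable with a sum proportional to \<open>\<delta>\<close>.\<close>
  have "\<forall>k. \<exists>v. v \<in> test_functions \<Omega> \<and> H1_norm \<Omega> (\<lambda>x. v x - S k x) < \<delta> * \<epsilon> k"
  proof
    fix k show "\<exists>v. v \<in> test_functions \<Omega> \<and> H1_norm \<Omega> (\<lambda>x. v x - S k x) < \<delta> * \<epsilon> k"
      using H1_0_approx[OF S0, of "\<delta> * \<epsilon> k" k] \<delta> \<epsilon>(1)[of k] by auto
  qed
  from choice[OF this] obtain v where v: "\<And>k. v k \<in> test_functions \<Omega>"
    "\<And>k. H1_norm \<Omega> (\<lambda>x. v k x - S k x) < \<delta> * \<epsilon> k" by blast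
  define e where "e k x = S k x - v k x" for k x
  have eH: "e k \<in> H1 \<Omega>" for k unfolding e_def by (intro H1_diff H1_0_H1 S0 test_functions_H1 v)
  have e_norm: "H1_norm \<Omega> (e k) \<le> \<delta> * \<epsilon> k" for k
    using v(2)[of k] H1_norm_commute[OF test_functions_H1[OF v(1)] H1_0_H1[OF S0], of k k]
    by (simp add: e_def[abs_def])
  have ec: "continuous_on \<Omega> (e k)" for k
    unfolding e_def S_def P_def
    by (intro continuous_on_diff continuous_on_trunc Ce T_continuous \<phi> \<Phi>c test_functions_continuous[OF v(1)])
  \<comment> \<open>Near the boundary the increment of \<open>e\<close> is at most
    \<open>4 * \<epsilon> k + C * \<epsilon> k + C * \<epsilon> (Suc k)\<close>, so truncation at
    \<open>\<eta> k\<close> changes nothing there; elsewhere it forces uniform convergence.\<close>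
  define \<eta> where "\<eta> k = (4 + 2 * C) * \<epsilon> k" for k
  have \<eta>: "\<eta> k \<ge> 0" for k using C(1) \<epsilon>(1)[of k] by (simp add: \<eta>_def)
  define d where "d k x = trunc (\<eta> k) (e (Suc k) x - e k x)" for k x
  have dH: "d k \<in> H1 \<Omega>" and d_norm: "H1_norm \<Omega> (d k) \<le> 2 * \<delta> * \<epsilon> k" for k
  proof -
    note D = H1_diff[OF eH[of "Suc k"] eH[of k]]
    show "d k \<in> H1 \<Omega>" unfolding d_def by (rule trunc_H1(1)[OF D \<eta>])
    have "H1_norm \<Omega> (d k) \<le> H1_norm \<Omega> (\<lambda>x. e (Suc k) x - e k x)"
      unfolding d_def by (rule trunc_H1(2)[OF D \<eta>])
    also have "\<dots> \<le> H1_norm \<Omega> (e (Suc k)) + H1_norm \<Omega> (e k)"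
      by (rule H1_norm_triangle_diff[OF eH eH])
    also have "\<dots> \<le> \<delta> * \<epsilon> (Suc k) + \<delta> * \<epsilon> k" by (intro add_mono e_norm)
    also have "\<dots> \<le> 2 * \<delta> * \<epsilon> k" using \<delta> \<epsilon>(1)[of k] by (simp add: \<epsilon>(2))
    finally show "H1_norm \<Omega> (d k) \<le> 2 * \<delta> * \<epsilon> k" .
  qed
  have d_bound: "norm (d k x) \<le> \<eta> k" for k x unfolding d_def by (rule trunc_bound[OF \<eta>])
  have dc: "continuous_on \<Omega> (d k)" for k
    unfolding d_def by (intro continuous_on_trunc \<eta> continuous_on_diff ec)
  define E where "E N x = e 0 x + (\<Sum>k<N. d k x)" for N x
  have E_Suc: "E (Suc N) x = E N x + d N x" for N x by (simp add: E_def)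
  have EH: "E N \<in> H1 \<Omega>" for N
  proof (induction N)
    case 0 then show ?case using eH[of 0] by (simp add: E_def[abs_def])
  next
    case (Suc N) then show ?case using H1_add[OF Suc dH[of N]] by (simp add: E_Suc[abs_def])
  qed
  \<comment> \<open>\<open>e 0\<close> contributes \<open>\<delta>\<close>, and the increments
    \<open>2 * \<delta> * \<epsilon> k\<close> sum to \<open>4 * \<delta>\<close>; the subtracted
    term is the part of that sum still to come.\<close>
  have E_norm: "H1_norm \<Omega> (E N) \<le> 5 * \<delta> - 4 * \<delta> * \<epsilon> N" for N
  proof (induction N)
    case 0 then show ?case using e_norm[of 0] by (simp add: E_def[abs_def] \<epsilon>_def)
  next
    case (Suc N)
    have "H1_norm \<Omega> (E (Suc N)) \<le> H1_norm \<Omega> (E N) + H1_norm \<Omega> (d N)"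
      using H1_norm_triangle[OF EH[of N] dH[of N]] by (simp add: E_Suc[abs_def])
    also have "\<dots> \<le> (5 * \<delta> - 4 * \<delta> * \<epsilon> N) + 2 * \<delta> * \<epsilon> N" by (intro add_mono Suc d_norm)
    also have "\<dots> = 5 * \<delta> - 4 * \<delta> * \<epsilon> (Suc N)" by (simp add: \<epsilon>(2))
    finally show ?case .
  qed
  have E_norm': "H1_norm \<Omega> (E N) \<le> 5 * \<delta>" for N
    using E_norm[of N] \<delta> \<epsilon>(1)[of N] mult_pos_pos[OF \<delta> \<epsilon>(1)[of N]] by linarith
  have Ec: "continuous_on \<Omega> (E N)" for N
    unfolding E_def by (intro continuous_on_add continuous_on_sum ec dc)
  \<comment> \<open>\<open>2 * \<eta> N\<close> is the sum of the geometric tail of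
    \<open>\<eta>\<close> from \<open>N\<close> on.\<close>
  have E_diff: "norm (E (N + m) x - E N x) \<le> 2 * \<eta> N - 2 * \<eta> (N + m)" for N m x
  proof (induction m)
    case (Suc m)
    have "norm (E (N + Suc m) x - E N x) \<le> norm (E (N + m) x - E N x) + norm (d (N + m) x)"
      using norm_triangle_ineq[of "E (N + m) x - E N x" "d (N + m) x"] by (simp add: E_Suc algebra_simps)
    also have "\<dots> \<le> (2 * \<eta> N - 2 * \<eta> (N + m)) + \<eta> (N + m)" by (intro add_mono Suc d_bound)
    also have "\<dots> = 2 * \<eta> N - 2 * \<eta> (N + Suc m)" by (simp add: \<eta>_def \<epsilon>(2))
    finally show ?case .
  qed simp
  have E_diff': "norm (E m x - E N x) \<le> 2 * \<eta> N" if "N \<le> m" for N m x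
    using E_diff[of N "m - N" x] \<eta>[of m] that by simp
  have \<eta>0: "\<eta> \<longlonglongrightarrow> 0"
    unfolding \<eta>_def using tendsto_mult[OF tendsto_const[of "4 + 2 * C"] \<epsilon>0] by simp
  have conv: "convergent (\<lambda>N. E N x)" for x
  proof (rule Cauchy_convergent, rule CauchyI')
    fix r :: real assume "r > 0"
    then have "\<forall>\<^sub>F N in sequentially. \<eta> N < r / 2" by (intro order_tendstoD(2)[OF \<eta>0]) simp
    then obtain N where N: "\<And>m. m \<ge> N \<Longrightarrow> \<eta> m < r / 2" by (auto simp: eventually_sequentially)
    have "dist (E m x) (E n x) < r" if "N \<le> m" "m < n" for m n
      using E_diff'[of m n x] N[OF that(1)] that by (simp add: dist_norm norm_minus_commute)
    then show "\<exists>N. \<forall>m\<ge>N. \<forall>n>m. dist (E m x) (E n x) < r" by blast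
  qed
  define Einf where "Einf x = lim (\<lambda>N. E N x)" for x
  have E_lim: "(\<lambda>N. E N x) \<longlonglongrightarrow> Einf x" for x
    unfolding Einf_def using conv by (simp add: convergent_LIMSEQ_iff)
  have Einf_diff: "norm (E N x - Einf x) \<le> 2 * \<eta> N" for N x
  proof -
    have "(\<lambda>m. norm (E m x - E N x)) \<longlonglongrightarrow> norm (Einf x - E N x)"
      by (intro tendsto_intros E_lim)
    then have "norm (Einf x - E N x) \<le> 2 * \<eta> N"
      by (rule LIMSEQ_le_const2) (use E_diff' in blast)
    then show ?thesis by (simp add: norm_minus_commute)
  qed
  have Einf_m: "Einf \<in> borel_measurable M"
    by (rule borel_measurable_LIMSEQ_metric[OF L2_measurable[OF H1_L2[OF EH]] E_lim])
  have diffm: "(\<lambda>x. E N x - Einf x) \<in> borel_measurable M" for N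
    by (intro borel_measurable_diff Einf_m L2_measurable[OF H1_L2[OF EH]])
  have Einf_L2: "Einf \<in> L2 M"
  proof -
    have "(\<lambda>x. E 0 x - Einf x) \<in> L2 M"
      by (rule L2_bounded[OF diffm, of _ "2 * \<eta> 0"]) (use Einf_diff in auto)
    from L2_diff[OF H1_L2[OF EH[of 0]] this] show ?thesis by simp
  qed
  have "(\<lambda>N. L2_norm M (\<lambda>x. E N x - Einf x)) \<longlonglongrightarrow> 0"
  proof (rule tendsto_sandwich[OF _ _ tendsto_const])
    show "\<forall>\<^sub>F N in sequentially. L2_norm M (\<lambda>x. E N x - Einf x) \<le> 2 * \<eta> N * L2_norm M (\<lambda>x. 1)"
      using Einf_diff \<eta> by (intro always_eventually allI L2_norm_bounded_le diffm) auto
    show "(\<lambda>N. 2 * \<eta> N * L2_norm M (\<lambda>x. 1)) \<longlonglongrightarrow> 0"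
      using tendsto_mult[OF tendsto_mult[OF tendsto_const[of 2] \<eta>0] tendsto_const[of "L2_norm M (\<lambda>x. 1)"]]
      by simp
  qed simp
  then have EinfH: "Einf \<in> H1 \<Omega>" and Einf_norm: "H1_norm \<Omega> Einf \<le> 5 * \<delta>"
    using H1_bounded_L2_limit[of "H1 \<Omega>" E "5 * \<delta>" Einf, OF _ H1_midpoint EH E_norm' Einf_L2] by blast+
  \<comment> \<open>The boundary values are inserted by hand, which leaves the class of
    \<open>w\<close> in \<open>H1\<close> unchanged; the remaining work is to show that they are
    attained continuously.\<close>
  define w where "w x = (if x \<in> \<Omega> then T \<phi> x - Einf x else \<phi> x)" for x
  have w_eq: "AE x in M. w x = T \<phi> x - Einf x" by (rule AE_I2) (simp add: w_def)
  have wm: "w \<in> borel_measurable M"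
    using L2_measurable[OF H1_L2[OF H1_diff[OF u EinfH]]]
    by (subst measurable_lebesgue_cong[of _ _ "\<lambda>x. T \<phi> x - Einf x"]) (auto simp: w_def)
  have wH: "w \<in> H1 \<Omega>" by (rule H1_cong_AE[OF H1_diff[OF u EinfH] wm w_eq])
  have w_norm: "H1_norm \<Omega> (\<lambda>x. w x - T \<phi> x) \<le> 5 * \<delta>"
  proof -
    have "H1_norm \<Omega> (\<lambda>x. w x - T \<phi> x) = H1_norm \<Omega> (\<lambda>x. (-1) * Einf x)"
    proof (rule H1_norm_cong_AE)
      show "(\<lambda>x. (-1) * Einf x) \<in> H1 \<Omega>" using H1_linear[OF EinfH EinfH, of "-1" 0] by simp
      show "(\<lambda>x. w x - T \<phi> x) \<in> borel_measurable M" by (rule L2_measurable[OF H1_L2[OF H1_diff[OF wH u]]])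
      show "AE x in M. w x - T \<phi> x = (-1) * Einf x" using w_eq by eventually_elim simp
    qed
    then show ?thesis using H1_norm_cmult[OF EinfH, of "-1"] Einf_norm by simp
  qed
  have frontier_out: "z \<notin> \<Omega>" if "z \<in> frontier \<Omega>" for z
    using that open_Omega by (auto simp: frontier_def interior_open)
  have w_frontier: "w z = \<phi> z" if "z \<in> frontier \<Omega>" for z
    using frontier_out[OF that] by (simp add: w_def)
  \<comment> \<open>A neighbourhood of the boundary where \<open>v k\<close> is absent. The factor 4
    leaves room above 3/2, the factor obtained on the boundary itself from the tolerances
    \<open>\<epsilon> k\<close> and \<open>\<epsilon> (Suc k)\<close>, so that the strict inequality
    defines an open set containing the boundary.\<close>
  define U where "U k = - closure {x. v k x \<noteq> 0} \<inter> {x. norm (\<Phi> k x - \<Phi> (Suc k) x) < 4 * \<epsilon> k}" for k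
  have U_open: "open (U k)" for k
    unfolding U_def by (intro open_Int open_Compl closed_closure open_Collect_less continuous_intros \<Phi>c)
  have U_frontier: "frontier \<Omega> \<subseteq> U k" for k
  proof
    fix z assume z: "z \<in> frontier \<Omega>"
    have "closure {x. v k x \<noteq> 0} \<subseteq> \<Omega>" using v(1)[of k] by (simp add: test_functions_def)
    then have "z \<notin> closure {x. v k x \<noteq> 0}" using frontier_out[OF z] by blast
    moreover have "norm (\<Phi> k z - \<Phi> (Suc k) z) < 4 * \<epsilon> k"
    proof -
      have "norm (\<Phi> k z - \<Phi> (Suc k) z) \<le> norm (\<phi> z - \<Phi> (Suc k) z) + norm (\<phi> z - \<Phi> k z)"
        using norm_triangle_ineq4[of "\<phi> z - \<Phi> (Suc k) z" "\<phi> z - \<Phi> k z"] by simp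
      then show ?thesis using \<Phi>(2)[OF z, of k] \<Phi>(2)[OF z, of "Suc k"] \<epsilon>(1)[of k] \<epsilon>(2)[of k] by simp
    qed
    ultimately show "z \<in> U k" by (simp add: U_def)
  qed
  have v0: "v k x = 0" if "x \<in> U k" for k x
    using that closure_subset[of "{x. v k x \<noteq> 0}"] by (auto simp: U_def)
  have d_eq: "d k x = e (Suc k) x - e k x" if "x \<in> U k" "x \<in> U (Suc k)" for k x
  proof -
    have "e (Suc k) x - e k x = (\<Phi> k x - \<Phi> (Suc k) x) + (P k x - P (Suc k) x)"
      using v0[OF that(1)] v0[OF that(2)] by (simp add: e_def S_def)
    also have "norm \<dots> \<le> norm (\<Phi> k x - \<Phi> (Suc k) x) + (norm (P k x) + norm (P (Suc k) x))"
      by (intro order_trans[OF norm_triangle_ineq] add_left_mono norm_triangle_ineq4)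
    also have "\<dots> \<le> 4 * \<epsilon> k + (C * \<epsilon> k + C * \<epsilon> (Suc k))"
      using that(1) by (intro add_mono P_bound) (simp add: U_def)
    also have "\<dots> \<le> \<eta> k" using Ce[of k] by (simp add: \<eta>_def \<epsilon>(2) algebra_simps)
    finally show ?thesis unfolding d_def by (rule trunc_id)
  qed
  \<comment> \<open>Where the truncations up to \<open>N\<close> are all inactive, the sum
    telescopes to the last correction.\<close>
  have E_eq: "E N x = e N x" if "\<And>k. k \<le> N \<Longrightarrow> x \<in> U k" for N x
    using that
  proof (induction N)
    case 0 then show ?case by (simp add: E_def)
  next
    case (Suc N) then show ?case using d_eq[of x N] by (simp add: E_Suc)
  qed
  have w_cont: "continuous_on (closure \<Omega>) w"
    unfolding continuous_on_eq_continuous_within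
  proof
    fix y assume y: "y \<in> closure \<Omega>"
    show "continuous (at y within closure \<Omega>) w"
    proof (cases "y \<in> \<Omega>")
      case True
      have "uniform_limit \<Omega> E Einf sequentially"
      proof (rule uniform_limitI)
        fix r :: real assume "r > 0"
        then have "\<forall>\<^sub>F N in sequentially. \<eta> N < r / 2" by (intro order_tendstoD(2)[OF \<eta>0]) simp
        then show "\<forall>\<^sub>F N in sequentially. \<forall>x\<in>\<Omega>. dist (E N x) (Einf x) < r"
        proof eventually_elim
          case (elim N)
          show ?case
          proof
            fix x show "dist (E N x) (Einf x) < r"
              using Einf_diff[of N x] elim by (simp add: dist_norm)
          qed
        qed
      qed
      then have "continuous_on \<Omega> Einf"
        by (rule uniform_limit_theorem[rotated]) (auto intro: always_eventually Ec)
      then have "continuous_on \<Omega> (\<lambda>x. T \<phi> x - Einf x)" by (intro continuous_on_diff T_continuous \<phi>)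
      then have "continuous_on \<Omega> w" by (rule continuous_on_eq) (simp add: w_def)
      then have "isCont w y" using True open_Omega by (simp add: continuous_on_eq_continuous_at)
      then show ?thesis by (rule continuous_at_imp_continuous_at_within)
    next
      case False
      then have yF: "y \<in> frontier \<Omega>" using y open_Omega by (simp add: frontier_def interior_open)
      show ?thesis
        unfolding continuous_within_eps_delta
      proof (intro allI impI)
        fix r :: real assume r: "r > 0"
        \<comment> \<open>The three errors come from \<open>P N\<close>, from
          \<open>\<Phi> N\<close> at the boundary point and from the tail of the series; the other
          \<open>r / 2\<close> is reserved for the continuity of \<open>\<Phi> N\<close>. Fixing
          \<open>N\<close> first leaves only finitely many \<open>U k\<close> to intersect, so
          \<open>V\<close> is open.\<close>
        have "(\<lambda>N. (C * \<epsilon> N + \<epsilon> N) + 2 * \<eta> N) \<longlonglongrightarrow> (C * 0 + 0) + 2 * 0"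
          by (intro tendsto_intros \<epsilon>0 \<eta>0)
        then have "\<forall>\<^sub>F N in sequentially. (C * \<epsilon> N + \<epsilon> N) + 2 * \<eta> N < r / 2"
          using r by (intro order_tendstoD(2)) auto
        then obtain N where N: "(C * \<epsilon> N + \<epsilon> N) + 2 * \<eta> N < r / 2" by (auto simp: eventually_sequentially)
        define V where "V = (\<Inter>k\<in>{..N}. U k)"
        have "open V" unfolding V_def using U_open by (intro open_INT) auto
        moreover have "y \<in> V" using U_frontier yF by (auto simp: V_def)
        ultimately obtain r1 where r1: "r1 > 0" "ball y r1 \<subseteq> V" by (auto simp: open_contains_ball)
        have "isCont (\<Phi> N) y" using \<Phi>c[of UNIV N] by (simp add: continuous_on_eq_continuous_at)
        then obtain r2 where r2: "r2 > 0" "\<And>x. dist x y < r2 \<Longrightarrow> dist (\<Phi> N x) (\<Phi> N y) < r / 2"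
          using r unfolding continuous_at_eps_delta by (metis half_gt_zero)
        obtain r3 where r3: "r3 > 0" "\<And>x. x \<in> frontier \<Omega> \<Longrightarrow> dist x y < r3 \<Longrightarrow> dist (\<phi> x) (\<phi> y) < r"
          using \<phi>[unfolded continuous_on_iff, rule_format, OF yF r] by blast
        show "\<exists>s>0. \<forall>x\<in>closure \<Omega>. dist x y < s \<longrightarrow> dist (w x) (w y) < r"
        proof (intro exI conjI ballI impI)
          show "min r1 (min r2 r3) > 0" using r1 r2 r3 by simp
          fix x assume x: "x \<in> closure \<Omega>" "dist x y < min r1 (min r2 r3)"
          show "dist (w x) (w y) < r"
          proof (cases "x \<in> \<Omega>")
            case True
            have "x \<in> V" using r1 x(2) by (auto simp: dist_commute)
            then have xU: "x \<in> U k" if "k \<le> N" for k using that by (auto simp: V_def)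
            have "T \<phi> x - E N x = \<Phi> N x + P N x"
              using E_eq[OF xU] v0[OF xU[of N]] by (simp add: e_def S_def)
            then have "w x - w y = (\<Phi> N x - \<Phi> N y) + (P N x - (\<phi> y - \<Phi> N y)) + (E N x - Einf x)"
              using True w_frontier[OF yF] by (simp add: w_def algebra_simps)
            also have "norm \<dots> \<le> norm (\<Phi> N x - \<Phi> N y) + (norm (P N x) + norm (\<phi> y - \<Phi> N y)) + norm (E N x - Einf x)"
              by (intro order_trans[OF norm_triangle_ineq] add_mono norm_triangle_ineq4 order_refl)
            also have "\<dots> < r / 2 + r / 2"
            proof -
              have "norm (\<Phi> N x - \<Phi> N y) < r / 2" using r2(2)[of x] x(2) by (simp add: dist_norm)
              then show ?thesis
                using P_bound[of N x] \<Phi>(2)[OF yF, of N] Einf_diff[of N x] N by linarith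
            qed
            finally show ?thesis by (simp add: dist_norm)
          next
            case False
            then have xF: "x \<in> frontier \<Omega>" using x(1) open_Omega by (simp add: frontier_def interior_open)
            then show ?thesis using r3(2)[OF xF] x(2) w_frontier[OF xF] w_frontier[OF yF] by simp
          qed
        qed
      qed
    qed
  qed
  from wH w_cont w_frontier w_norm show thesis by (rule that)
qed

text \<open>The approximants take the boundary values \<open>\<phi>\<close> exactly, so only
  convergence in \<open>H1\<close> is at stake.\<close>

lemma perron_solution_is_trace:
  assumes \<phi>: "continuous_on (frontier \<Omega>) \<phi>" and u: "T \<phi> \<in> H1 \<Omega>"
  shows "is_trace \<Omega> (T \<phi>) \<phi>"
proof -
  have "\<forall>n. \<exists>w. w \<in> H1 \<Omega> \<and> continuous_on (closure \<Omega>) w \<and> (\<forall>z\<in>frontier \<Omega>. w z = \<phi> z) \<and>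
      H1_norm \<Omega> (\<lambda>x. w x - T \<phi> x) \<le> 5 * inverse (real (Suc n))"
  proof
    fix n
    show "\<exists>w. w \<in> H1 \<Omega> \<and> continuous_on (closure \<Omega>) w \<and> (\<forall>z\<in>frontier \<Omega>. w z = \<phi> z) \<and>
      H1_norm \<Omega> (\<lambda>x. w x - T \<phi> x) \<le> 5 * inverse (real (Suc n))"
      by (rule continuous_approximation_with_boundary_values[OF \<phi> u, of "inverse (real (Suc n))"]) (simp, blast)
  qed
  from choice[OF this] obtain w where w: "\<And>n. w n \<in> H1 \<Omega>" "\<And>n. continuous_on (closure \<Omega>) (w n)"
    "\<And>n z. z \<in> frontier \<Omega> \<Longrightarrow> w n z = \<phi> z"
    "\<And>n. H1_norm \<Omega> (\<lambda>x. w n x - T \<phi> x) \<le> 5 * inverse (real (Suc n))" by blast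
  have "(\<lambda>n. H1_norm \<Omega> (\<lambda>x. w n x - T \<phi> x)) \<longlonglongrightarrow> 0"
  proof (rule tendsto_sandwich[OF _ _ tendsto_const])
    show "\<forall>\<^sub>F n in sequentially. H1_norm \<Omega> (\<lambda>x. w n x - T \<phi> x) \<le> 5 * inverse (real (Suc n))"
      using w(4) by (intro always_eventually allI)
    show "(\<lambda>n. 5 * inverse (real (Suc n))) \<longlonglongrightarrow> 0"
      using tendsto_mult[OF tendsto_const[of 5] LIMSEQ_inverse_real_of_nat] by simp
  qed simp
  moreover have "L2_norm \<sigma> (\<lambda>z. w n z - \<phi> z) = 0" for n
    using L2_norm_boundary_cong[of "\<lambda>z. w n z - \<phi> z" "\<lambda>z. 0"] w(3) by simp
  moreover have "w n \<in> L2 \<sigma>" "\<phi> \<in> L2 \<sigma>" for n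
    using continuous_L2_boundary[OF finite_boundary] continuous_frontier[OF w(2)] \<phi> by auto
  ultimately show ?thesis
    unfolding is_trace_def using u w(1,2) by (intro conjI exI[of _ w]) auto
qed

text \<open>Both functions are within \<open>C * ?e\<close> of \<open>T \<Phi>\<close> for a smooth
  \<open>\<Phi>\<close>. The tolerances run through a sequence so that the exceptional null sets can
  be united.\<close>

lemma variational_solution_eq_perron_solution:
  assumes \<phi>: "continuous_on (frontier \<Omega>) \<phi>" and u: "variational_solution \<Omega> a b c c0 \<phi> u"
  shows "AE x in M. T \<phi> x = u x"
proof -
  obtain C where C: "C \<ge> 0" "\<And>\<phi> B x. continuous_on (frontier \<Omega>) \<phi> \<Longrightarrow>
    (\<And>y. y \<in> frontier \<Omega> \<Longrightarrow> norm (\<phi> y) \<le> B) \<Longrightarrow> x \<in> \<Omega> \<Longrightarrow> norm (T \<phi> x) \<le> C * B"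
    by (rule T_bounded) blast
  have "AE x in M. norm (u x - T \<phi> x) \<le> 2 * C * inverse (real (Suc n))" for n
  proof -
    let ?e = "inverse (real (Suc n))"
    obtain \<Phi> where \<Phi>: "\<And>m. C_k m \<Phi>" "\<And>z. z \<in> frontier \<Omega> \<Longrightarrow> norm (\<phi> z - \<Phi> z) \<le> ?e"
      using smooth_approximation[OF \<phi>, of ?e] by auto
    have \<Phi>c: "continuous_on X \<Phi>" for X by (rule smooth_continuous[OF \<Phi>(1)])
    have "AE x in M. norm (u x - T \<Phi> x) \<le> C * ?e"
      by (rule variational_solution_near_smooth[OF C u _ smooth_H1[OF \<Phi>(1)] \<Phi>c \<Phi>(2)]) simp_all
    moreover have "AE x in M. norm (T \<phi> x - T \<Phi> x) \<le> C * ?e"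
    proof (rule AE_I2)
      fix x assume "x \<in> space M"
      then have x: "x \<in> \<Omega>" by simp
      have "norm (T (\<lambda>y. \<phi> y - \<Phi> y) x) \<le> C * ?e"
        by (intro C(2) continuous_on_diff \<phi> \<Phi>c \<Phi>(2) x)
      then show "norm (T \<phi> x - T \<Phi> x) \<le> C * ?e" by (simp only: T_diff[OF \<phi> \<Phi>c x])
    qed
    ultimately show ?thesis
    proof eventually_elim
      case (elim x)
      have "norm (u x - T \<phi> x) \<le> norm (u x - T \<Phi> x) + norm (T \<phi> x - T \<Phi> x)"
        using norm_triangle_ineq4[of "u x - T \<Phi> x" "T \<phi> x - T \<Phi> x"] by simp
      with elim show ?case by simp
    qed
  qed
  then have "AE x in M. \<forall>n. norm (u x - T \<phi> x) \<le> 2 * C * inverse (real (Suc n))"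
    by (simp add: AE_all_countable)
  then show ?thesis
  proof eventually_elim
    case (elim x)
    have "(\<lambda>n. 2 * C * inverse (real (Suc n))) \<longlonglongrightarrow> 2 * C * 0"
      by (intro tendsto_intros LIMSEQ_inverse_real_of_nat)
    then have "norm (u x - T \<phi> x) \<le> 2 * C * 0"
      by (rule LIMSEQ_le_const) (use elim in blast)
    then show ?case by simp
  qed
qed

end

theorem theorem1p6:
  fixes \<Omega> :: "(real ^ 'n::finite) set"
    and a :: "'n \<Rightarrow> 'n \<Rightarrow> real ^ 'n \<Rightarrow> real"
    and b :: "'n \<Rightarrow> real ^ 'n \<Rightarrow> complex"
    and c :: "'n \<Rightarrow> real ^ 'n \<Rightarrow> real"
    and c0 :: "real ^ 'n \<Rightarrow> complex"
    and \<mu> :: real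
    and T :: "(real ^ 'n \<Rightarrow> complex) \<Rightarrow> (real ^ 'n \<Rightarrow> complex)"
    and \<phi> :: "real ^ 'n \<Rightarrow> complex"
  assumes dim: "CARD('n) \<ge> 2"
    and Omega: "open \<Omega>" "bounded \<Omega>"
    and a: "\<And>k l. a k l \<in> borel_measurable (lebesgue_on \<Omega>)" "\<And>k l. bounded (a k l ` \<Omega>)"
    and b: "\<And>k. b k \<in> borel_measurable (lebesgue_on \<Omega>)" "\<And>k. bounded (b k ` \<Omega>)"
    and c: "\<And>k. c k \<in> borel_measurable (lebesgue_on \<Omega>)" "\<And>k. bounded (c k ` \<Omega>)"
    and c0: "c0 \<in> borel_measurable (lebesgue_on \<Omega>)" "bounded (c0 ` \<Omega>)"
    and mu: "0 < \<mu>" "\<mu> \<le> 1"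
    and elliptic: "\<And>x (\<xi> :: complex ^ 'n). x \<in> \<Omega> \<Longrightarrow>
      Re (\<Sum>k\<in>UNIV. \<Sum>l\<in>UNIV. complex_of_real (a k l x) * \<xi> $ k * cnj (\<xi> $ l)) \<ge> \<mu> * (norm \<xi>)\<^sup>2"
    and not_eigenvalue: "\<And>u. u \<in> H1_0 \<Omega> \<Longrightarrow> A_vanishes \<Omega> a b c c0 u \<Longrightarrow>
      (AE x in lebesgue_on \<Omega>. u x = 0)"
    and perron: "perron_operator \<Omega> a b c c0 T"
    and finite_boundary: "emeasure (hausdorff_measure (CARD('n) - 1)) (frontier \<Omega>) < \<infinity>"
    and H1_0_eq: "H1_0 \<Omega> = {u \<in> H1 \<Omega>. is_trace \<Omega> u (\<lambda>z. 0)}"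
    and phi: "continuous_on (frontier \<Omega>) \<phi>"
  shows "(\<forall>u. \<phi> \<in> Tr \<Omega> \<and> variational_solution \<Omega> a b c c0 \<phi> u \<longrightarrow>
            (AE x in lebesgue_on \<Omega>. T \<phi> x = u x)) \<and>
         (T \<phi> \<in> H1 \<Omega> \<longrightarrow>
            is_trace \<Omega> (T \<phi>) \<phi> \<and>
            variational_solution \<Omega> a b c c0 \<phi> (T \<phi>) \<and>
            (\<forall>u. variational_solution \<Omega> a b c c0 \<phi> u \<longrightarrow> (AE x in lebesgue_on \<Omega>. u x = T \<phi> x)) \<and>
            \<phi> \<in> Tr \<Omega>)"
proof -
  interpret perron_solution \<Omega> a b c c0 \<mu> T
    by unfold_locales (fact Omega a b c c0 mu elliptic not_eigenvalue perron finite_boundary H1_0_eq)+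
  show ?thesis
  proof (intro conjI allI impI)
    fix u assume "\<phi> \<in> Tr \<Omega> \<and> variational_solution \<Omega> a b c c0 \<phi> u"
    then show "AE x in lebesgue_on \<Omega>. T \<phi> x = u x"
      using variational_solution_eq_perron_solution[OF phi] by blast
  next
    assume T: "T \<phi> \<in> H1 \<Omega>"
    show tr: "is_trace \<Omega> (T \<phi>) \<phi>" by (rule perron_solution_is_trace[OF phi T])
    show "variational_solution \<Omega> a b c c0 \<phi> (T \<phi>)"
      using T tr T_harmonic[OF phi] by (simp add: variational_solution_def)
    show "\<phi> \<in> Tr \<Omega>" using T tr by (auto simp: Tr_def is_trace_def)
    fix u assume "variational_solution \<Omega> a b c c0 \<phi> u"
    from variational_solution_eq_perron_solution[OF phi this]
    show "AE x in lebesgue_on \<Omega>. u x = T \<phi> x" by eventually_elim simp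
  qed
qed

end
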